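(* Let $A$ be any commutative unital ring, let $N\subseteq \mathrm{GL}_{2,A}$ be the schematic normalizer of the diagonal torus, let $V$ be the standard comodule of $\mathrm{GL}_{2,A}$, let $d\ge 1$ be an integer, and write $d=2k+1$ if $d$ is odd and $d=2k$ if $d$ is even. Let $\mathrm{Sym}^d(V)\cong\bigoplus_{i=0}^{k}\mathrm{Sym}^d(V)^i$ be the refined weight space decomposition of $\mathrm{Sym}^d(V)$. For each integer $0\le i\le k$ there is a $k[N]$-comodule structure $$\Delta_{N,d,i}:\mathrm{Sym}^d(V)^i\to k[N]\otimes_A\mathrm{Sym}^d(V)^i$$ and $\mathrm{Sym}^d(V)\cong\bigoplus_{i}\mathrm{Sym}^d(V)^i$ is a direct sum decomposition of $k[N]$-comodules. The characters are as follows. If $d=2k+1\geq 1$ is odd, then $$\mathrm{Char}(\mathrm{Sym}^d(V)^i)=x_2^{d-i}x_1^i+x_2^ix_1^{d-i}\quad\text{for } i=0,\dots,k.$$ If $d=2k\ge 2$ is even, then $$\mathrm{Char}(\mathrm{Sym}^d(V)^i)=x_1^{d-i}x_2^i+x_1^ix_2^{d-i}\quad\text{for } i=0,\dots,k-1,\qquad \mathrm{Char}(\mathrm{Sym}^d(V)^k)=x_1^kx_2^k.$$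
   Context: $k[X]$ denotes the coordinate ring (over $A$) of an affine $A$-scheme $X$; the integer $k$ is unrelated. Let $D=x_{11}x_{22}-x_{12}x_{21}$ and $G=\mathrm{GL}_{2,A}=\mathrm{Spec}(k[G])$, $k[G]=A[x_{ij},1/D]$, with comultiplication $x_{ij}\mapsto\sum_l x_{il}\otimes x_{lj}$. Put $I_1=(x_{12},x_{21})$, $I_2=(x_{11},x_{22})$, $k[T]=k[G]/I_1=A[t_1^{\pm1},t_2^{\pm1}]$ (diagonal torus $T$, $t_i$ the class of $x_{ii}$), $k[N]=k[G]/I_1I_2$ (schematic normalizer $N=\mathrm{Spec}(k[N])$ of $T$). The standard comodule (called the standard right comodule in the paper) is the free module $V=A\{e_1,e_2\}$ with $\Delta:V\to k[G]\otimes_A V$, $\Delta(e_1)=x_{11}\otimes e_1+x_{12}\otimes e_2$, $\Delta(e_2)=x_{21}\otimes e_1+x_{22}\otimes e_2$. On $\mathrm{Sym}^d(V)$ the induced comodule map is multiplicative: $e_1^ae_2^b\mapsto\Delta(e_1)^a\Delta(e_2)^b$ ($a+b=d$), and by passing to quotients of $k[G]$ it induces $k[N]$- and $k[T]$-comodule maps $\Delta_{N,d}$, $\Delta_{T,d}$. The $k[N]$-comodule structure on a summand is the restriction of $\Delta_{N,d}$. One has $\Delta_{T,d}(e_2^ie_1^{d-i})=t_1^{d-i}t_2^i\otimes e_2^ie_1^{d-i}$, so the weights of $\mathrm{Sym}^d(V)$ are $\Gamma(d)=\{t_2^it_1^{d-i}:i=0,\dots,d\}$. The Weyl group $S(2)$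 acts on $\Gamma(d)$ by exchanging $t_1,t_2$, with orbits $\Gamma(d,i)=\{t_2^it_1^{d-i},t_2^{d-i}t_1^i\}$, $i=0,\dots,k$ (so $\Gamma(d,k)=\{t_1^kt_2^k\}$ if $d=2k$). Define $\mathrm{Sym}^d(V)^i=\bigoplus_{\lambda\in\Gamma(d,i)}\mathrm{Sym}^d(V)_\lambda$, where $\mathrm{Sym}^d(V)_\lambda$ is the weight space of weight $\lambda$; the decomposition $\mathrm{Sym}^d(V)\cong\bigoplus_{i=0}^k\mathrm{Sym}^d(V)^i$ is the refined weight space decomposition. The character of a $k[T]$-comodule $W$ that is a direct sum of free finite-rank weight spaces is $\mathrm{Char}(W)=\sum_{(a,b)}\mathrm{rank}_A(W_{t_1^at_2^b})\,x_1^ax_2^b$. *)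

theory Defs
  imports
    "HOL-Algebra.Module"
    "HOL-Algebra.QuotRing"
    "HOL-Algebra.Ideal_Product"
    "HOL-Library.Poly_Mapping"
    "HOL-Library.Product_Plus"
begin

text \<open>
  The base ring is an arbitrary commutative ring with carrier (\<^const>\<open>cring\<close>); the zero ring is
  allowed. Modules and algebras over it are \<^type>\<open>module\<close> records. Constructions that only
  concern modules are also given (irrelevant) multiplicative fields, so that one definition serves
  for modules and for algebras.
\<close>


section \<open>Linear algebra over a ring with carrier\<close>

definition regular_mod :: "('a, 'z) ring_scheme \<Rightarrow> ('a, 'a) module" where
  "regular_mod R = \<lparr>carrier = carrier R, mult = mult R, one = \<one>\<^bsub>R\<^esub>, zero = \<zero>\<^bsub>R\<^esub>, add = add R,
     smult = mult R\<rparr>"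

definition lin_map :: "('a, 'z) ring_scheme \<Rightarrow> ('a, 'm, 'y) module_scheme \<Rightarrow>
    ('a, 'n, 'x) module_scheme \<Rightarrow> ('m \<Rightarrow> 'n) set" where
  "lin_map R M N = {f \<in> carrier M \<rightarrow> carrier N.
     (\<forall>u\<in>carrier M. \<forall>v\<in>carrier M. f (u \<oplus>\<^bsub>M\<^esub> v) = f u \<oplus>\<^bsub>N\<^esub> f v) \<and>
     (\<forall>r\<in>carrier R. \<forall>u\<in>carrier M. f (r \<odot>\<^bsub>M\<^esub> u) = r \<odot>\<^bsub>N\<^esub> f u)}"

definition module_span :: "('a, 'z) ring_scheme \<Rightarrow> ('a, 'm, 'y) module_scheme \<Rightarrow> 'm set \<Rightarrow> 'm set" where
  "module_span R M S = \<Inter>{H. submodule H R M \<and> S \<subseteq> H}"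

text \<open>The quotient of a module by a submodule, or of an algebra by an ideal.\<close>

definition quot_mod :: "('a, 'm, 'y) module_scheme \<Rightarrow> 'm set \<Rightarrow> ('a, 'm set) module" where
  "quot_mod M J = \<lparr>carrier = carrier (M Quot J), mult = mult (M Quot J), one = \<one>\<^bsub>M Quot J\<^esub>,
     zero = \<zero>\<^bsub>M Quot J\<^esub>, add = add (M Quot J),
     smult = (\<lambda>r X. \<Union>x\<in>X. J +>\<^bsub>M\<^esub> (r \<odot>\<^bsub>M\<^esub> x))\<rparr>"

text \<open>
  Internal direct sum of submodules over a possibly infinite index set. The families are
  extensional functions, so that uniqueness is meaningful.
\<close>

definition is_direct_sum :: "('a, 'z) ring_scheme \<Rightarrow> ('a, 'm, 'y) module_scheme \<Rightarrow>
    'i set \<Rightarrow> ('i \<Rightarrow> 'm set) \<Rightarrow> bool" where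
  "is_direct_sum R M I W \<longleftrightarrow> (\<forall>i\<in>I. submodule (W i) R M) \<and>
     (\<forall>v\<in>carrier M. \<exists>!f. f \<in> (\<Pi>\<^sub>E i\<in>I. W i) \<and> finite {i\<in>I. f i \<noteq> \<zero>\<^bsub>M\<^esub>} \<and>
        v = (\<Oplus>\<^bsub>M\<^esub>i\<in>{i\<in>I. f i \<noteq> \<zero>\<^bsub>M\<^esub>}. f i))"

text \<open>
  The basis is a family and not a set. Over a nonzero ring the rank \<open>n\<close> is unique; over the zero
  ring every module is free of every rank.
\<close>

definition free_of_rank :: "('a, 'z) ring_scheme \<Rightarrow> ('a, 'm, 'y) module_scheme \<Rightarrow> nat \<Rightarrow> bool" where
  "free_of_rank R M n \<longleftrightarrow> (\<exists>e \<in> {..<n} \<rightarrow> carrier M. \<forall>v\<in>carrier M.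
     \<exists>!c. c \<in> {..<n} \<rightarrow>\<^sub>E carrier R \<and> v = (\<Oplus>\<^bsub>M\<^esub>j\<in>{..<n}. c j \<odot>\<^bsub>M\<^esub> e j))"


section \<open>Monoid algebras and polynomial rings\<close>

text \<open>
  The monoid algebra of \<open>G\<close>: finitely supported functions with the convolution product. As a
  module it is the free module on the carrier of \<open>G\<close>.
\<close>

definition monoid_alg :: "('a, 'z) ring_scheme \<Rightarrow> ('g, 'y) monoid_scheme \<Rightarrow> ('a, 'g \<Rightarrow> 'a) module" where
  "monoid_alg R G = \<lparr>
     carrier = {f. (\<forall>g. f g \<in> carrier R) \<and> {g. f g \<noteq> \<zero>\<^bsub>R\<^esub>} \<subseteq> carrier G \<and> finite {g. f g \<noteq> \<zero>\<^bsub>R\<^esub>}},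
     mult = (\<lambda>f f' x. \<Oplus>\<^bsub>R\<^esub>p\<in>{p. f (fst p) \<noteq> \<zero>\<^bsub>R\<^esub> \<and> f' (snd p) \<noteq> \<zero>\<^bsub>R\<^esub> \<and> fst p \<otimes>\<^bsub>G\<^esub> snd p = x}.
               f (fst p) \<otimes>\<^bsub>R\<^esub> f' (snd p)),
     one = (\<lambda>x. if x = \<one>\<^bsub>G\<^esub> then \<one>\<^bsub>R\<^esub> else \<zero>\<^bsub>R\<^esub>),
     zero = (\<lambda>x. \<zero>\<^bsub>R\<^esub>),
     add = (\<lambda>f f' x. f x \<oplus>\<^bsub>R\<^esub> f' x),
     smult = (\<lambda>r f x. r \<otimes>\<^bsub>R\<^esub> f x)\<rparr>"

definition basis_elt :: "('a, 'z) ring_scheme \<Rightarrow> 'g \<Rightarrow> 'g \<Rightarrow> 'a" where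
  "basis_elt R g = (\<lambda>x. if x = g then \<one>\<^bsub>R\<^esub> else \<zero>\<^bsub>R\<^esub>)"

text \<open>Exponent vectors; used for finite types \<open>'v\<close> of variables only.\<close>

definition exponents :: "('v \<Rightarrow> nat) monoid" where
  "exponents = \<lparr>carrier = UNIV, mult = (\<lambda>m n v. m v + n v), one = (\<lambda>v. 0)\<rparr>"

definition mpoly :: "('a, 'z) ring_scheme \<Rightarrow> ('a, ('v \<Rightarrow> nat) \<Rightarrow> 'a) module" where
  "mpoly R = monoid_alg R exponents"

definition pvar :: "('a, 'z) ring_scheme \<Rightarrow> 'v \<Rightarrow> ('v \<Rightarrow> nat) \<Rightarrow> 'a" where
  "pvar R v = basis_elt R (\<lambda>w. if w = v then 1 else 0)"

text \<open>The \<open>R\<close>-algebra homomorphism from the polynomial ring to \<open>B\<close> sending each variable \<open>v\<close> to \<open>\<phi> v\<close>.\<close>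

definition peval :: "('a, 'z) ring_scheme \<Rightarrow> ('a, 'b, 'y) module_scheme \<Rightarrow> ('v \<Rightarrow> 'b) \<Rightarrow>
    (('v \<Rightarrow> nat) \<Rightarrow> 'a) \<Rightarrow> 'b" where
  "peval R B \<phi> f = (\<Oplus>\<^bsub>B\<^esub>m\<in>{m. f m \<noteq> \<zero>\<^bsub>R\<^esub>}. f m \<odot>\<^bsub>B\<^esub> (\<Otimes>\<^bsub>B\<^esub>v\<in>UNIV. \<phi> v [^]\<^bsub>B\<^esub> m v))"


section \<open>Tensor products\<close>

definition bilin_rels :: "('a, 'z) ring_scheme \<Rightarrow> ('a, 'm, 'y) module_scheme \<Rightarrow>
    ('a, 'n, 'x) module_scheme \<Rightarrow> ('m \<times> 'n \<Rightarrow> 'a) set" where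
  "bilin_rels R M N = (let F = monoid_alg R (M \<times>\<times> N); b = (\<lambda>m n. basis_elt R (m, n)) in
     {b (m \<oplus>\<^bsub>M\<^esub> m') n \<ominus>\<^bsub>F\<^esub> (b m n \<oplus>\<^bsub>F\<^esub> b m' n) | m m' n.
        m \<in> carrier M \<and> m' \<in> carrier M \<and> n \<in> carrier N} \<union>
     {b m (n \<oplus>\<^bsub>N\<^esub> n') \<ominus>\<^bsub>F\<^esub> (b m n \<oplus>\<^bsub>F\<^esub> b m n') | m n n'.
        m \<in> carrier M \<and> n \<in> carrier N \<and> n' \<in> carrier N} \<union>
     {b (r \<odot>\<^bsub>M\<^esub> m) n \<ominus>\<^bsub>F\<^esub> (r \<odot>\<^bsub>F\<^esub> b m n) | r m n.
        r \<in> carrier R \<and> m \<in> carrier M \<and> n \<in> carrier N} \<union>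
     {b m (r \<odot>\<^bsub>N\<^esub> n) \<ominus>\<^bsub>F\<^esub> (r \<odot>\<^bsub>F\<^esub> b m n) | r m n.
        r \<in> carrier R \<and> m \<in> carrier M \<and> n \<in> carrier N})"

definition tensor_rels :: "('a, 'z) ring_scheme \<Rightarrow> ('a, 'm, 'y) module_scheme \<Rightarrow>
    ('a, 'n, 'x) module_scheme \<Rightarrow> ('m \<times> 'n \<Rightarrow> 'a) set" where
  "tensor_rels R M N = module_span R (monoid_alg R (M \<times>\<times> N)) (bilin_rels R M N)"

text \<open>
  The free module on pairs modulo bilinearity. When \<open>M\<close> and \<open>N\<close> are algebras, the relations form an
  ideal of the monoid algebra, and the quotient multiplication is
  \<open>(m \<otimes> n) (m' \<otimes> n') = m m' \<otimes> n n'\<close>.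
\<close>

definition tensor :: "('a, 'z) ring_scheme \<Rightarrow> ('a, 'm, 'y) module_scheme \<Rightarrow>
    ('a, 'n, 'x) module_scheme \<Rightarrow> ('a, ('m \<times> 'n \<Rightarrow> 'a) set) module" where
  "tensor R M N = quot_mod (monoid_alg R (M \<times>\<times> N)) (tensor_rels R M N)"

definition tens :: "('a, 'z) ring_scheme \<Rightarrow> ('a, 'm, 'y) module_scheme \<Rightarrow>
    ('a, 'n, 'x) module_scheme \<Rightarrow> 'm \<Rightarrow> 'n \<Rightarrow> ('m \<times> 'n \<Rightarrow> 'a) set" where
  "tens R M N m n = tensor_rels R M N +>\<^bsub>monoid_alg R (M \<times>\<times> N)\<^esub> basis_elt R (m, n)"

text \<open>
  The linear map to \<open>P\<close> that a bilinear \<open>\<beta>\<close> induces on a tensor product. The value does not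
  depend on the representative of the coset, so the image of the coset is a singleton.
\<close>

definition tlift :: "('a, 'z) ring_scheme \<Rightarrow> ('a, 'p, 'y) module_scheme \<Rightarrow> ('m \<Rightarrow> 'n \<Rightarrow> 'p) \<Rightarrow>
    ('m \<times> 'n \<Rightarrow> 'a) set \<Rightarrow> 'p" where
  "tlift R P \<beta> X = the_elem
     ((\<lambda>\<phi>. \<Oplus>\<^bsub>P\<^esub>p\<in>{p. \<phi> p \<noteq> \<zero>\<^bsub>R\<^esub>}. \<phi> p \<odot>\<^bsub>P\<^esub> \<beta> (fst p) (snd p)) ` X)"

text \<open>\<open>f \<otimes> g\<close> with values in \<open>tensor R P Q\<close>.\<close>

definition tmap :: "('a, 'z) ring_scheme \<Rightarrow> ('a, 'p, 'y) module_scheme \<Rightarrow> ('a, 'q, 'x) module_scheme \<Rightarrow>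
    ('m \<Rightarrow> 'p) \<Rightarrow> ('n \<Rightarrow> 'q) \<Rightarrow> ('m \<times> 'n \<Rightarrow> 'a) set \<Rightarrow> ('p \<times> 'q \<Rightarrow> 'a) set" where
  "tmap R P Q f g = tlift R (tensor R P Q) (\<lambda>m n. tens R P Q (f m) (g n))"

text \<open>\<open>(L \<otimes> M) \<otimes> N \<rightarrow> L \<otimes> (M \<otimes> N)\<close>\<close>

definition tassoc :: "('a, 'z) ring_scheme \<Rightarrow> ('a, 'l, 'y) module_scheme \<Rightarrow>
    ('a, 'm, 'x) module_scheme \<Rightarrow> ('a, 'n, 'w) module_scheme \<Rightarrow>
    (('l \<times> 'm \<Rightarrow> 'a) set \<times> 'n \<Rightarrow> 'a) set \<Rightarrow> ('l \<times> ('m \<times> 'n \<Rightarrow> 'a) set \<Rightarrow> 'a) set" where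
  "tassoc R L M N = (let P = tensor R L (tensor R M N) in
     tlift R P (\<lambda>t n. tlift R P (\<lambda>l m. tens R L (tensor R M N) l (tens R M N m n)) t))"


section \<open>Coalgebras and comodules\<close>

definition coalgebra :: "('a, 'z) ring_scheme \<Rightarrow> ('a, 'c, 'y) module_scheme \<Rightarrow>
    ('c \<Rightarrow> ('c \<times> 'c \<Rightarrow> 'a) set) \<Rightarrow> ('c \<Rightarrow> 'a) \<Rightarrow> bool" where
  "coalgebra R C \<Delta> \<epsilon> \<longleftrightarrow> module R C \<and>
     \<Delta> \<in> lin_map R C (tensor R C C) \<and> \<epsilon> \<in> lin_map R C (regular_mod R) \<and>
     (\<forall>c\<in>carrier C.
        tassoc R C C C (tmap R (tensor R C C) C \<Delta> id (\<Delta> c)) = tmap R C (tensor R C C) id \<Delta> (\<Delta> c) \<and>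
        tlift R C (\<lambda>x y. \<epsilon> x \<odot>\<^bsub>C\<^esub> y) (\<Delta> c) = c \<and>
        tlift R C (\<lambda>x y. \<epsilon> y \<odot>\<^bsub>C\<^esub> x) (\<Delta> c) = c)"

text \<open>The coaction is a map \<open>\<delta> : M \<rightarrow> C \<otimes> M\<close>, with the coalgebra on the left.\<close>

definition comodule :: "('a, 'z) ring_scheme \<Rightarrow> ('a, 'c, 'y) module_scheme \<Rightarrow>
    ('c \<Rightarrow> ('c \<times> 'c \<Rightarrow> 'a) set) \<Rightarrow> ('c \<Rightarrow> 'a) \<Rightarrow>
    ('a, 'm, 'x) module_scheme \<Rightarrow> ('m \<Rightarrow> ('c \<times> 'm \<Rightarrow> 'a) set) \<Rightarrow> bool" where
  "comodule R C \<Delta> \<epsilon> M \<delta> \<longleftrightarrow> coalgebra R C \<Delta> \<epsilon> \<and> module R M \<and>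
     \<delta> \<in> lin_map R M (tensor R C M) \<and>
     (\<forall>v\<in>carrier M.
        tassoc R C C M (tmap R (tensor R C C) M \<Delta> id (\<delta> v)) = tmap R C (tensor R C M) id \<delta> (\<delta> v) \<and>
        tlift R M (\<lambda>c w. \<epsilon> c \<odot>\<^bsub>M\<^esub> w) (\<delta> v) = v)"

text \<open>
  The comodule \<open>(M, \<delta>)\<close> is the internal direct sum of the comodules \<open>(W i, \<delta>' i)\<close>. Since
  \<open>C \<otimes> W i\<close> is not literally a subset of \<open>C \<otimes> M\<close>, that \<open>\<delta>' i\<close> is the restriction of \<open>\<delta>\<close> is
  expressed through the map \<open>C \<otimes> W i \<rightarrow> C \<otimes> M\<close> induced by the inclusion.
\<close>

definition comodule_direct_sum :: "('a, 'z) ring_scheme \<Rightarrow> ('a, 'c, 'y) module_scheme \<Rightarrow>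
    ('c \<Rightarrow> ('c \<times> 'c \<Rightarrow> 'a) set) \<Rightarrow> ('c \<Rightarrow> 'a) \<Rightarrow>
    ('a, 'm) module \<Rightarrow> ('m \<Rightarrow> ('c \<times> 'm \<Rightarrow> 'a) set) \<Rightarrow>
    'i set \<Rightarrow> ('i \<Rightarrow> 'm set) \<Rightarrow> ('i \<Rightarrow> 'm \<Rightarrow> ('c \<times> 'm \<Rightarrow> 'a) set) \<Rightarrow> bool" where
  "comodule_direct_sum R C \<Delta> \<epsilon> M \<delta> I W \<delta>' \<longleftrightarrow>
     comodule R C \<Delta> \<epsilon> M \<delta> \<and> is_direct_sum R M I W \<and>
     (\<forall>i\<in>I. comodule R C \<Delta> \<epsilon> (M\<lparr>carrier := W i\<rparr>) (\<delta>' i) \<and>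
        (\<forall>w\<in>W i. tmap R C M id id (\<delta>' i w) = \<delta> w))"

text \<open>The maps induced by \<open>\<Delta>\<close> and \<open>\<epsilon>\<close> on the quotient of \<open>C\<close> by a Hopf ideal \<open>J\<close>.\<close>

definition quot_comult :: "('a, 'z) ring_scheme \<Rightarrow> ('a, 'c, 'y) module_scheme \<Rightarrow> 'c set \<Rightarrow>
    ('c \<Rightarrow> ('c \<times> 'c \<Rightarrow> 'a) set) \<Rightarrow> 'c set \<Rightarrow> ('c set \<times> 'c set \<Rightarrow> 'a) set" where
  "quot_comult R C J \<Delta> X = (let Q = quot_mod C J; \<pi> = (\<lambda>c. J +>\<^bsub>C\<^esub> c) in
     the_elem ((\<lambda>c. tmap R Q Q \<pi> \<pi> (\<Delta> c)) ` X))"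

definition quot_counit :: "('c \<Rightarrow> 'a) \<Rightarrow> 'c set \<Rightarrow> 'a" where
  "quot_counit \<epsilon> X = the_elem (\<epsilon> ` X)"


section \<open>The group scheme \<open>GL\<^sub>2\<close>, its diagonal torus, and the normalizer of the torus\<close>

datatype gvar = X11 | X12 | X21 | X22 | Dinv

type_synonym 'a kG = "((gvar \<Rightarrow> nat) \<Rightarrow> 'a) set"

definition det_poly :: "('a, 'z) ring_scheme \<Rightarrow> (gvar \<Rightarrow> nat) \<Rightarrow> 'a" where
  "det_poly R = (let P = mpoly R in
     pvar R X11 \<otimes>\<^bsub>P\<^esub> pvar R X22 \<ominus>\<^bsub>P\<^esub> pvar R X12 \<otimes>\<^bsub>P\<^esub> pvar R X21)"

definition det_ideal :: "('a, 'z) ring_scheme \<Rightarrow> ((gvar \<Rightarrow> nat) \<Rightarrow> 'a) set" where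
  "det_ideal R = (let P = mpoly R in Idl\<^bsub>P\<^esub> {pvar R Dinv \<otimes>\<^bsub>P\<^esub> det_poly R \<ominus>\<^bsub>P\<^esub> \<one>\<^bsub>P\<^esub>})"

text \<open>
  The localization \<open>R[x\<^sub>i\<^sub>j, 1/D]\<close>, presented as \<open>R[x\<^sub>i\<^sub>j, y] / (y D - 1)\<close>; the variable \<open>Dinv\<close> is \<open>y\<close>.
\<close>

definition kG :: "('a, 'z) ring_scheme \<Rightarrow> ('a, 'a kG) module" where
  "kG R = quot_mod (mpoly R) (det_ideal R)"

definition xG :: "('a, 'z) ring_scheme \<Rightarrow> gvar \<Rightarrow> 'a kG" where
  "xG R v = det_ideal R +>\<^bsub>mpoly R\<^esub> pvar R v"

text \<open>The value on \<open>1/D\<close> is forced, because \<open>D\<close> is grouplike.\<close>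

definition comultG_gen :: "('a, 'z) ring_scheme \<Rightarrow> gvar \<Rightarrow> ('a kG \<times> 'a kG \<Rightarrow> 'a) set" where
  "comultG_gen R v = (let T = tensor R (kG R) (kG R);
       t = (\<lambda>v w. tens R (kG R) (kG R) (xG R v) (xG R w)) in
     (case v of
        X11 \<Rightarrow> t X11 X11 \<oplus>\<^bsub>T\<^esub> t X12 X21
      | X12 \<Rightarrow> t X11 X12 \<oplus>\<^bsub>T\<^esub> t X12 X22
      | X21 \<Rightarrow> t X21 X11 \<oplus>\<^bsub>T\<^esub> t X22 X21
      | X22 \<Rightarrow> t X21 X12 \<oplus>\<^bsub>T\<^esub> t X22 X22
      | Dinv \<Rightarrow> t Dinv Dinv))"

definition comultG :: "('a, 'z) ring_scheme \<Rightarrow> 'a kG \<Rightarrow> ('a kG \<times> 'a kG \<Rightarrow> 'a) set" where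
  "comultG R X = the_elem (peval R (tensor R (kG R) (kG R)) (comultG_gen R) ` X)"

definition counitG :: "('a, 'z) ring_scheme \<Rightarrow> 'a kG \<Rightarrow> 'a" where
  "counitG R X = the_elem (peval R (regular_mod R)
     (\<lambda>v. if v \<in> {X12, X21} then \<zero>\<^bsub>R\<^esub> else \<one>\<^bsub>R\<^esub>) ` X)"

definition I1 :: "('a, 'z) ring_scheme \<Rightarrow> 'a kG set" where
  "I1 R = Idl\<^bsub>kG R\<^esub> {xG R X12, xG R X21}"

definition I2 :: "('a, 'z) ring_scheme \<Rightarrow> 'a kG set" where
  "I2 R = Idl\<^bsub>kG R\<^esub> {xG R X11, xG R X22}"

definition IN :: "('a, 'z) ring_scheme \<Rightarrow> 'a kG set" where
  "IN R = I1 R \<cdot>\<^bsub>kG R\<^esub> I2 R"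

definition kT :: "('a, 'z) ring_scheme \<Rightarrow> ('a, 'a kG set) module" where
  "kT R = quot_mod (kG R) (I1 R)"

definition comultT :: "('a, 'z) ring_scheme \<Rightarrow> 'a kG set \<Rightarrow> ('a kG set \<times> 'a kG set \<Rightarrow> 'a) set" where
  "comultT R = quot_comult R (kG R) (I1 R) (comultG R)"

definition counitT :: "('a, 'z) ring_scheme \<Rightarrow> 'a kG set \<Rightarrow> 'a" where
  "counitT R = quot_counit (counitG R)"

definition projT :: "('a, 'z) ring_scheme \<Rightarrow> 'a kG \<Rightarrow> 'a kG set" where
  "projT R g = I1 R +>\<^bsub>kG R\<^esub> g"

definition kN :: "('a, 'z) ring_scheme \<Rightarrow> ('a, 'a kG set) module" where
  "kN R = quot_mod (kG R) (IN R)"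

definition comultN :: "('a, 'z) ring_scheme \<Rightarrow> 'a kG set \<Rightarrow> ('a kG set \<times> 'a kG set \<Rightarrow> 'a) set" where
  "comultN R = quot_comult R (kG R) (IN R) (comultG R)"

definition counitN :: "('a, 'z) ring_scheme \<Rightarrow> 'a kG set \<Rightarrow> 'a" where
  "counitN R = quot_counit (counitG R)"

definition projN :: "('a, 'z) ring_scheme \<Rightarrow> 'a kG \<Rightarrow> 'a kG set" where
  "projN R g = IN R +>\<^bsub>kG R\<^esub> g"

text \<open>The quotient map \<open>k[N] \<rightarrow> k[T]\<close>, that is, restriction of functions from \<open>N\<close> to \<open>T\<close>.\<close>

definition resNT :: "('a, 'z) ring_scheme \<Rightarrow> 'a kG set \<Rightarrow> 'a kG set" where
  "resNT R X = the_elem (projT R ` X)"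

text \<open>The character \<open>t\<^sub>1\<^sup>a t\<^sub>2\<^sup>b\<close> of the torus; the exponents are integers, as \<open>t\<^sub>1\<close> and \<open>t\<^sub>2\<close> are units of \<open>k[T]\<close>.\<close>

definition wt :: "('a, 'z) ring_scheme \<Rightarrow> int \<Rightarrow> int \<Rightarrow> 'a kG set" where
  "wt R a b = projT R (xG R X11) [^]\<^bsub>kT R\<^esub> a \<otimes>\<^bsub>kT R\<^esub> projT R (xG R X22) [^]\<^bsub>kT R\<^esub> b"


section \<open>The symmetric powers of the standard comodule\<close>

datatype evar = E1 | E2

type_synonym 'a symV = "(evar \<Rightarrow> nat) \<Rightarrow> 'a"

text \<open>
  As \<open>V\<close> is free on \<open>e\<^sub>1, e\<^sub>2\<close>, its symmetric algebra is the polynomial ring \<open>R[e\<^sub>1, e\<^sub>2]\<close>, and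
  \<open>Sym\<^sup>d(V)\<close> consists of the forms of degree \<open>d\<close>; in particular \<open>V = Sym\<^sup>1(V)\<close>.
\<close>

definition Sym :: "('a, 'z) ring_scheme \<Rightarrow> nat \<Rightarrow> ('a, 'a symV) module" where
  "Sym R d = (mpoly R)\<lparr>carrier :=
     {f \<in> carrier (mpoly R). \<forall>m. f m \<noteq> \<zero>\<^bsub>R\<^esub> \<longrightarrow> m E1 + m E2 = d}\<rparr>"

definition std_coaction :: "('a, 'z) ring_scheme \<Rightarrow> evar \<Rightarrow> ('a kG \<times> 'a symV \<Rightarrow> 'a) set" where
  "std_coaction R e = (let S = mpoly R; T = tensor R (kG R) S;
       t = (\<lambda>v w. tens R (kG R) S (xG R v) (pvar R w)) in
     (case e of
        E1 \<Rightarrow> t X11 E1 \<oplus>\<^bsub>T\<^esub> t X12 E2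
      | E2 \<Rightarrow> t X21 E1 \<oplus>\<^bsub>T\<^esub> t X22 E2))"

text \<open>The multiplicative extension \<open>e\<^sub>1\<^sup>a e\<^sub>2\<^sup>b \<mapsto> \<Delta>(e\<^sub>1)\<^sup>a \<Delta>(e\<^sub>2)\<^sup>b\<close>, computed in the algebra \<open>k[G] \<otimes> Sym(V)\<close>.\<close>

definition coactSym :: "('a, 'z) ring_scheme \<Rightarrow> 'a symV \<Rightarrow> ('a kG \<times> 'a symV \<Rightarrow> 'a) set" where
  "coactSym R = peval R (tensor R (kG R) (mpoly R)) (std_coaction R)"

definition hom_part :: "('a, 'z) ring_scheme \<Rightarrow> nat \<Rightarrow> 'a symV \<Rightarrow> 'a symV" where
  "hom_part R d f = (\<lambda>m. if m E1 + m E2 = d then f m else \<zero>\<^bsub>R\<^esub>)"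

text \<open>
  \<^const>\<open>coactSym\<close> maps \<open>Sym\<^sup>d(V)\<close> into the image of \<open>k[G] \<otimes> Sym\<^sup>d(V)\<close> in \<open>k[G] \<otimes> Sym(V)\<close>. As
  \<open>Sym\<^sup>d(V)\<close> is a direct summand of \<open>Sym(V)\<close>, \<open>id \<otimes> hom_part d\<close> recovers the element of
  \<open>k[G] \<otimes> Sym\<^sup>d(V)\<close>.
\<close>

definition coactG :: "('a, 'z) ring_scheme \<Rightarrow> nat \<Rightarrow> 'a symV \<Rightarrow> ('a kG \<times> 'a symV \<Rightarrow> 'a) set" where
  "coactG R d f = tmap R (kG R) (Sym R d) id (hom_part R d) (coactSym R f)"

definition coactN :: "('a, 'z) ring_scheme \<Rightarrow> nat \<Rightarrow> 'a symV \<Rightarrow> ('a kG set \<times> 'a symV \<Rightarrow> 'a) set" where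
  "coactN R d f = tmap R (kN R) (Sym R d) (projN R) id (coactG R d f)"

definition coactT :: "('a, 'z) ring_scheme \<Rightarrow> nat \<Rightarrow> 'a symV \<Rightarrow> ('a kG set \<times> 'a symV \<Rightarrow> 'a) set" where
  "coactT R d f = tmap R (kT R) (Sym R d) (projT R) id (coactG R d f)"

definition weight_space :: "('a, 'z) ring_scheme \<Rightarrow> ('a, 'm, 'y) module_scheme \<Rightarrow>
    ('m \<Rightarrow> ('a kG set \<times> 'm \<Rightarrow> 'a) set) \<Rightarrow> 'a kG set \<Rightarrow> 'm set" where
  "weight_space R M \<delta> t = {v \<in> carrier M. \<delta> v = tens R (kT R) M t v}"

text \<open>The orbit \<open>\<Gamma>(d,i)\<close>, a set with one element if \<open>d = 2 i\<close>; meant for \<open>i \<le> d\<close>.\<close>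

definition orbit_wts :: "('a, 'z) ring_scheme \<Rightarrow> nat \<Rightarrow> nat \<Rightarrow> 'a kG set set" where
  "orbit_wts R d i = {wt R (int (d - i)) (int i), wt R (int i) (int (d - i))}"

definition refined :: "('a, 'z) ring_scheme \<Rightarrow> nat \<Rightarrow> nat \<Rightarrow> 'a symV set" where
  "refined R d i = {(\<Oplus>\<^bsub>Sym R d\<^esub>t\<in>orbit_wts R d i. f t) | f.
     f \<in> (\<Pi> t\<in>orbit_wts R d i. weight_space R (Sym R d) (coactT R d) t)}"

definition refined_mod :: "('a, 'z) ring_scheme \<Rightarrow> nat \<Rightarrow> nat \<Rightarrow> ('a, 'a symV) module" where
  "refined_mod R d i = (Sym R d)\<lparr>carrier := refined R d i\<rparr>"


section \<open>Characters\<close>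

text \<open>Characters are integral Laurent polynomials in \<open>x\<^sub>1, x\<^sub>2\<close>, indexed by the pairs of exponents.\<close>

type_synonym laurent2 = "(int \<times> int) \<Rightarrow>\<^sub>0 int"

definition x1 :: laurent2 where "x1 = Poly_Mapping.single (1, 0) 1"

definition x2 :: laurent2 where "x2 = Poly_Mapping.single (0, 1) 1"

text \<open>
  \<open>has_char R M \<delta> \<chi>\<close>: the \<open>k[T]\<close>-comodule \<open>(M, \<delta>)\<close> is the direct sum of its weight spaces, these are free
  of finite rank, and \<open>\<chi>\<close> is the generating function of the ranks. A relation is used because the
  character is only defined for such comodules, and because ranks are not unique over the zero
  ring; over a nonzero ring, \<open>\<chi>\<close> is determined by \<open>(M, \<delta>)\<close>.
\<close>

definition has_char :: "('a, 'z) ring_scheme \<Rightarrow> ('a, 'm, 'y) module_scheme \<Rightarrow>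
    ('m \<Rightarrow> ('a kG set \<times> 'm \<Rightarrow> 'a) set) \<Rightarrow> laurent2 \<Rightarrow> bool" where
  "has_char R M \<delta> \<chi> \<longleftrightarrow>
     comodule R (kT R) (comultT R) (counitT R) M \<delta> \<and>
     is_direct_sum R M UNIV (\<lambda>(a, b). weight_space R M \<delta> (wt R a b)) \<and>
     (\<forall>a b. \<exists>n. free_of_rank R (M\<lparr>carrier := weight_space R M \<delta> (wt R a b)\<rparr>) n \<and>
        Poly_Mapping.lookup \<chi> (a, b) = int n)"

text \<open>The \<open>k[T]\<close>-coaction underlying a \<open>k[N]\<close>-coaction on \<open>M\<close>.\<close>

definition restrict_to_T :: "('a, 'z) ring_scheme \<Rightarrow> ('a, 'm, 'y) module_scheme \<Rightarrow>
    ('m \<Rightarrow> ('a kG set \<times> 'm \<Rightarrow> 'a) set) \<Rightarrow> 'm \<Rightarrow> ('a kG set \<times> 'm \<Rightarrow> 'a) set" where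
  "restrict_to_T R M \<delta> v = tmap R (kT R) M (resNT R) id (\<delta> v)"

end

theory Submission
  imports Defs
begin

text \<open>
  In \<open>k[N]\<close> all products of an off-diagonal with a diagonal coordinate vanish, so for \<open>(a,b) \<noteq> (0,0)\<close> the
  coaction of \<open>N\<close> maps \<open>e\<^sub>1\<^sup>a e\<^sub>2\<^sup>b\<close> to
  \<open>x\<^sub>1\<^sub>1\<^sup>a x\<^sub>2\<^sub>2\<^sup>b \<otimes> e\<^sub>1\<^sup>a e\<^sub>2\<^sup>b + x\<^sub>1\<^sub>2\<^sup>a x\<^sub>2\<^sub>1\<^sup>b \<otimes> e\<^sub>1\<^sup>b e\<^sub>2\<^sup>a\<close>.
  Hence it preserves the span of every set of nonconstant monomials that is stable under exchanging
  \<open>e\<^sub>1\<close> and \<open>e\<^sub>2\<close>. Such a span is a direct summand of \<open>Sym(V)\<close>, which makes tensoring its inclusion with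
  \<open>k[N]\<close> injective, so the comodule axioms are inherited from \<open>Sym(V)\<close>. As the characters of the torus are
  linearly independent, the weight spaces are spanned by single monomials, and the refined summands
  are the spans of the orbits \<open>{e\<^sub>1\<^sup>d\<^sup>-\<^sup>i e\<^sub>2\<^sup>i, e\<^sub>1\<^sup>i e\<^sub>2\<^sup>d\<^sup>-\<^sup>i}\<close>. All coactions are algebra homomorphisms, so
  that identities between them need only be checked on generators.
\<close>

section \<open>Linear maps and generators\<close>

text \<open>The constant monomial is excluded for a reason: there the two-term formula would give
  \<open>1 \<otimes> 1\<close> twice, whereas the coaction gives it once. The main obstacle is that
  \<open>C \<otimes> W\<close> is a quotient of a free module on pairs and not a subset of
  \<open>C \<otimes> M\<close>; over a general ring the induced map may even fail to be injective.
  If \<open>p\<close> is a linear projection of \<open>M\<close> onto \<open>W\<close>, then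
  \<open>id \<otimes> p\<close> is a left inverse of that map, so equations in
  \<open>C \<otimes> W\<close> may be tested in \<open>C \<otimes> M\<close>. Here \<open>p\<close>
  is always truncation of a polynomial to a set of monomials, and for this reason
  \<open>Sym^d(V)\<close>, the refined summands and the weight spaces are all handled as modules of
  polynomials with prescribed support. Independence of the torus characters enters through a
  homomorphism from \<open>k[T]\<close> to a Laurent polynomial ring that sends them to the basis
  elements: pairing the Laurent coefficient of an exponent with the polynomial coefficient of the
  same exponent defines a functional on \<open>k[T] \<otimes> Sym(V)\<close> that reads the
  coefficients of a form from its coaction.\<close>

lemma lin_mapI:
  assumes "\<And>x. x \<in> carrier M \<Longrightarrow> f x \<in> carrier N"
    and "\<And>x y. x \<in> carrier M \<Longrightarrow> y \<in> carrier M \<Longrightarrow> f (x \<oplus>\<^bsub>M\<^esub> y) = f x \<oplus>\<^bsub>N\<^esub> f y"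
    and "\<And>r x. r \<in> carrier R \<Longrightarrow> x \<in> carrier M \<Longrightarrow> f (r \<odot>\<^bsub>M\<^esub> x) = r \<odot>\<^bsub>N\<^esub> f x"
  shows "f \<in> lin_map R M N"
  using assms unfolding lin_map_def by auto

lemma lin_closed: "f \<in> lin_map R M N \<Longrightarrow> x \<in> carrier M \<Longrightarrow> f x \<in> carrier N"
  and lin_add: "f \<in> lin_map R M N \<Longrightarrow> x \<in> carrier M \<Longrightarrow> y \<in> carrier M \<Longrightarrow>
    f (x \<oplus>\<^bsub>M\<^esub> y) = f x \<oplus>\<^bsub>N\<^esub> f y"
  and lin_smult: "f \<in> lin_map R M N \<Longrightarrow> r \<in> carrier R \<Longrightarrow> x \<in> carrier M \<Longrightarrow>
    f (r \<odot>\<^bsub>M\<^esub> x) = r \<odot>\<^bsub>N\<^esub> f x"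
  unfolding lin_map_def by auto

lemma lin_cong:
  assumes "f \<in> lin_map R M N" "\<And>x. x \<in> carrier M \<Longrightarrow> f x = g x" "module R M"
  shows "g \<in> lin_map R M N"
proof -
  interpret M: module R M by fact
  show ?thesis
    using assms(1) by (intro lin_mapI) (simp_all add: assms(2)[symmetric] lin_closed lin_add lin_smult)
qed

lemma lin_zero:
  fixes M (structure)
  assumes "f \<in> lin_map R M N" "module R M" "module R N"
  shows "f \<zero> = \<zero>\<^bsub>N\<^esub>"
proof -
  interpret M: module R M by fact
  interpret N: module R N by fact
  have "f (\<zero>\<^bsub>R\<^esub> \<odot> \<zero>) = \<zero>\<^bsub>R\<^esub> \<odot>\<^bsub>N\<^esub> f \<zero>"
    using assms(1) by (intro lin_smult) auto
  then show ?thesis using lin_closed[OF assms(1)] by simp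
qed

lemma lin_minus:
  assumes "f \<in> lin_map R M N" "module R M" "module R N" "x \<in> carrier M" "y \<in> carrier M"
  shows "f (x \<ominus>\<^bsub>M\<^esub> y) = f x \<ominus>\<^bsub>N\<^esub> f y"
proof -
  interpret M: module R M by fact
  interpret N: module R N by fact
  have "f (x \<ominus>\<^bsub>M\<^esub> y) \<oplus>\<^bsub>N\<^esub> f y = f x"
    using assms by (simp add: lin_add[OF assms(1), symmetric] M.minus_eq M.a_assoc M.l_neg)
  then show ?thesis
    using assms lin_closed[OF assms(1)] by (metis M.minus_closed N.minus_eq N.add.inv_solve_right)
qed

lemma lin_finsum:
  assumes "f \<in> lin_map R M N" "module R M" "module R N" "g \<in> A \<rightarrow> carrier M"
  shows "f (\<Oplus>\<^bsub>M\<^esub>i\<in>A. g i) = (\<Oplus>\<^bsub>N\<^esub>i\<in>A. f (g i))"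
proof -
  interpret M: module R M by fact
  interpret N: module R N by fact
  show ?thesis
    using assms(4)
  proof (induction A rule: infinite_finite_induct)
    case (insert a A)
    then have "(\<lambda>i. f (g i)) \<in> A \<rightarrow> carrier N" "f (g a) \<in> carrier N"
      using lin_closed[OF assms(1)] by auto
    then show ?case using insert by (simp add: lin_add[OF assms(1)])
  qed (simp_all add: lin_zero[OF assms(1-3)])
qed

lemma lin_id: "(\<lambda>x. x) \<in> lin_map R M M" "id \<in> lin_map R M M"
  by (auto simp: lin_map_def)

lemma lin_comp:
  "f \<in> lin_map R L M \<Longrightarrow> g \<in> lin_map R M N \<Longrightarrow> (\<lambda>x. g (f x)) \<in> lin_map R L N"
  by (rule lin_mapI) (simp_all add: lin_closed lin_add lin_smult)

lemma lin_add_fun: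
  assumes "f \<in> lin_map R M N" "g \<in> lin_map R M N" "module R N"
  shows "(\<lambda>x. f x \<oplus>\<^bsub>N\<^esub> g x) \<in> lin_map R M N"
proof -
  interpret N: module R N by fact
  show ?thesis
    by (rule lin_mapI)
      (simp_all add: assms(1,2)[THEN lin_closed] assms(1,2)[THEN lin_add]
        assms(1,2)[THEN lin_smult] N.a_ac N.smult_r_distr)
qed

lemma lin_smult_fun:
  assumes "f \<in> lin_map R M N" "module R N" "r \<in> carrier R"
  shows "(\<lambda>x. r \<odot>\<^bsub>N\<^esub> f x) \<in> lin_map R M N"
proof -
  interpret N: module R N by fact
  show ?thesis
    by (rule lin_mapI)
      (simp_all add: assms(3) assms(1)[THEN lin_closed] assms(1)[THEN lin_add]
        assms(1)[THEN lin_smult] N.smult_r_distr N.smult_assoc1[symmetric] N.R.m_comm[OF assms(3)])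
qed

section \<open>Submodules, preimages and equalizers\<close>

lemma submoduleI':
  fixes M (structure)
  assumes "module R M" "H \<subseteq> carrier M" "\<zero> \<in> H" "\<And>x y. x \<in> H \<Longrightarrow> y \<in> H \<Longrightarrow> x \<oplus> y \<in> H"
    and smult: "\<And>r x. r \<in> carrier R \<Longrightarrow> x \<in> H \<Longrightarrow> r \<odot> x \<in> H"
  shows "submodule H R M"
proof -
  interpret M: module R M by fact
  show ?thesis
  proof (rule M.submoduleI)
    fix x assume "x \<in> H"
    \<comment> \<open>Negation is scaling by minus one, so closure under scalars suffices.\<close>
    moreover have "(\<ominus>\<^bsub>R\<^esub> \<one>\<^bsub>R\<^esub>) \<odot> x = \<ominus> x" using \<open>x \<in> H\<close> assms(2) M.smult_l_minus[of "\<one>\<^bsub>R\<^esub>" x] by auto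
    ultimately show "\<ominus> x \<in> H" using smult[of "\<ominus>\<^bsub>R\<^esub> \<one>\<^bsub>R\<^esub>" x] by simp
  qed (use assms in auto)
qed

lemma submodule_facts:
  fixes M (structure)
  assumes "submodule H R M" "module R M"
  shows "H \<subseteq> carrier M" "\<zero> \<in> H" "\<And>x y. x \<in> H \<Longrightarrow> y \<in> H \<Longrightarrow> x \<oplus> y \<in> H"
    "\<And>r x. r \<in> carrier R \<Longrightarrow> x \<in> H \<Longrightarrow> r \<odot> x \<in> H"
    "\<And>x y. x \<in> H \<Longrightarrow> y \<in> H \<Longrightarrow> x \<ominus> y \<in> H"
    "module R (M\<lparr>carrier := H\<rparr>)"
proof -
  interpret M: module R M by fact
  interpret H: submodule H R M by fact
  show "H \<subseteq> carrier M" "\<zero> \<in> H" using H.subset H.one_closed by auto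
  show *: "\<And>x y. x \<in> H \<Longrightarrow> y \<in> H \<Longrightarrow> x \<oplus> y \<in> H" by (rule M.submoduleE(5)[OF assms(1)])
  show "\<And>r x. r \<in> carrier R \<Longrightarrow> x \<in> H \<Longrightarrow> r \<odot> x \<in> H" by (rule M.submoduleE(4)[OF assms(1)])
  show "\<And>x y. x \<in> H \<Longrightarrow> y \<in> H \<Longrightarrow> x \<ominus> y \<in> H"
    unfolding a_minus_def by (intro * M.submoduleE(3)[OF assms(1)])
  show "module R (M\<lparr>carrier := H\<rparr>)" using H.submodule_is_module[OF assms(2)] .
qed

lemma submodule_incl: "submodule H R M \<Longrightarrow> module R M \<Longrightarrow> (\<lambda>x. x) \<in> lin_map R (M\<lparr>carrier := H\<rparr>) M"
  "submodule H R M \<Longrightarrow> module R M \<Longrightarrow> id \<in> lin_map R (M\<lparr>carrier := H\<rparr>) M"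
  using submodule_facts(1)[of H R M] by (auto simp: lin_map_def)

text \<open>The inclusion is linear and so commutes with finite sums; this identifies the sums
  formed in the two module records.\<close>

lemma finsum_submodule:
  fixes M (structure)
  assumes "submodule H R M" "module R M" "g \<in> A \<rightarrow> H"
  shows "(\<Oplus>\<^bsub>M\<lparr>carrier := H\<rparr>\<^esub>i\<in>A. g i) = (\<Oplus>i\<in>A. g i)" "(\<Oplus>i\<in>A. g i) \<in> H"
proof -
  have H: "module R (M\<lparr>carrier := H\<rparr>)" using submodule_facts(6)[OF assms(1,2)] .
  show *: "(\<Oplus>\<^bsub>M\<lparr>carrier := H\<rparr>\<^esub>i\<in>A. g i) = (\<Oplus>i\<in>A. g i)"
    by (rule lin_finsum[OF submodule_incl(1)[OF assms(1,2)] H assms(2)]) (use assms in auto)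
  interpret H: module R "M\<lparr>carrier := H\<rparr>" by fact
  show "(\<Oplus>i\<in>A. g i) \<in> H"
    unfolding *[symmetric] using H.finsum_closed[of g A] assms(3) by simp
qed

lemma submodule_vimage:
  assumes "f \<in> lin_map R M N" "module R M" "module R N" "submodule H R N"
  shows "submodule {x \<in> carrier M. f x \<in> H} R M"
proof -
  interpret M: module R M by fact
  show ?thesis
    using submodule_facts[OF assms(4,3)]
    by (intro submoduleI'[OF assms(2)])
      (auto simp: lin_zero[OF assms(1-3)] lin_add[OF assms(1)] lin_smult[OF assms(1)])
qed

lemma submodule_zero: "module R M \<Longrightarrow> submodule {\<zero>\<^bsub>M\<^esub>} R M"
proof -
  assume M: "module R M"
  interpret module R M by fact
  show ?thesis by (rule submoduleI'[OF M]) auto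
qed

lemma submodule_equalizer:
  assumes "f \<in> lin_map R M N" "g \<in> lin_map R M N" "module R M" "module R N"
  shows "submodule {x \<in> carrier M. f x = g x} R M"
proof -
  interpret M: module R M by fact
  show ?thesis
    by (rule submoduleI'[OF assms(3)])
      (auto simp: lin_zero[OF _ assms(3,4)] assms(1,2)[THEN lin_add] assms(1,2)[THEN lin_smult]
        assms(1,2))
qed

text \<open>Quantifying over submodules avoids explicit linear combinations: to extend a property
  from \<open>S\<close> to the whole module, it is enough to see that it cuts out a
  submodule.\<close>

definition generates :: "('a, 'z) ring_scheme \<Rightarrow> ('a, 'm, 'y) module_scheme \<Rightarrow> 'm set \<Rightarrow> bool" where
  "generates R M S \<longleftrightarrow> S \<subseteq> carrier M \<and> (\<forall>H. submodule H R M \<longrightarrow> S \<subseteq> H \<longrightarrow> carrier M \<subseteq> H)"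

lemma generates_mem:
  assumes "generates R M S" "f \<in> lin_map R M N" "module R M" "module R N" "submodule H R N"
    and "\<And>s. s \<in> S \<Longrightarrow> f s \<in> H" and "x \<in> carrier M"
  shows "f x \<in> H"
  using assms(1,6,7) submodule_vimage[OF assms(2-5)] unfolding generates_def by blast

text \<open>The equalizer of the two maps is a submodule that contains \<open>S\<close>.\<close>

lemma generates_eq:
  assumes "generates R M S" "f \<in> lin_map R M N" "g \<in> lin_map R M N" "module R M" "module R N"
    and "\<And>s. s \<in> S \<Longrightarrow> f s = g s" and "x \<in> carrier M"
  shows "f x = g x"
  using assms(1,6,7) submodule_equalizer[OF assms(2-5)] unfolding generates_def by blast

text \<open>Pull a submodule of \<open>N\<close> back along \<open>f\<close>: the preimage contains
  \<open>S\<close>, hence everything, and surjectivity carries this back to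
  \<open>N\<close>.\<close>

lemma generates_image:
  assumes "generates R M S" "f \<in> lin_map R M N" "module R M" "module R N" "carrier N \<subseteq> f ` carrier M"
  shows "generates R N (f ` S)"
  unfolding generates_def
proof (intro conjI allI impI)
  show "f ` S \<subseteq> carrier N" using assms(1) lin_closed[OF assms(2)] unfolding generates_def by blast
  fix H assume H: "submodule H R N" "f ` S \<subseteq> H"
  have "f x \<in> H" if "x \<in> carrier M" for x
    by (rule generates_mem[OF assms(1-4) H(1) _ that]) (use H in auto)
  then show "carrier N \<subseteq> H" using assms(5) by auto
qed

section \<open>Bilinear maps\<close>

definition bilin :: "('a, 'z) ring_scheme \<Rightarrow> ('a, 'm, 'y) module_scheme \<Rightarrow> ('a, 'n, 'x) module_scheme \<Rightarrow>
    ('a, 'p, 'w) module_scheme \<Rightarrow> ('m \<Rightarrow> 'n \<Rightarrow> 'p) \<Rightarrow> bool" where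
  "bilin R M N P \<beta> \<longleftrightarrow> (\<forall>m\<in>carrier M. \<beta> m \<in> lin_map R N P) \<and>
     (\<forall>n\<in>carrier N. (\<lambda>m. \<beta> m n) \<in> lin_map R M P)"

lemma bilinI:
  assumes "\<And>m. m \<in> carrier M \<Longrightarrow> \<beta> m \<in> lin_map R N P"
    and "\<And>n. n \<in> carrier N \<Longrightarrow> (\<lambda>m. \<beta> m n) \<in> lin_map R M P"
  shows "bilin R M N P \<beta>"
  using assms by (auto simp: bilin_def)

lemma bilin_right: "bilin R M N P \<beta> \<Longrightarrow> m \<in> carrier M \<Longrightarrow> (\<lambda>n. \<beta> m n) \<in> lin_map R N P"
  and bilin_left: "bilin R M N P \<beta> \<Longrightarrow> n \<in> carrier N \<Longrightarrow> (\<lambda>m. \<beta> m n) \<in> lin_map R M P"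
  by (auto simp: bilin_def)

lemma bilin_closed: "bilin R M N P \<beta> \<Longrightarrow> m \<in> carrier M \<Longrightarrow> n \<in> carrier N \<Longrightarrow> \<beta> m n \<in> carrier P"
  by (metis bilin_left lin_closed)

lemma bilin_comp:
  assumes "bilin R M N P \<beta>" "f \<in> lin_map R M' M" "g \<in> lin_map R N' N" "h \<in> lin_map R P P'"
  shows "bilin R M' N' P' (\<lambda>m n. h (\<beta> (f m) (g n)))"
proof (rule bilinI)
  fix m assume "m \<in> carrier M'"
  then show "(\<lambda>n. h (\<beta> (f m) (g n))) \<in> lin_map R N' P'"
    by (intro lin_comp[OF lin_comp[OF assms(3) bilin_right[OF assms(1)]] assms(4)]
        lin_closed[OF assms(2)])
next
  fix n assume "n \<in> carrier N'"
  then show "(\<lambda>m. h (\<beta> (f m) (g n))) \<in> lin_map R M' P'"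
    by (intro lin_comp[OF lin_comp[OF assms(2) bilin_left[OF assms(1)]] assms(4)]
        lin_closed[OF assms(3)])
qed

text \<open>Linearity is used in one variable at a time: first in the second argument for fixed
  \<open>s\<close> in \<open>S\<close>, then in the first argument for arbitrary
  \<open>n\<close>.\<close>

lemma bilin_eq:
  assumes "generates R M S" "generates R N T" "bilin R M N P \<beta>" "bilin R M N P \<gamma>"
    and mods: "module R M" "module R N" "module R P"
    and eq: "\<And>s t. s \<in> S \<Longrightarrow> t \<in> T \<Longrightarrow> \<beta> s t = \<gamma> s t"
    and "m \<in> carrier M" "n \<in> carrier N"
  shows "\<beta> m n = \<gamma> m n"
proof -
  have S: "S \<subseteq> carrier M" using assms(1) by (simp add: generates_def)
  have "\<beta> s n = \<gamma> s n" if "s \<in> S" for s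
    using generates_eq[OF assms(2) bilin_right[OF assms(3)] bilin_right[OF assms(4)] mods(2,3) eq[OF that] assms(10)]
      that S by blast
  then show ?thesis
    using generates_eq[OF assms(1) bilin_left[OF assms(3)] bilin_left[OF assms(4)] mods(1,3) _ assms(9)]
      assms(10) by blast
qed

section \<open>The base ring as an algebra over itself\<close>

lemma module_cring: "module R M \<Longrightarrow> cring R"
  and module_abelian: "module R M \<Longrightarrow> abelian_group M"
  by (simp_all add: module_def)

lemma finsum_regular_mod [simp]: "finsum (regular_mod R) f A = finsum R f A"
  by (simp add: finsum_def finprod_def regular_mod_def)

lemma regular_mod_simps [simp]:
  "carrier (regular_mod R) = carrier R" "add (regular_mod R) = add R" "mult (regular_mod R) = mult R"
  "smult (regular_mod R) = mult R" "\<zero>\<^bsub>regular_mod R\<^esub> = \<zero>\<^bsub>R\<^esub>" "\<one>\<^bsub>regular_mod R\<^esub> = \<one>\<^bsub>R\<^esub>"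
  by (simp_all add: regular_mod_def)

lemma regular_mod_algebra:
  assumes "cring R" shows "algebra R (regular_mod R)"
proof -
  interpret cring R by fact
  have "cring (regular_mod R)"
    by (rule cringI; (rule abelian_groupI comm_monoidI)?)
      (auto simp: a_ac m_assoc l_distr intro: l_neg m_comm)
  then show ?thesis
    by (intro algebraI assms) (auto simp: m_assoc l_distr r_distr)
qed

section \<open>Free modules\<close>

text \<open>Linear extension of a family on the basis of a free module. The sum inside
  \<open>tlift\<close> has exactly this shape, and so does \<open>peval\<close> once the monomials
  are evaluated.\<close>

definition lext :: "('a, 'z) ring_scheme \<Rightarrow> ('a, 'p, 'y) module_scheme \<Rightarrow> ('g \<Rightarrow> 'p) \<Rightarrow> ('g \<Rightarrow> 'a) \<Rightarrow> 'p" where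
  "lext R P b f = (\<Oplus>\<^bsub>P\<^esub>x\<in>{x. f x \<noteq> \<zero>\<^bsub>R\<^esub>}. f x \<odot>\<^bsub>P\<^esub> b x)"

lemma monoid_alg_simps [simp]:
  "(f \<oplus>\<^bsub>monoid_alg R G\<^esub> g) x = f x \<oplus>\<^bsub>R\<^esub> g x" "(r \<odot>\<^bsub>monoid_alg R G\<^esub> f) x = r \<otimes>\<^bsub>R\<^esub> f x"
  "\<zero>\<^bsub>monoid_alg R G\<^esub> x = \<zero>\<^bsub>R\<^esub>"
  by (simp_all add: monoid_alg_def)

lemma monoid_alg_carrier:
  "f \<in> carrier (monoid_alg R G) \<longleftrightarrow>
    (\<forall>g. f g \<in> carrier R) \<and> {g. f g \<noteq> \<zero>\<^bsub>R\<^esub>} \<subseteq> carrier G \<and> finite {g. f g \<noteq> \<zero>\<^bsub>R\<^esub>}"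
  by (simp add: monoid_alg_def)

lemma monoid_alg_module:
  fixes R (structure)
  assumes "cring R" shows "module R (monoid_alg R G)"
proof -
  interpret cring R by fact
  let ?F = "monoid_alg R G"
  have add: "f \<oplus>\<^bsub>?F\<^esub> g \<in> carrier ?F" if "f \<in> carrier ?F" "g \<in> carrier ?F" for f g
  proof -
    have "{x. f x \<oplus> g x \<noteq> \<zero>} \<subseteq> {x. f x \<noteq> \<zero>} \<union> {x. g x \<noteq> \<zero>}" by auto
    then show ?thesis using that unfolding monoid_alg_carrier
      by (auto intro: finite_subset)
  qed
  have smult: "r \<odot>\<^bsub>?F\<^esub> f \<in> carrier ?F" if "r \<in> carrier R" "f \<in> carrier ?F" for r f
  proof -
    have "{x. r \<otimes> f x \<noteq> \<zero>} \<subseteq> {x. f x \<noteq> \<zero>}" using that by auto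
    then show ?thesis using that unfolding monoid_alg_carrier
      by (auto intro: finite_subset)
  qed
  have zero: "\<zero>\<^bsub>?F\<^esub> \<in> carrier ?F" by (simp add: monoid_alg_carrier)
  have closed: "f x \<in> carrier R" if "f \<in> carrier ?F" for f x using that by (simp add: monoid_alg_carrier)
  show ?thesis
  proof (rule moduleI)
    show "abelian_group ?F"
    proof (rule abelian_groupI)
      fix f assume f: "f \<in> carrier ?F"
      then have "(\<ominus> \<one>) \<odot>\<^bsub>?F\<^esub> f \<in> carrier ?F" by (intro smult) auto
      moreover have "(\<ominus> \<one>) \<odot>\<^bsub>?F\<^esub> f \<oplus>\<^bsub>?F\<^esub> f = \<zero>\<^bsub>?F\<^esub>"
        by (rule ext) (use closed[OF f] in \<open>simp add: l_minus l_neg\<close>)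
      ultimately show "\<exists>y\<in>carrier ?F. y \<oplus>\<^bsub>?F\<^esub> f = \<zero>\<^bsub>?F\<^esub>" by blast
    qed (use zero in \<open>auto simp: add closed a_ac intro!: ext\<close>)
  qed (auto simp: assms smult closed intro!: ext l_distr r_distr m_assoc)
qed

lemma monoid_alg_eval:
  "(\<lambda>f. f x) \<in> lin_map R (monoid_alg R G) (regular_mod R)"
  by (rule lin_mapI) (auto simp: monoid_alg_carrier)

lemma monoid_alg_finsum_apply:
  assumes "cring R" "h \<in> A \<rightarrow> carrier (monoid_alg R G)"
  shows "(\<Oplus>\<^bsub>monoid_alg R G\<^esub>i\<in>A. h i) x = (\<Oplus>\<^bsub>R\<^esub>i\<in>A. h i x)"
  using lin_finsum[OF monoid_alg_eval monoid_alg_module[OF assms(1)]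
      algebra.module[OF regular_mod_algebra[OF assms(1)]] assms(2)] by simp

lemma basis_elt_closed:
  fixes R (structure)
  assumes "cring R" "g \<in> carrier G" shows "basis_elt R g \<in> carrier (monoid_alg R G)"
proof -
  interpret cring R by fact
  have "{x. basis_elt R g x \<noteq> \<zero>} \<subseteq> {g}" by (auto simp: basis_elt_def)
  then show ?thesis using assms(2) unfolding monoid_alg_carrier
    by (auto simp: basis_elt_def intro: finite_subset)
qed

text \<open>Supports change under addition and scaling. Summing over a finite set that contains the
  support gives several elements a common index set.\<close>

lemma lext_superset:
  assumes "module R P" "f \<in> carrier (monoid_alg R G)" "finite A" "{x. f x \<noteq> \<zero>\<^bsub>R\<^esub>} \<subseteq> A"
    and "\<And>x. x \<in> A \<Longrightarrow> b x \<in> carrier P"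
  shows "lext R P b f = (\<Oplus>\<^bsub>P\<^esub>x\<in>A. f x \<odot>\<^bsub>P\<^esub> b x)"
proof -
  interpret P: module R P by fact
  show ?thesis unfolding lext_def
    by (rule P.add.finprod_mono_neutral_cong_left)
      (use assms in \<open>auto simp: monoid_alg_carrier\<close>)
qed

lemma lext_lin:
  fixes P (structure)
  assumes P: "module R P" and b: "\<And>x. x \<in> carrier G \<Longrightarrow> b x \<in> carrier P"
  shows "lext R P b \<in> lin_map R (monoid_alg R G) P"
proof -
  interpret P: module R P by fact
  let ?F = "monoid_alg R G"
  note F = monoid_alg_module[OF P.R.is_cring, of G]
  interpret F: module R ?F by fact
  let ?s = "\<lambda>f. {x. f x \<noteq> \<zero>\<^bsub>R\<^esub>}"
  have s: "finite (?s f)" "?s f \<subseteq> carrier G" "\<And>x. f x \<in> carrier R" if "f \<in> carrier ?F" for f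
    using that by (auto simp: monoid_alg_carrier)
  show ?thesis
  proof (rule lin_mapI)
    fix f assume f: "f \<in> carrier ?F"
    show "lext R P b f \<in> carrier P" unfolding lext_def
      by (rule P.finsum_closed) (use s[OF f] b in auto)
    fix r assume r: "r \<in> carrier R"
    have "lext R P b (r \<odot>\<^bsub>?F\<^esub> f) = (\<Oplus>x\<in>?s f. (r \<odot>\<^bsub>?F\<^esub> f) x \<odot> b x)"
      by (rule lext_superset[OF P F.smult_closed[OF r f]]) (use s[OF f] b r in auto)
    also have "\<dots> = (\<Oplus>x\<in>?s f. r \<odot> (f x \<odot> b x))"
      by (rule P.finsum_cong') (use s[OF f] b r in \<open>auto intro!: P.smult_assoc1\<close>)
    also have "\<dots> = r \<odot> lext R P b f" unfolding lext_def
      by (rule P.finsum_smult_ldistr[symmetric]) (use s[OF f] b r in auto)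
    finally show "lext R P b (r \<odot>\<^bsub>?F\<^esub> f) = r \<odot> lext R P b f" .
  next
    fix f g assume f: "f \<in> carrier ?F" and g: "g \<in> carrier ?F"
    let ?A = "?s f \<union> ?s g"
    have A: "\<And>x. x \<in> ?A \<Longrightarrow> b x \<in> carrier P" using s[OF f] s[OF g] b by auto
    have fA: "lext R P b f = (\<Oplus>x\<in>?A. f x \<odot> b x)"
      by (rule lext_superset[OF P f _ _ A]) (use s[OF f] s[OF g] in auto)
    have gA: "lext R P b g = (\<Oplus>x\<in>?A. g x \<odot> b x)"
      by (rule lext_superset[OF P g _ _ A]) (use s[OF f] s[OF g] in auto)
    have "lext R P b (f \<oplus>\<^bsub>?F\<^esub> g) = (\<Oplus>x\<in>?A. (f \<oplus>\<^bsub>?F\<^esub> g) x \<odot> b x)"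
      by (rule lext_superset[OF P F.a_closed[OF f g]]) (use s[OF f] s[OF g] b in auto)
    also have "\<dots> = (\<Oplus>x\<in>?A. f x \<odot> b x \<oplus> g x \<odot> b x)"
      by (rule P.finsum_cong') (use s[OF f] s[OF g] b in \<open>auto intro!: P.smult_l_distr\<close>)
    also have "\<dots> = (\<Oplus>x\<in>?A. f x \<odot> b x) \<oplus> (\<Oplus>x\<in>?A. g x \<odot> b x)"
      by (rule P.finsum_addf) (use s[OF f] s[OF g] b in auto)
    also have "\<dots> = lext R P b f \<oplus> lext R P b g" by (simp only: fA gA)
    finally show "lext R P b (f \<oplus>\<^bsub>?F\<^esub> g) = lext R P b f \<oplus> lext R P b g" .
  qed
qed

lemma lext_basis:
  assumes "module R P" "b g \<in> carrier P"
  shows "lext R P b (basis_elt R g) = b g"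
proof -
  interpret P: module R P by fact
  \<comment> \<open>A dummy monoid with carrier \<open>{g}\<close> places the basis element in a
    free module, as \<open>lext_superset\<close> requires.\<close>
  define G where "G = \<lparr>carrier = {g}, mult = \<lambda>x y. g, one = g\<rparr>"
  have "basis_elt R g \<in> carrier (monoid_alg R G)"
    by (rule basis_elt_closed[OF P.R.is_cring]) (simp add: G_def)
  then have "lext R P b (basis_elt R g) = (\<Oplus>\<^bsub>P\<^esub>x\<in>{g}. basis_elt R g x \<odot>\<^bsub>P\<^esub> b x)"
    by (rule lext_superset[OF assms(1)]) (use assms in \<open>auto simp: basis_elt_def\<close>)
  then show ?thesis using assms(2) by (simp add: basis_elt_def)
qed

lemma lext_self:
  fixes R (structure)
  assumes "cring R" "f \<in> carrier (monoid_alg R G)"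
  shows "lext R (monoid_alg R G) (basis_elt R) f = f"
proof
  fix x
  interpret cring R by fact
  let ?F = "monoid_alg R G"
  interpret F: module R ?F by (rule monoid_alg_module) fact
  \<comment> \<open>\<open>x\<close> is added because it may lie outside the support of
    \<open>f\<close>; the enlarged sum has at most one nonzero term, the one at
    \<open>x\<close>.\<close>
  let ?A = "insert x {x. f x \<noteq> \<zero>}"
  have A: "finite {x. f x \<noteq> \<zero>}" "\<And>x. f x \<in> carrier R" "\<And>x. f x \<noteq> \<zero> \<Longrightarrow> x \<in> carrier G"
    using assms(2) by (auto simp: monoid_alg_carrier)
  have "lext R ?F (basis_elt R) f x = (\<Oplus>y\<in>{x. f x \<noteq> \<zero>}. (f y \<odot>\<^bsub>?F\<^esub> basis_elt R y) x)"
    unfolding lext_def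
    by (rule monoid_alg_finsum_apply[OF assms(1)]) (use A in \<open>auto intro!: F.smult_closed basis_elt_closed[OF assms(1)]\<close>)
  also have "\<dots> = (\<Oplus>y\<in>{x. f x \<noteq> \<zero>}. if x = y then f y else \<zero>)"
    by (rule finsum_cong') (use A in \<open>auto simp: basis_elt_def\<close>)
  also have "\<dots> = (\<Oplus>y\<in>?A. if x = y then f y else \<zero>)"
    by (rule add.finprod_mono_neutral_cong_left) (use A in auto)
  also have "\<dots> = f x"
    by (rule add.finprod_singleton) (use A in auto)
  finally show "lext R ?F (basis_elt R) f x = f x" .
qed

text \<open>\<open>lext_self\<close> writes every element as a finite combination of basis elements,
  and submodules are closed under such combinations.\<close>

lemma generates_basis:
  assumes "cring R" shows "generates R (monoid_alg R G) (basis_elt R ` carrier G)"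
  unfolding generates_def
proof (intro conjI allI impI subsetI)
  let ?F = "monoid_alg R G"
  have F: "module R ?F" by (rule monoid_alg_module) fact
  fix H f assume H: "submodule H R ?F" "basis_elt R ` carrier G \<subseteq> H" and f: "f \<in> carrier ?F"
  have "lext R ?F (basis_elt R) f \<in> H" unfolding lext_def
    by (rule finsum_submodule(2)[OF H(1) F])
      (use H(2) f in \<open>auto simp: monoid_alg_carrier intro!: submodule_facts(4)[OF H(1) F]\<close>)
  then show "f \<in> H" using lext_self[OF assms f] by simp
qed (use basis_elt_closed[OF assms] in auto)

section \<open>Quotients\<close>

lemma minus_eq_zero_iff:
  assumes "abelian_group M" "x \<in> carrier M" "y \<in> carrier M"
  shows "x \<ominus>\<^bsub>M\<^esub> y = \<zero>\<^bsub>M\<^esub> \<longleftrightarrow> x = y"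
proof -
  interpret abelian_group M by fact
  show ?thesis using assms(2,3)
    by (metis a_inv_closed add.inv_solve_right l_zero minus_eq r_neg zero_closed)
qed

lemma quot_mod_simps:
  "carrier (quot_mod M J) = (\<lambda>x. J +>\<^bsub>M\<^esub> x) ` carrier M" "add (quot_mod M J) = set_add M"
  "\<zero>\<^bsub>quot_mod M J\<^esub> = J" "mult (quot_mod M J) = rcoset_mult M J" "\<one>\<^bsub>quot_mod M J\<^esub> = J +>\<^bsub>M\<^esub> \<one>\<^bsub>M\<^esub>"
  by (auto simp: quot_mod_def FactRing_def A_RCOSETS_def' a_r_coset_def')

lemma submodule_abelian_subgroup:
  assumes "module R M" "submodule J R M" shows "abelian_subgroup J M"
  using assms by (intro abelian_subgroupI3 additive_subgroupI)
    (auto simp: module_def submodule_def)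

lemma mem_coset_iff:
  assumes "module R M" "submodule J R M" "x \<in> carrier M"
  shows "y \<in> J +>\<^bsub>M\<^esub> x \<longleftrightarrow> y \<in> carrier M \<and> y \<ominus>\<^bsub>M\<^esub> x \<in> J"
proof -
  interpret M: module R M by fact
  interpret J: abelian_subgroup J M by (rule submodule_abelian_subgroup) fact+
  show ?thesis
    using J.a_rcos_module[OF assms(3), of y] J.a_elemrcos_carrier[OF assms(3), of y]
    by (auto simp: M.minus_eq)
qed

lemma self_mem_coset:
  assumes "module R M" "submodule J R M" "x \<in> carrier M"
  shows "x \<in> J +>\<^bsub>M\<^esub> x"
proof -
  interpret J: abelian_subgroup J M by (rule submodule_abelian_subgroup) fact+
  show ?thesis by (rule J.a_rcos_self[OF assms(3)])
qed

lemma coset_eq_iff: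
  fixes M (structure)
  assumes "module R M" "submodule J R M" "x \<in> carrier M" "y \<in> carrier M"
  shows "J +> x = J +> y \<longleftrightarrow> x \<ominus> y \<in> J"
proof -
  interpret J: abelian_subgroup J M by (rule submodule_abelian_subgroup) fact+
  show ?thesis
    using J.a_repr_independence'[of x y] mem_coset_iff[OF assms(1,2,4), of x] assms(3,4)
      J.a_rcos_self[OF assms(3)] by auto
qed

text \<open>Maps on quotients are defined here as \<open>the_elem\<close> of the image of a coset;
  this evaluates them once the underlying map is constant on that coset.\<close>

lemma the_elem_image_coset:
  fixes M (structure)
  assumes "module R M" "submodule J R M" "x \<in> carrier M"
    and "\<And>y. y \<in> carrier M \<Longrightarrow> y \<ominus> x \<in> J \<Longrightarrow> f y = f x"
  shows "the_elem (f ` (J +> x)) = f x"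
proof -
  have "f y = f x" if "y \<in> J +> x" for y
    using that assms(4)[of y] mem_coset_iff[OF assms(1-3), of y] by blast
  then have "f ` (J +> x) = {f x}"
    using self_mem_coset[OF assms(1-3)] by blast
  then show ?thesis by simp
qed

lemma lin_coset_const:
  fixes N (structure)
  assumes "f \<in> lin_map R M N" "module R M" "module R N" "submodule J R M"
    and "\<And>j. j \<in> J \<Longrightarrow> f j = \<zero>" and "x \<in> carrier M" "y \<in> carrier M" "y \<ominus>\<^bsub>M\<^esub> x \<in> J"
  shows "f y = f x"
proof -
  interpret N: module R N by fact
  have "f y \<ominus> f x = \<zero>" using lin_minus[OF assms(1-3,7,6)] assms(5,8) by metis
  then show ?thesis using lin_closed[OF assms(1)] assms(6,7) by (simp add: minus_eq_zero_iff[OF N.abelian_group_axioms])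
qed

lemma the_elem_image_coset_lin:
  assumes "f \<in> lin_map R M N" "module R M" "module R N" "submodule J R M"
    and "\<And>j. j \<in> J \<Longrightarrow> f j = \<zero>\<^bsub>N\<^esub>" and "x \<in> carrier M"
  shows "the_elem (f ` (J +>\<^bsub>M\<^esub> x)) = f x"
  by (rule the_elem_image_coset[OF assms(2,4,6)]) (rule lin_coset_const[OF assms])

text \<open>\<open>quot_mod\<close> scales a coset by a union over all its representatives. The
  cosets in that union coincide, because \<open>J\<close> is closed under scalars.\<close>

lemma quot_mod_smult:
  fixes M (structure)
  assumes "module R M" "submodule J R M" "x \<in> carrier M" "r \<in> carrier R"
  shows "r \<odot>\<^bsub>quot_mod M J\<^esub> (J +> x) = J +> (r \<odot> x)"
proof -
  interpret M: module R M by fact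
  have "J +> (r \<odot> y) = J +> (r \<odot> x)" if "y \<in> J +> x" for y
  proof -
    have y: "y \<in> carrier M" "y \<ominus> x \<in> J" using that mem_coset_iff[OF assms(1-3)] by auto
    have "r \<odot> y \<ominus> r \<odot> x = r \<odot> (y \<ominus> x)"
      using assms y by (simp add: M.minus_eq M.smult_r_distr M.smult_r_minus)
    then show ?thesis
      using coset_eq_iff[OF assms(1,2)] y assms submodule_facts(4)[OF assms(2,1)] by simp
  qed
  then have "(\<Union>y\<in>J +> x. J +> (r \<odot> y)) = (\<Union>y\<in>J +> x. J +> (r \<odot> x))"
    by (rule SUP_cong[OF refl])
  also have "\<dots> = J +> (r \<odot> x)" using self_mem_coset[OF assms(1-3)] by blast
  finally show ?thesis by (simp add: quot_mod_def)
qed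

lemma quot_mod_add:
  fixes M (structure)
  assumes "module R M" "submodule J R M" "x \<in> carrier M" "y \<in> carrier M"
  shows "(J +> x) \<oplus>\<^bsub>quot_mod M J\<^esub> (J +> y) = J +> (x \<oplus> y)"
proof -
  interpret J: abelian_subgroup J M by (rule submodule_abelian_subgroup) fact+
  show ?thesis using J.a_rcos_sum assms(3,4) by (simp add: quot_mod_simps)
qed

lemma quot_mod_zero:
  assumes "module R M" "submodule J R M" shows "J +>\<^bsub>M\<^esub> \<zero>\<^bsub>M\<^esub> = \<zero>\<^bsub>quot_mod M J\<^esub>"
proof -
  interpret J: abelian_subgroup J M by (rule submodule_abelian_subgroup) fact+
  show ?thesis using J.a_rcos_const[OF submodule_facts(2)[OF assms(2,1)]] by (simp add: quot_mod_simps)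
qed

lemma quot_mod_module:
  fixes M (structure)
  assumes "module R M" "submodule J R M" shows "module R (quot_mod M J)"
proof -
  interpret M: module R M by fact
  note [simp] = quot_mod_simps(1) quot_mod_add[OF assms] quot_mod_smult[OF assms]
    quot_mod_zero[OF assms, symmetric]
  show ?thesis
  proof (rule moduleI)
    show "abelian_group (quot_mod M J)"
    proof (rule abelian_groupI)
      fix X assume "X \<in> carrier (quot_mod M J)"
      then obtain x where x: "x \<in> carrier M" "X = J +> x" by auto
      show "\<exists>Y\<in>carrier (quot_mod M J). Y \<oplus>\<^bsub>quot_mod M J\<^esub> X = \<zero>\<^bsub>quot_mod M J\<^esub>"
        by (rule bexI[of _ "J +> (\<ominus> x)"]) (use x in \<open>auto simp: M.l_neg\<close>)
    qed (auto simp: M.a_ac)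
  qed (auto simp: M.smult_l_distr M.smult_r_distr M.smult_assoc1 M.R.is_cring)
qed

lemma coset_lin:
  assumes "module R M" "submodule J R M"
  shows "(\<lambda>x. J +>\<^bsub>M\<^esub> x) \<in> lin_map R M (quot_mod M J)"
  by (rule lin_mapI) (auto simp: quot_mod_add[OF assms] quot_mod_smult[OF assms] quot_mod_simps(1))

lemma coset_eq_zero:
  assumes "module R M" "submodule J R M" "x \<in> J" shows "J +>\<^bsub>M\<^esub> x = \<zero>\<^bsub>quot_mod M J\<^esub>"
proof -
  interpret J: abelian_subgroup J M by (rule submodule_abelian_subgroup) fact+
  show ?thesis using J.a_rcos_const[OF assms(3)] by (simp add: quot_mod_simps)
qed

text \<open>The induced map \<open>g\<close> may be any function with the right values on cosets,
  which fits all the different \<open>the_elem\<close> definitions.\<close>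

lemma quot_lift_lin:
  assumes "f \<in> lin_map R M N" "module R M" "module R N" "submodule J R M"
    and "\<And>j. j \<in> J \<Longrightarrow> f j = \<zero>\<^bsub>N\<^esub>"
    and g: "\<And>x. x \<in> carrier M \<Longrightarrow> g (J +>\<^bsub>M\<^esub> x) = f x"
  shows "g \<in> lin_map R (quot_mod M J) N"
proof -
  interpret M: module R M by fact
  show ?thesis
    by (rule lin_mapI)
      (auto simp: quot_mod_simps(1) quot_mod_add[OF assms(2,4)] quot_mod_smult[OF assms(2,4)] g
        assms(1)[THEN lin_closed] assms(1)[THEN lin_add] assms(1)[THEN lin_smult])
qed

section \<open>Tensor products\<close>

lemma module_span_submodule:
  assumes "module R M" "S \<subseteq> carrier M"
  shows "submodule (module_span R M S) R M" "S \<subseteq> module_span R M S"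
proof -
  interpret M: module R M by fact
  have c: "carrier M \<in> {H. submodule H R M \<and> S \<subseteq> H}" using M.carrier_is_submodule assms(2) by auto
  show "submodule (module_span R M S) R M" unfolding module_span_def
    by (rule submoduleI'[OF assms(1)])
      (use c in \<open>auto intro: submodule_facts(2,3,4)[OF _ assms(1)]\<close>)
  show "S \<subseteq> module_span R M S" unfolding module_span_def by auto
qed

lemma module_span_least: "submodule H R M \<Longrightarrow> S \<subseteq> H \<Longrightarrow> module_span R M S \<subseteq> H"
  unfolding module_span_def by auto

lemma DirProd_carrier [simp]: "carrier (M \<times>\<times> N) = carrier M \<times> carrier N"
  by (simp add: DirProd_def)

context
  fixes R :: "('a, 'z) ring_scheme" and M :: "('a, 'm, 'y) module_scheme" and N :: "('a, 'n, 'x) module_scheme"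
  assumes M: "module R M" and N: "module R N"
begin

interpretation M: module R M by (rule M)
interpretation N: module R N by (rule N)

private abbreviation "FMN \<equiv> monoid_alg R (M \<times>\<times> N)"

lemma tensor_free: "module R FMN"
  by (rule monoid_alg_module) (rule M.R.is_cring)

interpretation F: module R FMN by (rule tensor_free)

lemma bas_closed: "m \<in> carrier M \<Longrightarrow> n \<in> carrier N \<Longrightarrow> basis_elt R (m, n) \<in> carrier FMN"
  by (rule basis_elt_closed[OF M.R.is_cring]) simp

lemma bilin_rels_cases:
  assumes "z \<in> bilin_rels R M N"
  obtains (add_left) m m' n where "m \<in> carrier M" "m' \<in> carrier M" "n \<in> carrier N"
    "z = basis_elt R (m \<oplus>\<^bsub>M\<^esub> m', n) \<ominus>\<^bsub>FMN\<^esub> (basis_elt R (m, n) \<oplus>\<^bsub>FMN\<^esub> basis_elt R (m', n))"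
  | (add_right) m n n' where "m \<in> carrier M" "n \<in> carrier N" "n' \<in> carrier N"
    "z = basis_elt R (m, n \<oplus>\<^bsub>N\<^esub> n') \<ominus>\<^bsub>FMN\<^esub> (basis_elt R (m, n) \<oplus>\<^bsub>FMN\<^esub> basis_elt R (m, n'))"
  | (smult_left) r m n where "r \<in> carrier R" "m \<in> carrier M" "n \<in> carrier N"
    "z = basis_elt R (r \<odot>\<^bsub>M\<^esub> m, n) \<ominus>\<^bsub>FMN\<^esub> (r \<odot>\<^bsub>FMN\<^esub> basis_elt R (m, n))"
  | (smult_right) r m n where "r \<in> carrier R" "m \<in> carrier M" "n \<in> carrier N"
    "z = basis_elt R (m, r \<odot>\<^bsub>N\<^esub> n) \<ominus>\<^bsub>FMN\<^esub> (r \<odot>\<^bsub>FMN\<^esub> basis_elt R (m, n))"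
  using assms unfolding bilin_rels_def Let_def
  apply (elim UnE CollectE exE conjE)
  subgoal by (rule add_left)
  subgoal by (rule add_right)
  subgoal by (rule smult_left)
  subgoal by (rule smult_right)
  done

lemma bilin_rels_closed: "bilin_rels R M N \<subseteq> carrier FMN"
proof
  fix z assume "z \<in> bilin_rels R M N"
  then show "z \<in> carrier FMN"
    by (cases rule: bilin_rels_cases) (auto intro!: F.minus_closed F.a_closed F.smult_closed bas_closed)
qed

lemma tensor_rels_submodule: "submodule (tensor_rels R M N) R FMN"
  and bilin_rels_subset: "bilin_rels R M N \<subseteq> tensor_rels R M N"
  unfolding tensor_rels_def by (rule module_span_submodule[OF tensor_free bilin_rels_closed])+

lemma tensor_module: "module R (tensor R M N)"
  unfolding tensor_def by (rule quot_mod_module[OF tensor_free tensor_rels_submodule])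

interpretation T: module R "tensor R M N" by (rule tensor_module)

lemma tens_closed: "m \<in> carrier M \<Longrightarrow> n \<in> carrier N \<Longrightarrow> tens R M N m n \<in> carrier (tensor R M N)"
  unfolding tensor_def tens_def by (rule lin_closed[OF coset_lin[OF tensor_free tensor_rels_submodule]])
    (rule bas_closed)

lemma coset_lin_tensor:
  "(\<lambda>x. tensor_rels R M N +>\<^bsub>FMN\<^esub> x) \<in> lin_map R FMN (tensor R M N)"
  unfolding tensor_def by (rule coset_lin[OF tensor_free tensor_rels_submodule])

lemma tensor_coset_eqI:
  "x \<in> carrier FMN \<Longrightarrow> y \<in> carrier FMN \<Longrightarrow> x \<ominus>\<^bsub>FMN\<^esub> y \<in> bilin_rels R M N \<Longrightarrow>
    tensor_rels R M N +>\<^bsub>FMN\<^esub> x = tensor_rels R M N +>\<^bsub>FMN\<^esub> y"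
  using coset_eq_iff[OF tensor_free tensor_rels_submodule, of x y] bilin_rels_subset by blast

lemma tens_bilin: "bilin R M N (tensor R M N) (tens R M N)"
proof (intro bilinI lin_mapI)
  fix m n assume m: "m \<in> carrier M" and n: "n \<in> carrier N"
  then show "tens R M N m n \<in> carrier (tensor R M N)" by (rule tens_closed)
  show "tens R M N m n \<in> carrier (tensor R M N)" using m n by (rule tens_closed)
next
  fix m m' n assume *: "m \<in> carrier M" "m' \<in> carrier M" "n \<in> carrier N"
  have "tens R M N (m \<oplus>\<^bsub>M\<^esub> m') n =
      tensor_rels R M N +>\<^bsub>FMN\<^esub> (basis_elt R (m, n) \<oplus>\<^bsub>FMN\<^esub> basis_elt R (m', n))"
    unfolding tens_def using *
    by (intro tensor_coset_eqI bas_closed F.a_closed) (auto simp: bilin_rels_def Let_def)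
  then show "tens R M N (m \<oplus>\<^bsub>M\<^esub> m') n = tens R M N m n \<oplus>\<^bsub>tensor R M N\<^esub> tens R M N m' n"
    using * by (simp add: tens_def lin_add[OF coset_lin_tensor] bas_closed)
next
  fix m n n' assume *: "m \<in> carrier M" "n \<in> carrier N" "n' \<in> carrier N"
  have "tens R M N m (n \<oplus>\<^bsub>N\<^esub> n') =
      tensor_rels R M N +>\<^bsub>FMN\<^esub> (basis_elt R (m, n) \<oplus>\<^bsub>FMN\<^esub> basis_elt R (m, n'))"
    unfolding tens_def using *
    by (intro tensor_coset_eqI bas_closed F.a_closed) (auto simp: bilin_rels_def Let_def)
  then show "tens R M N m (n \<oplus>\<^bsub>N\<^esub> n') = tens R M N m n \<oplus>\<^bsub>tensor R M N\<^esub> tens R M N m n'"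
    using * by (simp add: tens_def lin_add[OF coset_lin_tensor] bas_closed)
next
  fix r m n assume *: "r \<in> carrier R" "m \<in> carrier M" "n \<in> carrier N"
  have "tens R M N (r \<odot>\<^bsub>M\<^esub> m) n = tensor_rels R M N +>\<^bsub>FMN\<^esub> (r \<odot>\<^bsub>FMN\<^esub> basis_elt R (m, n))"
    unfolding tens_def using *
    by (intro tensor_coset_eqI bas_closed F.smult_closed M.smult_closed) (auto simp: bilin_rels_def Let_def)
  then show "tens R M N (r \<odot>\<^bsub>M\<^esub> m) n = r \<odot>\<^bsub>tensor R M N\<^esub> tens R M N m n"
    using * by (simp add: tens_def lin_smult[OF coset_lin_tensor] bas_closed)
next
  fix r m n assume *: "r \<in> carrier R" "m \<in> carrier M" "n \<in> carrier N"
  have "tens R M N m (r \<odot>\<^bsub>N\<^esub> n) = tensor_rels R M N +>\<^bsub>FMN\<^esub> (r \<odot>\<^bsub>FMN\<^esub> basis_elt R (m, n))"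
    unfolding tens_def using *
    by (intro tensor_coset_eqI bas_closed F.smult_closed N.smult_closed) (auto simp: bilin_rels_def Let_def)
  then show "tens R M N m (r \<odot>\<^bsub>N\<^esub> n) = r \<odot>\<^bsub>tensor R M N\<^esub> tens R M N m n"
    using * by (simp add: tens_def lin_smult[OF coset_lin_tensor] bas_closed)
qed

text \<open>Pure tensors are the images of the basis elements under the surjective quotient
  map.\<close>

lemma generates_tens_free:
  "generates R (tensor R M N) ((\<lambda>(m, n). tens R M N m n) ` (carrier M \<times> carrier N))"
proof -
  have "generates R (tensor R M N) ((\<lambda>x. tensor_rels R M N +>\<^bsub>FMN\<^esub> x) ` (basis_elt R ` carrier (M \<times>\<times> N)))"
    by (rule generates_image[OF generates_basis[OF M.R.is_cring] coset_lin_tensor tensor_free tensor_module])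
      (simp add: tensor_def quot_mod_simps)
  also have "(\<lambda>x. tensor_rels R M N +>\<^bsub>FMN\<^esub> x) ` (basis_elt R ` carrier (M \<times>\<times> N)) =
      (\<lambda>(m, n). tens R M N m n) ` (carrier M \<times> carrier N)"
    by (auto simp: tens_def image_image split: prod.splits)
  finally show ?thesis .
qed

text \<open>With the left factor fixed in \<open>S\<close>, the right factor extends from
  \<open>S'\<close> to \<open>N\<close>; then the left factor extends from \<open>S\<close> to
  \<open>M\<close>. This reaches all pure tensors.\<close>

lemma generates_tens:
  assumes S: "generates R M S" and S': "generates R N S'"
  shows "generates R (tensor R M N) ((\<lambda>(m, n). tens R M N m n) ` (S \<times> S'))"
  unfolding generates_def
proof (intro conjI allI impI)
  have SS: "S \<subseteq> carrier M" "S' \<subseteq> carrier N" using S S' by (auto simp: generates_def)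
  then show "(\<lambda>(m, n). tens R M N m n) ` (S \<times> S') \<subseteq> carrier (tensor R M N)"
    by (auto intro!: tens_closed)
  fix H assume H: "submodule H R (tensor R M N)" "(\<lambda>(m, n). tens R M N m n) ` (S \<times> S') \<subseteq> H"
  have "tens R M N m n \<in> H" if "m \<in> S" "n \<in> carrier N" for m n
    by (rule generates_mem[OF S' bilin_right[OF tens_bilin] N tensor_module H(1)])
      (use H(2) SS that in auto)
  then have "tens R M N m n \<in> H" if "m \<in> carrier M" "n \<in> carrier N" for m n
    using generates_mem[OF S bilin_left[OF tens_bilin] M tensor_module H(1)] that by blast
  then show "carrier (tensor R M N) \<subseteq> H"
    using generates_tens_free H(1) unfolding generates_def by auto
qed

lemma tensor_ext:
  assumes "f \<in> lin_map R (tensor R M N) P" "g \<in> lin_map R (tensor R M N) P" "module R P"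
    and "\<And>m n. m \<in> carrier M \<Longrightarrow> n \<in> carrier N \<Longrightarrow> f (tens R M N m n) = g (tens R M N m n)"
    and "t \<in> carrier (tensor R M N)"
  shows "f t = g t"
  by (rule generates_eq[OF generates_tens_free assms(1,2) tensor_module assms(3) _ assms(5)])
    (use assms(4) in auto)

context
  fixes P :: "('a, 'p, 'w) module_scheme" and \<beta> :: "'m \<Rightarrow> 'n \<Rightarrow> 'p"
  assumes P: "module R P" and \<beta>: "bilin R M N P \<beta>"
begin

interpretation P: module R P by (rule P)

private abbreviation "ev \<equiv> lext R P (\<lambda>p. \<beta> (fst p) (snd p))"

lemma tlift_ev_lin: "ev \<in> lin_map R FMN P"
  by (rule lext_lin[OF P]) (auto intro: bilin_closed[OF \<beta>])

lemma tlift_ev_basis: "m \<in> carrier M \<Longrightarrow> n \<in> carrier N \<Longrightarrow> ev (basis_elt R (m, n)) = \<beta> m n"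
  using lext_basis[OF P, of "\<lambda>p. \<beta> (fst p) (snd p)" "(m, n)"] bilin_closed[OF \<beta>] by auto

text \<open>The kernel of \<open>ev\<close> is a submodule. Each of the four kinds of relations lies
  in it by additivity or homogeneity of \<open>\<beta>\<close> in one argument, so their span does
  too.\<close>

lemma tlift_ev_rels:
  assumes "j \<in> tensor_rels R M N" shows "ev j = \<zero>\<^bsub>P\<^esub>"
proof -
  have "bilin_rels R M N \<subseteq> {x \<in> carrier FMN. ev x \<in> {\<zero>\<^bsub>P\<^esub>}}"
  proof
    fix z assume z: "z \<in> bilin_rels R M N"
    note ev = lin_minus[OF tlift_ev_lin tensor_free P] lin_add[OF tlift_ev_lin]
      lin_smult[OF tlift_ev_lin] tlift_ev_basis bas_closed bilin_closed[OF \<beta>]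
      lin_add[OF bilin_left[OF \<beta>]] lin_add[OF bilin_right[OF \<beta>]]
      lin_smult[OF bilin_left[OF \<beta>]] lin_smult[OF bilin_right[OF \<beta>]]
      minus_eq_zero_iff[OF P.abelian_group_axioms]
    have "ev z = \<zero>\<^bsub>P\<^esub>"
      using z by (cases rule: bilin_rels_cases) (simp_all add: ev)
    then show "z \<in> {x \<in> carrier FMN. ev x \<in> {\<zero>\<^bsub>P\<^esub>}}" using z bilin_rels_closed by auto
  qed
  then have "tensor_rels R M N \<subseteq> {x \<in> carrier FMN. ev x \<in> {\<zero>\<^bsub>P\<^esub>}}"
    unfolding tensor_rels_def
    by (intro module_span_least submodule_vimage[OF tlift_ev_lin tensor_free P submodule_zero[OF P]])
  then show ?thesis using assms by auto
qed

lemma tlift_coset: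
  "x \<in> carrier FMN \<Longrightarrow> tlift R P \<beta> (tensor_rels R M N +>\<^bsub>FMN\<^esub> x) = ev x"
  using the_elem_image_coset_lin[OF tlift_ev_lin tensor_free P tensor_rels_submodule tlift_ev_rels]
  unfolding tlift_def lext_def by simp

lemma tlift_lin: "tlift R P \<beta> \<in> lin_map R (tensor R M N) P"
  unfolding tensor_def
  by (rule quot_lift_lin[OF tlift_ev_lin tensor_free P tensor_rels_submodule tlift_ev_rels tlift_coset])

lemma tlift_tens: "m \<in> carrier M \<Longrightarrow> n \<in> carrier N \<Longrightarrow> tlift R P \<beta> (tens R M N m n) = \<beta> m n"
  unfolding tens_def by (simp add: tlift_coset bas_closed tlift_ev_basis)

end

end

section \<open>Functoriality of the tensor product\<close>

lemma tmap_bilin: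
  assumes "f \<in> lin_map R M P" "g \<in> lin_map R N Q" "module R P" "module R Q"
  shows "bilin R M N (tensor R P Q) (\<lambda>m n. tens R P Q (f m) (g n))"
  using bilin_comp[OF tens_bilin[OF assms(3,4)] assms(1,2) lin_id(1)] by simp

lemma tmap_lin:
  assumes "f \<in> lin_map R M P" "g \<in> lin_map R N Q" "module R M" "module R N" "module R P" "module R Q"
  shows "tmap R P Q f g \<in> lin_map R (tensor R M N) (tensor R P Q)"
  unfolding tmap_def by (rule tlift_lin) (use assms tensor_module tmap_bilin in auto)

lemma tmap_tens:
  assumes "f \<in> lin_map R M P" "g \<in> lin_map R N Q" "module R M" "module R N" "module R P" "module R Q"
    and "m \<in> carrier M" "n \<in> carrier N"
  shows "tmap R P Q f g (tens R M N m n) = tens R P Q (f m) (g n)"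
  unfolding tmap_def by (rule tlift_tens[OF assms(3,4) tensor_module[OF assms(5,6)] tmap_bilin[OF assms(1,2,5,6)] assms(7,8)])

text \<open>The composites are represented by \<open>h\<close> and \<open>k\<close>, which have to
  agree with them on carriers only. In this way identities, inclusions and truncations can be
  absorbed into other maps.\<close>

lemma tmap_tmap:
  assumes f: "f \<in> lin_map R M P" "g \<in> lin_map R N Q" and f': "f' \<in> lin_map R P P'" "g' \<in> lin_map R Q Q'"
    and M: "module R M" "module R N" and P: "module R P" "module R Q" and P': "module R P'" "module R Q'"
    and t: "t \<in> carrier (tensor R M N)"
    and h: "h \<in> lin_map R M P'" "k \<in> lin_map R N Q'"
    and eq: "\<And>x. x \<in> carrier M \<Longrightarrow> f' (f x) = h x" "\<And>x. x \<in> carrier N \<Longrightarrow> g' (g x) = k x"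
  shows "tmap R P' Q' f' g' (tmap R P Q f g t) = tmap R P' Q' h k t"
  by (rule tensor_ext[OF M lin_comp[OF tmap_lin[OF f M P] tmap_lin[OF f' P P']] tmap_lin[OF h M P']
        tensor_module[OF P'] _ t])
    (simp add: tmap_tens[OF f M P] tmap_tens[OF f' P P'] tmap_tens[OF h M P'] eq
      f[THEN lin_closed])

lemma tmap_ident:
  assumes "module R M" "module R N" "t \<in> carrier (tensor R M N)"
    and h: "h \<in> lin_map R M M" "k \<in> lin_map R N N"
    and eq: "\<And>x. x \<in> carrier M \<Longrightarrow> h x = x" "\<And>x. x \<in> carrier N \<Longrightarrow> k x = x"
  shows "tmap R M N h k t = t"
  by (rule tensor_ext[OF assms(1,2) tmap_lin[OF h assms(1,2,1,2)] lin_id(1) tensor_module[OF assms(1,2)] _ assms(3)])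
    (simp add: tmap_tens[OF h assms(1,2,1,2)] eq)

lemma tlift_tmap:
  assumes f: "f \<in> lin_map R M P" "g \<in> lin_map R N Q" and mods: "module R M" "module R N" "module R P" "module R Q"
    and X: "module R X" and \<beta>: "bilin R P Q X \<beta>" and t: "t \<in> carrier (tensor R M N)"
    and \<gamma>: "bilin R M N X \<gamma>" and eq: "\<And>m n. m \<in> carrier M \<Longrightarrow> n \<in> carrier N \<Longrightarrow> \<beta> (f m) (g n) = \<gamma> m n"
  shows "tlift R X \<beta> (tmap R P Q f g t) = tlift R X \<gamma> t"
  by (rule tensor_ext[OF mods(1,2) lin_comp[OF tmap_lin[OF f mods] tlift_lin[OF mods(3,4) X \<beta>]]
        tlift_lin[OF mods(1,2) X \<gamma>] X _ t])
    (simp add: tmap_tens[OF f mods] tlift_tens[OF mods(3,4) X \<beta>] tlift_tens[OF mods(1,2) X \<gamma>] eq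
      f[THEN lin_closed])

section \<open>The associator\<close>

lemma tassoc_inner:
  assumes L: "module R L" and M: "module R M" and N: "module R N" and n: "n \<in> carrier N"
  defines "P \<equiv> tensor R L (tensor R M N)"
  defines "\<And>n l m. \<beta> n l m \<equiv> tens R L (tensor R M N) l (tens R M N m n)"
  shows "bilin R L M P (\<beta> n)"
  using bilin_comp[OF tens_bilin[OF L tensor_module[OF M N]] lin_id(1) bilin_left[OF tens_bilin[OF M N] n] lin_id(1)]
  unfolding P_def \<beta>_def by simp

text \<open>Linearity in \<open>t\<close> belongs to the lift. Linearity in \<open>n\<close> is an
  equation between maps that are linear in \<open>t\<close>, so it is tested on pure
  tensors.\<close>

lemma tassoc_outer:
  assumes L: "module R L" and M: "module R M" and N: "module R N"
  defines "P \<equiv> tensor R L (tensor R M N)"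
  defines "\<And>n l m. \<beta> n l m \<equiv> tens R L (tensor R M N) l (tens R M N m n)"
  shows "bilin R (tensor R L M) N P (\<lambda>t n. tlift R P (\<beta> n) t)"
proof (rule bilinI)
  note MN = tensor_module[OF M N]
  have P: "module R P" unfolding P_def by (rule tensor_module[OF L MN])
  note \<beta> = tassoc_inner[OF L M N, folded P_def \<beta>_def]
  note lin = tlift_lin[OF L M P \<beta>]
  interpret N: module R N by (rule N)
  show "(\<lambda>t. tlift R P (\<beta> n) t) \<in> lin_map R (tensor R L M) P" if "n \<in> carrier N" for n
    using lin[OF that] .
  fix t assume t: "t \<in> carrier (tensor R L M)"
  have \<beta>_lin: "(\<lambda>n. \<beta> n l m) \<in> lin_map R N P" if "l \<in> carrier L" "m \<in> carrier M" for l m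
    unfolding \<beta>_def P_def
    by (rule lin_comp[OF bilin_right[OF tens_bilin[OF M N] that(2)]
          bilin_right[OF tens_bilin[OF L MN] that(1)]])
  show "(\<lambda>n. tlift R P (\<beta> n) t) \<in> lin_map R N P"
  proof (rule lin_mapI)
    fix n assume n: "n \<in> carrier N"
    show "tlift R P (\<beta> n) t \<in> carrier P" by (rule lin_closed[OF lin[OF n] t])
    fix n' assume n': "n' \<in> carrier N"
    show "tlift R P (\<beta> (n \<oplus>\<^bsub>N\<^esub> n')) t = tlift R P (\<beta> n) t \<oplus>\<^bsub>P\<^esub> tlift R P (\<beta> n') t"
      by (rule tensor_ext[OF L M lin[OF N.a_closed[OF n n']] lin_add_fun[OF lin[OF n] lin[OF n'] P] P _ t])
        (simp add: tlift_tens[OF L M P \<beta>] n n' lin_add[OF \<beta>_lin])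
  next
    fix n r assume n: "n \<in> carrier N" and r: "r \<in> carrier R"
    show "tlift R P (\<beta> (r \<odot>\<^bsub>N\<^esub> n)) t = r \<odot>\<^bsub>P\<^esub> tlift R P (\<beta> n) t"
      by (rule tensor_ext[OF L M lin[OF N.smult_closed[OF r n]] lin_smult_fun[OF lin[OF n] P r] P _ t])
        (simp add: tlift_tens[OF L M P \<beta>] n r lin_smult[OF \<beta>_lin])
  qed
qed

lemma tassoc_lin:
  assumes "module R L" "module R M" "module R N"
  shows "tassoc R L M N \<in> lin_map R (tensor R (tensor R L M) N) (tensor R L (tensor R M N))"
  unfolding tassoc_def Let_def
  by (intro tlift_lin tassoc_outer tensor_module assms)

lemma tassoc_tens:
  assumes "module R L" "module R M" "module R N" "l \<in> carrier L" "m \<in> carrier M" "n \<in> carrier N"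
  shows "tassoc R L M N (tens R (tensor R L M) N (tens R L M l m) n) =
    tens R L (tensor R M N) l (tens R M N m n)"
  unfolding tassoc_def Let_def
  by (subst tlift_tens[OF tensor_module[OF assms(1,2)] assms(3) tensor_module[OF assms(1) tensor_module[OF assms(2,3)]]
        tassoc_outer[OF assms(1-3)]])
    (simp_all add: tens_closed assms tlift_tens[OF assms(1,2) tensor_module[OF assms(1) tensor_module[OF assms(2,3)]]
        tassoc_inner[OF assms(1-3)]])

lemma tensor3_ext:
  assumes L: "module R L" and M: "module R M" and N: "module R N" and X: "module R X"
    and f: "f \<in> lin_map R (tensor R (tensor R L M) N) X" and g: "g \<in> lin_map R (tensor R (tensor R L M) N) X"
    and eq: "\<And>l m n. l \<in> carrier L \<Longrightarrow> m \<in> carrier M \<Longrightarrow> n \<in> carrier N \<Longrightarrow>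
      f (tens R (tensor R L M) N (tens R L M l m) n) = g (tens R (tensor R L M) N (tens R L M l m) n)"
    and t: "t \<in> carrier (tensor R (tensor R L M) N)"
  shows "f t = g t"
proof -
  note LM = tensor_module[OF L M]
  have N': "generates R N (carrier N)" by (auto simp: generates_def)
  show ?thesis
    by (rule generates_eq[OF generates_tens[OF LM N generates_tens_free[OF L M] N'] f g tensor_module[OF LM N] X _ t])
      (auto simp: eq)
qed

text \<open>Both sides are linear, and on \<open>(l \<otimes> m) \<otimes> n\<close> both give
  \<open>f l \<otimes> (g m \<otimes> h n)\<close>.\<close>

lemma tassoc_natural:
  assumes f: "f \<in> lin_map R L L'" and g: "g \<in> lin_map R M M'" and h: "h \<in> lin_map R N N'"
    and L: "module R L" "module R L'" and M: "module R M" "module R M'" and N: "module R N" "module R N'"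
    and t: "t \<in> carrier (tensor R (tensor R L M) N)"
  shows "tassoc R L' M' N' (tmap R (tensor R L' M') N' (tmap R L' M' f g) h t) =
    tmap R L' (tensor R M' N') f (tmap R M' N' g h) (tassoc R L M N t)"
proof -
  note mods = L M N tensor_module[OF L(1) M(1)] tensor_module[OF L(2) M(2)] tensor_module[OF M(1) N(1)]
    tensor_module[OF M(2) N(2)]
  note fg = tmap_lin[OF f g L(1) M(1) L(2) M(2)] and gh = tmap_lin[OF g h M(1) N(1) M(2) N(2)]
  show ?thesis
    by (rule tensor3_ext[OF L(1) M(1) N(1) tensor_module[OF L(2) mods(10)]
          lin_comp[OF tmap_lin[OF fg h mods(7,5,8,6)] tassoc_lin[OF L(2) M(2) N(2)]]
          lin_comp[OF tassoc_lin[OF L(1) M(1) N(1)] tmap_lin[OF f gh mods(1,9,2,10)]] _ t])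
      (simp add: tmap_tens[OF fg h mods(7,5,8,6)] tmap_tens[OF f g L(1) M(1) L(2) M(2)]
        tmap_tens[OF g h M(1) N(1) M(2) N(2)] tassoc_tens mods tmap_tens[OF f gh mods(1,9,2,10)]
        f[THEN lin_closed] g[THEN lin_closed] h[THEN lin_closed] tens_closed)
qed

section \<open>Algebras\<close>

lemma algebra_module: "algebra R B \<Longrightarrow> module R B"
  and algebra_cring: "algebra R B \<Longrightarrow> cring B"
  by (rule algebra.module, assumption) (rule algebra.M_cring)

lemma mult_bilin:
  fixes B (structure)
  assumes "algebra R B" shows "bilin R B B B (mult B)"
proof -
  interpret Bc: cring B by (rule algebra_cring) fact
  interpret algebra R B by fact
  have assoc3: "x \<otimes> (r \<odot> y) = r \<odot> (x \<otimes> y)"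
    if "r \<in> carrier R" "x \<in> carrier B" "y \<in> carrier B" for r x y
    using that smult_assoc2[of r y x] by (simp add: Bc.m_comm)
  show ?thesis
    by (intro bilinI lin_mapI) (simp_all add: Bc.l_distr Bc.r_distr smult_assoc2 assoc3)
qed

definition alg_hom :: "('a, 'z) ring_scheme \<Rightarrow> ('a, 'm, 'y) module_scheme \<Rightarrow>
    ('a, 'n, 'x) module_scheme \<Rightarrow> ('m \<Rightarrow> 'n) set" where
  "alg_hom R B C = {f \<in> lin_map R B C. f \<one>\<^bsub>B\<^esub> = \<one>\<^bsub>C\<^esub> \<and>
     (\<forall>x\<in>carrier B. \<forall>y\<in>carrier B. f (x \<otimes>\<^bsub>B\<^esub> y) = f x \<otimes>\<^bsub>C\<^esub> f y)}"

lemma alg_hom_lin: "f \<in> alg_hom R B C \<Longrightarrow> f \<in> lin_map R B C"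
  and alg_hom_one: "f \<in> alg_hom R B C \<Longrightarrow> f \<one>\<^bsub>B\<^esub> = \<one>\<^bsub>C\<^esub>"
  and alg_hom_mult: "f \<in> alg_hom R B C \<Longrightarrow> x \<in> carrier B \<Longrightarrow> y \<in> carrier B \<Longrightarrow>
    f (x \<otimes>\<^bsub>B\<^esub> y) = f x \<otimes>\<^bsub>C\<^esub> f y"
  by (auto simp: alg_hom_def)

text \<open>The image of a product and the product of the images are both bilinear in the two
  arguments, so multiplicativity is decided on generators.\<close>

lemma alg_homI:
  fixes B (structure)
  assumes "generates R B S" "algebra R B" "algebra R C" "f \<in> lin_map R B C" "f \<one> = \<one>\<^bsub>C\<^esub>"
    and eq: "\<And>x y. x \<in> S \<Longrightarrow> y \<in> S \<Longrightarrow> f (x \<otimes> y) = f x \<otimes>\<^bsub>C\<^esub> f y"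
  shows "f \<in> alg_hom R B C"
proof -
  note B = algebra_module[OF assms(2)] and C = algebra_module[OF assms(3)]
  have "f (x \<otimes> y) = f x \<otimes>\<^bsub>C\<^esub> f y" if "x \<in> carrier B" "y \<in> carrier B" for x y
    by (rule bilin_eq[OF assms(1,1) bilin_comp[OF mult_bilin[OF assms(2)] lin_id(1) lin_id(1) assms(4)]
          bilin_comp[OF mult_bilin[OF assms(3)] assms(4) assms(4) lin_id(1)] B B C eq that])
  then show ?thesis using assms(4,5) by (simp add: alg_hom_def)
qed

lemma alg_hom_id: "(\<lambda>x. x) \<in> alg_hom R B B" "id \<in> alg_hom R B B"
  by (simp_all add: alg_hom_def lin_id)

lemma alg_hom_comp: "f \<in> alg_hom R B C \<Longrightarrow> g \<in> alg_hom R C D \<Longrightarrow> (\<lambda>x. g (f x)) \<in> alg_hom R B D"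
  using lin_comp[of f R B C g D] by (auto simp: alg_hom_def lin_closed)

lemma regular_mod_module: "cring R \<Longrightarrow> module R (regular_mod R)"
  by (rule algebra_module[OF regular_mod_algebra])

subsection \<open>Monoid algebras\<close>

context
  fixes R :: "('a, 'z) ring_scheme" and G :: "('g, 'y) monoid_scheme"
  assumes R: "cring R" and G: "comm_monoid G"
begin

interpretation R: cring R by (rule R)
interpretation G: comm_monoid G by (rule G)

private abbreviation "F \<equiv> monoid_alg R G"
private abbreviation "F2 \<equiv> monoid_alg R (G \<times>\<times> G)"

interpretation F: module R F by (rule monoid_alg_module[OF R])

lemma pair_fun_bilin: "bilin R F F F2 (\<lambda>f g p. f (fst p) \<otimes>\<^bsub>R\<^esub> g (snd p))"
proof (intro bilinI lin_mapI)
  fix f g assume f: "f \<in> carrier F" and g: "g \<in> carrier F"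
  have "{p. f (fst p) \<otimes>\<^bsub>R\<^esub> g (snd p) \<noteq> \<zero>\<^bsub>R\<^esub>} \<subseteq> {x. f x \<noteq> \<zero>\<^bsub>R\<^esub>} \<times> {x. g x \<noteq> \<zero>\<^bsub>R\<^esub>}"
    using f g by (auto simp: monoid_alg_carrier)
  then show "(\<lambda>p. f (fst p) \<otimes>\<^bsub>R\<^esub> g (snd p)) \<in> carrier F2"
    using f g unfolding monoid_alg_carrier by (auto intro: finite_subset)
  then show "(\<lambda>p. f (fst p) \<otimes>\<^bsub>R\<^esub> g (snd p)) \<in> carrier F2" .
qed (auto simp: monoid_alg_carrier R.l_distr R.r_distr R.m_assoc R.m_lcomm)

text \<open>Factors convolution into a bilinear map to functions on pairs, followed by the linear
  map induced by the product of \<open>G\<close>. Bilinearity then follows without rearranging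
  double sums.\<close>

lemma monoid_alg_mult_eq:
  assumes "f \<in> carrier F" "g \<in> carrier F"
  shows "f \<otimes>\<^bsub>F\<^esub> g = lext R F (\<lambda>p. basis_elt R (fst p \<otimes>\<^bsub>G\<^esub> snd p)) (\<lambda>p. f (fst p) \<otimes>\<^bsub>R\<^esub> g (snd p))"
proof
  fix x
  let ?A = "{x. f x \<noteq> \<zero>\<^bsub>R\<^esub>} \<times> {x. g x \<noteq> \<zero>\<^bsub>R\<^esub>}"
  let ?h = "\<lambda>p. f (fst p) \<otimes>\<^bsub>R\<^esub> g (snd p)"
  let ?b = "\<lambda>p. basis_elt R (fst p \<otimes>\<^bsub>G\<^esub> snd p)"
  have A: "finite ?A" "\<And>x. f x \<in> carrier R" "\<And>x. g x \<in> carrier R" "?A \<subseteq> carrier G \<times> carrier G"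
    using assms by (auto simp: monoid_alg_carrier)
  have b: "?b p \<in> carrier F" if "p \<in> ?A" for p
    by (rule basis_elt_closed[OF R]) (use that A(4) in auto)
  have h: "?h \<in> carrier F2" by (rule bilin_closed[OF pair_fun_bilin assms])
  have "lext R F ?b ?h x = (\<Oplus>\<^bsub>F\<^esub>p\<in>?A. ?h p \<odot>\<^bsub>F\<^esub> ?b p) x"
    by (subst lext_superset[OF F.module_axioms h A(1) _ b]) (use A in auto)
  also have "\<dots> = (\<Oplus>\<^bsub>R\<^esub>p\<in>?A. (?h p \<odot>\<^bsub>F\<^esub> ?b p) x)"
    by (rule monoid_alg_finsum_apply[OF R]) (use A b in \<open>auto intro!: F.smult_closed\<close>)
  also have "\<dots> = (\<Oplus>\<^bsub>R\<^esub>p\<in>{p. f (fst p) \<noteq> \<zero>\<^bsub>R\<^esub> \<and> g (snd p) \<noteq> \<zero>\<^bsub>R\<^esub> \<and> fst p \<otimes>\<^bsub>G\<^esub> snd p = x}. ?h p)"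
    by (rule R.add.finprod_mono_neutral_cong_right) (use A in \<open>auto simp: basis_elt_def\<close>)
  finally show "(f \<otimes>\<^bsub>F\<^esub> g) x = lext R F ?b ?h x" by (simp add: monoid_alg_def)
qed

lemma monoid_alg_mult_bilin: "bilin R F F F (mult F)"
proof -
  have "lext R F (\<lambda>p. basis_elt R (fst p \<otimes>\<^bsub>G\<^esub> snd p)) \<in> lin_map R F2 F"
    by (rule lext_lin[OF F.module_axioms]) (auto intro!: basis_elt_closed[OF R])
  from bilin_comp[OF pair_fun_bilin lin_id(1) lin_id(1) this]
  have *: "bilin R F F F (\<lambda>f g. lext R F (\<lambda>p. basis_elt R (fst p \<otimes>\<^bsub>G\<^esub> snd p)) (\<lambda>p. f (fst p) \<otimes>\<^bsub>R\<^esub> g (snd p)))" .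
  show ?thesis
    \<comment> \<open>\<open>monoid_alg_mult_eq\<close> holds on carriers only, so linearity is
      transported by \<open>lin_cong\<close>.\<close>
    by (rule bilinI; rule lin_cong[OF _ _ F.module_axioms],
        erule bilin_right[OF *] bilin_left[OF *]) (simp_all add: monoid_alg_mult_eq)
qed

lemma basis_elt_mult:
  assumes "x \<in> carrier G" "y \<in> carrier G"
  shows "basis_elt R x \<otimes>\<^bsub>F\<^esub> basis_elt R y = basis_elt R (x \<otimes>\<^bsub>G\<^esub> y)"
proof -
  have "(\<lambda>p. basis_elt R x (fst p) \<otimes>\<^bsub>R\<^esub> basis_elt R y (snd p)) = basis_elt R (x, y)"
    by (auto simp: basis_elt_def fun_eq_iff)
  then show ?thesis
    using lext_basis[OF F.module_axioms, of "\<lambda>p. basis_elt R (fst p \<otimes>\<^bsub>G\<^esub> snd p)" "(x, y)"] assms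
    by (simp add: monoid_alg_mult_eq basis_elt_closed[OF R])
qed

lemma monoid_alg_one: "\<one>\<^bsub>F\<^esub> = basis_elt R \<one>\<^bsub>G\<^esub>"
  by (simp add: monoid_alg_def basis_elt_def)

text \<open>Each ring law is linear in every variable, so it reduces to the corresponding law of
  \<open>G\<close> on basis elements; distributivity is bilinearity itself.\<close>

lemma monoid_alg_algebra: "algebra R F"
proof -
  note gen = generates_basis[OF R, of G] and mb = monoid_alg_mult_bilin and F = F.module_axioms
  note bc = basis_elt_closed[OF R, of _ G] and idl = lin_id(1)
  have closed: "x \<otimes>\<^bsub>F\<^esub> y \<in> carrier F" if "x \<in> carrier F" "y \<in> carrier F" for x y
    by (rule bilin_closed[OF mb that])
  have comm: "x \<otimes>\<^bsub>F\<^esub> y = y \<otimes>\<^bsub>F\<^esub> x" if "x \<in> carrier F" "y \<in> carrier F" for x y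
  proof (rule bilin_eq[OF gen gen mb _ F F F _ that])
    show "bilin R F F F (\<lambda>x y. y \<otimes>\<^bsub>F\<^esub> x)"
      using mb by (simp add: bilin_def)
  qed (auto simp: basis_elt_mult G.m_comm)
  have assoc: "(x \<otimes>\<^bsub>F\<^esub> y) \<otimes>\<^bsub>F\<^esub> z = x \<otimes>\<^bsub>F\<^esub> (y \<otimes>\<^bsub>F\<^esub> z)"
    if x: "x \<in> carrier F" and y: "y \<in> carrier F" and z: "z \<in> carrier F" for x y z
  proof (rule generates_eq[OF gen _ _ F F _ x])
    show "(\<lambda>x. (x \<otimes>\<^bsub>F\<^esub> y) \<otimes>\<^bsub>F\<^esub> z) \<in> lin_map R F F" "(\<lambda>x. x \<otimes>\<^bsub>F\<^esub> (y \<otimes>\<^bsub>F\<^esub> z)) \<in> lin_map R F F"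
      by (intro lin_comp[OF bilin_left[OF mb y] bilin_left[OF mb z]] bilin_left[OF mb] closed y z)+
    fix s assume "s \<in> basis_elt R ` carrier G"
    then obtain a where a: "a \<in> carrier G" "s = basis_elt R a" by auto
    then have s: "s \<in> carrier F" using bc by simp
    show "(s \<otimes>\<^bsub>F\<^esub> y) \<otimes>\<^bsub>F\<^esub> z = s \<otimes>\<^bsub>F\<^esub> (y \<otimes>\<^bsub>F\<^esub> z)"
      by (rule bilin_eq[OF gen gen bilin_comp[OF mb bilin_right[OF mb s] idl idl]
            bilin_comp[OF mb idl idl bilin_right[OF mb s]] F F F _ y z])
        (auto simp: a basis_elt_mult G.m_assoc)
  qed
  have one: "\<one>\<^bsub>F\<^esub> \<in> carrier F" unfolding monoid_alg_one by (rule bc) simp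
  have l_one: "\<one>\<^bsub>F\<^esub> \<otimes>\<^bsub>F\<^esub> x = x" if "x \<in> carrier F" for x
    by (rule generates_eq[OF gen bilin_right[OF mb one] idl F F _ that])
      (auto simp: monoid_alg_one basis_elt_mult)
  show ?thesis
  proof (rule algebraI[OF R])
    show "cring F"
      by (rule cringI[OF F.abelian_group_axioms comm_monoidI])
        (auto simp: lin_add[OF bilin_left[OF mb]] intro: closed comm assoc one l_one)
    show "\<And>a x y. \<lbrakk>a \<in> carrier R; x \<in> carrier F; y \<in> carrier F\<rbrakk> \<Longrightarrow> a \<odot>\<^bsub>F\<^esub> x \<otimes>\<^bsub>F\<^esub> y = a \<odot>\<^bsub>F\<^esub> (x \<otimes>\<^bsub>F\<^esub> y)"
      by (rule lin_smult[OF bilin_left[OF mb]])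
  qed (simp_all add: F.smult_l_distr F.smult_r_distr F.smult_assoc1)
qed

lemma lext_alg_hom:
  assumes B: "algebra R B" and b: "\<And>x. x \<in> carrier G \<Longrightarrow> b x \<in> carrier B"
    and "\<And>x y. x \<in> carrier G \<Longrightarrow> y \<in> carrier G \<Longrightarrow> b (x \<otimes>\<^bsub>G\<^esub> y) = b x \<otimes>\<^bsub>B\<^esub> b y" "b \<one>\<^bsub>G\<^esub> = \<one>\<^bsub>B\<^esub>"
  shows "lext R B b \<in> alg_hom R F B"
proof (rule alg_homI[OF generates_basis[OF R] monoid_alg_algebra B])
  note Bm = algebra_module[OF B]
  show "lext R B b \<in> lin_map R F B" by (rule lext_lin[OF Bm b])
  show "lext R B b \<one>\<^bsub>F\<^esub> = \<one>\<^bsub>B\<^esub>" unfolding monoid_alg_one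
    using lext_basis[OF Bm, of b "\<one>\<^bsub>G\<^esub>"] b[OF G.one_closed] assms(4) by simp
  fix x y assume "x \<in> basis_elt R ` carrier G" "y \<in> basis_elt R ` carrier G"
  then obtain g h where gh: "g \<in> carrier G" "x = basis_elt R g" "h \<in> carrier G" "y = basis_elt R h" by auto
  then show "lext R B b (x \<otimes>\<^bsub>F\<^esub> y) = lext R B b x \<otimes>\<^bsub>B\<^esub> lext R B b y"
    using lext_basis[OF Bm, of b] b by (simp add: basis_elt_mult assms(3) b[OF G.m_closed[OF gh(1,3)], unfolded assms(3)[OF gh(1,3)]])
qed

end

subsection \<open>Quotient algebras\<close>

lemma ideal_submodule:
  fixes B (structure)
  assumes "algebra R B" "ideal J B" shows "submodule J R B"
proof -
  interpret B: algebra R B by fact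
  interpret J: ideal J B by fact
  have "r \<odot> x \<in> J" if "r \<in> carrier R" "x \<in> J" for r x
  proof -
    \<comment> \<open>A scalar acts as multiplication by a ring element, and an ideal absorbs such
      products.\<close>
    have "r \<odot> x = (r \<odot> \<one>) \<otimes> x"
      using that by (simp add: B.smult_assoc2)
    then show ?thesis using that by (simp add: J.I_l_closed)
  qed
  then show ?thesis
    by (intro submoduleI'[OF B.module]) auto
qed

lemma quot_mod_mult:
  fixes B (structure)
  assumes "algebra R B" "ideal J B" "x \<in> carrier B" "y \<in> carrier B"
  shows "(J +> x) \<otimes>\<^bsub>quot_mod B J\<^esub> (J +> y) = J +> (x \<otimes> y)"
  using ideal.rcoset_mult_add[OF assms(2-4)] by (simp add: quot_mod_simps)

lemma quot_mod_algebra: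
  assumes "algebra R B" "ideal J B" shows "algebra R (quot_mod B J)"
proof -
  interpret Bc: cring B by (rule algebra_cring) fact
  interpret B: algebra R B by fact
  note J = ideal_submodule[OF assms]
  interpret Q: module R "quot_mod B J" by (rule quot_mod_module[OF B.module J])
  note simps = quot_mod_simps(1) quot_mod_mult[OF assms] quot_mod_add[OF B.module J]
    quot_mod_smult[OF B.module J] quot_mod_simps(5)
  show ?thesis
  proof (rule algebraI[OF B.R_cring])
    show "cring (quot_mod B J)"
      by (rule cringI[OF Q.abelian_group_axioms comm_monoidI])
        (auto simp only: simps image_iff Bc.l_distr Bc.m_assoc Bc.m_comm Bc.m_closed Bc.one_closed Bc.l_one
          Bc.a_closed Bc.m_lcomm Bc.r_one Bc.r_distr)
    show "\<And>a x y. \<lbrakk>a \<in> carrier R; x \<in> carrier (quot_mod B J); y \<in> carrier (quot_mod B J)\<rbrakk> \<Longrightarrow>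
        a \<odot>\<^bsub>quot_mod B J\<^esub> x \<otimes>\<^bsub>quot_mod B J\<^esub> y = a \<odot>\<^bsub>quot_mod B J\<^esub> (x \<otimes>\<^bsub>quot_mod B J\<^esub> y)"
      by (auto simp: simps B.smult_assoc2)
  qed (simp_all add: Q.smult_l_distr Q.smult_r_distr Q.smult_assoc1)
qed

lemma coset_alg_hom:
  assumes "algebra R B" "ideal J B" shows "(\<lambda>x. J +>\<^bsub>B\<^esub> x) \<in> alg_hom R B (quot_mod B J)"
  using coset_lin[OF algebra_module[OF assms(1)] ideal_submodule[OF assms]] quot_mod_mult[OF assms]
  by (simp add: alg_hom_def quot_mod_simps)

lemma quot_lift_alg_hom:
  assumes f: "f \<in> alg_hom R B C" and B: "algebra R B" "algebra R C" "ideal J B"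
    and J: "\<And>j. j \<in> J \<Longrightarrow> f j = \<zero>\<^bsub>C\<^esub>"
    and g: "\<And>x. x \<in> carrier B \<Longrightarrow> g (J +>\<^bsub>B\<^esub> x) = f x"
  shows "g \<in> alg_hom R (quot_mod B J) C"
proof -
  interpret B: algebra R B by fact
  note lin = quot_lift_lin[OF alg_hom_lin[OF f] B.module algebra_module[OF B(2)] ideal_submodule[OF B(1,3)] J g]
  show ?thesis
    using lin alg_hom_mult[OF f] alg_hom_one[OF f]
    by (auto simp: alg_hom_def quot_mod_simps(1,5) quot_mod_mult[OF B(1,3)] g)
qed

lemma ideal_kernel:
  assumes f: "f \<in> alg_hom R B C" and B: "algebra R B" and C: "algebra R C"
  shows "ideal {x \<in> carrier B. f x = \<zero>\<^bsub>C\<^esub>} B"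
proof -
  interpret Bc: cring B by (rule algebra_cring) fact
  interpret B: algebra R B by fact
  interpret Cc: cring C by (rule algebra_cring) fact
  interpret C: algebra R C by fact
  have "submodule {x \<in> carrier B. f x \<in> {\<zero>\<^bsub>C\<^esub>}} R B"
    by (intro submodule_vimage[OF alg_hom_lin[OF f] B.module C.module] submodule_zero C.module)
  then show ?thesis
    by (intro idealI Bc.ring_axioms)
      (auto simp: submodule_def alg_hom_mult[OF f] lin_closed[OF alg_hom_lin[OF f]])
qed

text \<open>The kernel is an ideal, so it contains the ideal generated by \<open>S\<close> as soon
  as it contains \<open>S\<close>.\<close>

lemma genideal_kernel:
  fixes C (structure)
  assumes f: "f \<in> alg_hom R B C" and B: "algebra R B" and C: "algebra R C"
    and S: "S \<subseteq> carrier B" "\<And>s. s \<in> S \<Longrightarrow> f s = \<zero>" and j: "j \<in> Idl\<^bsub>B\<^esub> S"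
  shows "f j = \<zero>"
proof -
  interpret Bc: cring B by (rule algebra_cring) fact
  interpret B: algebra R B by fact
  have "Idl\<^bsub>B\<^esub> S \<subseteq> {x \<in> carrier B. f x = \<zero>}"
    by (rule Bc.genideal_minimal[OF ideal_kernel[OF f B C]]) (use S in auto)
  then show ?thesis using j by auto
qed

subsection \<open>Tensor products of algebras\<close>

lemma DirProd_comm_monoid:
  assumes "cring B" "cring C" shows "comm_monoid (B \<times>\<times> C)"
proof -
  interpret B: cring B by fact
  interpret C: cring C by fact
  show ?thesis
    by (rule comm_monoidI) (auto simp: DirProd_def B.m_assoc C.m_assoc intro: B.m_comm C.m_comm)
qed

context
  fixes R :: "('a, 'z) ring_scheme" and B :: "('a, 'm, 'y) module_scheme" and C :: "('a, 'n, 'x) module_scheme"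
  assumes B: "algebra R B" and C: "algebra R C"
begin

interpretation Bc: cring B by (rule algebra_cring) (rule B)
interpretation B: algebra R B by (rule B)
interpretation Cc: cring C by (rule algebra_cring) (rule C)
interpretation C: algebra R C by (rule C)

private abbreviation "FT \<equiv> monoid_alg R (B \<times>\<times> C)"

lemma tensor_free_algebra: "algebra R FT"
  by (rule monoid_alg_algebra[OF B.R_cring DirProd_comm_monoid[OF B.M_cring C.M_cring]])

interpretation Fc: cring FT by (rule algebra_cring) (rule tensor_free_algebra)
interpretation F: algebra R FT by (rule tensor_free_algebra)

private lemma bmult:
  assumes "b \<in> carrier B" "b' \<in> carrier B" "c \<in> carrier C" "c' \<in> carrier C"
  shows "basis_elt R (b, c) \<otimes>\<^bsub>FT\<^esub> basis_elt R (b', c') = basis_elt R (b \<otimes>\<^bsub>B\<^esub> b', c \<otimes>\<^bsub>C\<^esub> c')"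
  using assms basis_elt_mult[OF B.R_cring DirProd_comm_monoid[OF B.M_cring C.M_cring], of "(b, c)" "(b', c')"]
  by (simp add: DirProd_def)

text \<open>Multiplication by a basis element \<open>(b, c)\<close>, followed by passage to the
  tensor product, is the linear extension of the bilinear map that sends \<open>(x, y)\<close> to
  \<open>b x \<otimes> c y\<close>. It therefore kills the relations. Arbitrary multipliers follow
  since basis elements generate.\<close>

lemma tensor_rels_ideal: "ideal (tensor_rels R B C) FT"
proof -
  note F = F.module and J = tensor_rels_submodule[OF B.module C.module]
  note mb = mult_bilin[OF tensor_free_algebra] and bas = bas_closed[OF B.module C.module]
  let ?J = "tensor_rels R B C"
  have 1: "x \<otimes>\<^bsub>FT\<^esub> z \<in> ?J" if x: "x \<in> basis_elt R ` carrier (B \<times>\<times> C)" and z: "z \<in> ?J" for x z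
  proof -
    obtain b c where bc: "b \<in> carrier B" "c \<in> carrier C" "x = basis_elt R (b, c)" using x by auto
    have xc: "x \<in> carrier FT" and zc: "z \<in> carrier FT" using bc bas z submodule_facts(1)[OF J F] by auto
    note T = tensor_module[OF B.module C.module] and col = coset_lin_tensor[OF B.module C.module]
    note \<beta> = bilin_comp[OF tens_bilin[OF B.module C.module] bilin_right[OF mult_bilin[OF B] bc(1)]
        bilin_right[OF mult_bilin[OF C] bc(2)] lin_id(1)]
    have "?J +>\<^bsub>FT\<^esub> (x \<otimes>\<^bsub>FT\<^esub> z) =
        lext R (tensor R B C) (\<lambda>p. tens R B C (b \<otimes>\<^bsub>B\<^esub> fst p) (c \<otimes>\<^bsub>C\<^esub> snd p)) z"
      by (rule generates_eq[OF generates_basis[OF B.R_cring] lin_comp[OF bilin_right[OF mb xc] col]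
            tlift_ev_lin[OF B.module C.module T \<beta>] F T _ zc])
        (auto simp: tlift_ev_basis[OF B.module C.module T \<beta>] bc bmult tens_def[symmetric])
    then have "?J +>\<^bsub>FT\<^esub> (x \<otimes>\<^bsub>FT\<^esub> z) = ?J"
      using tlift_ev_rels[OF B.module C.module T \<beta> z] by (simp add: tensor_def quot_mod_simps)
    then show ?thesis using self_mem_coset[OF F J, of "x \<otimes>\<^bsub>FT\<^esub> z"] bilin_closed[OF mb xc zc] by simp
  qed
  have 2: "x \<otimes>\<^bsub>FT\<^esub> z \<in> ?J" if x: "x \<in> carrier FT" and z: "z \<in> ?J" for x z
    by (rule generates_mem[OF generates_basis[OF B.R_cring] bilin_left[OF mb] F F J 1[OF _ z] x])
      (use z submodule_facts(1)[OF J F] in auto)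
  show ?thesis
  proof (rule idealI[OF Fc.ring_axioms])
    show "subgroup ?J (add_monoid FT)" using J by (simp add: submodule_def)
    show "x \<otimes>\<^bsub>FT\<^esub> a \<in> ?J" "a \<otimes>\<^bsub>FT\<^esub> x \<in> ?J" if "a \<in> ?J" "x \<in> carrier FT" for a x
      using 2[OF that(2,1)] Fc.m_comm[OF that(2)] that submodule_facts(1)[OF J F] by auto
  qed
qed

lemma tensor_algebra: "algebra R (tensor R B C)"
  unfolding tensor_def by (rule quot_mod_algebra[OF tensor_free_algebra tensor_rels_ideal])

lemma tens_mult:
  assumes "b \<in> carrier B" "b' \<in> carrier B" "c \<in> carrier C" "c' \<in> carrier C"
  shows "tens R B C b c \<otimes>\<^bsub>tensor R B C\<^esub> tens R B C b' c' = tens R B C (b \<otimes>\<^bsub>B\<^esub> b') (c \<otimes>\<^bsub>C\<^esub> c')"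
  unfolding tens_def tensor_def
  using quot_mod_mult[OF tensor_free_algebra tensor_rels_ideal] bmult[OF assms]
    bas_closed[OF B.module C.module] assms by simp

lemma tens_one: "\<one>\<^bsub>tensor R B C\<^esub> = tens R B C \<one>\<^bsub>B\<^esub> \<one>\<^bsub>C\<^esub>"
  unfolding tens_def tensor_def
  by (simp add: quot_mod_simps monoid_alg_one[OF B.R_cring DirProd_comm_monoid[OF B.M_cring C.M_cring]] one_DirProd)

end

lemma tmap_alg_hom:
  assumes f: "f \<in> alg_hom R B B'" and g: "g \<in> alg_hom R C C'"
    and B: "algebra R B" "algebra R C" "algebra R B'" "algebra R C'"
  shows "tmap R B' C' f g \<in> alg_hom R (tensor R B C) (tensor R B' C')"
proof -
  note m = B[THEN algebra_module]
  interpret Bc: cring B by (rule algebra_cring) (rule B)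
  interpret Cc: cring C by (rule algebra_cring) (rule B)
  note fl = alg_hom_lin[OF f] and gl = alg_hom_lin[OF g]
  note tt = tmap_tens[OF fl gl m]
  show ?thesis
  proof (rule alg_homI[OF generates_tens_free[OF m(1,2)] tensor_algebra[OF B(1,2)] tensor_algebra[OF B(3,4)] tmap_lin[OF fl gl m]])
    show "tmap R B' C' f g \<one>\<^bsub>tensor R B C\<^esub> = \<one>\<^bsub>tensor R B' C'\<^esub>"
      by (simp add: tens_one[OF B(1,2)] tens_one[OF B(3,4)] tt alg_hom_one[OF f] alg_hom_one[OF g])
  qed (auto simp: tens_mult[OF B(1,2)] tens_mult[OF B(3,4)] tt alg_hom_mult[OF f] alg_hom_mult[OF g]
      lin_closed[OF fl] lin_closed[OF gl])
qed

lemma tassoc_alg_hom: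
  assumes B: "algebra R B" and C: "algebra R C" and D: "algebra R D"
  shows "tassoc R B C D \<in> alg_hom R (tensor R (tensor R B C) D) (tensor R B (tensor R C D))"
proof -
  note m = assms[THEN algebra_module]
  interpret Bc: cring B by (rule algebra_cring) (rule B)
  interpret Cc: cring C by (rule algebra_cring) (rule C)
  interpret Dc: cring D by (rule algebra_cring) (rule D)
  note BC = tensor_algebra[OF B C] and CD = tensor_algebra[OF C D]
  have gD: "generates R D (carrier D)" by (auto simp: generates_def)
  note simps = tassoc_tens[OF m] tens_mult[OF B C] tens_mult[OF C D] tens_mult[OF BC D] tens_mult[OF B CD]
    tens_closed[OF m(1,2)] tens_closed[OF m(2,3)]
  show ?thesis
  proof (rule alg_homI[OF generates_tens[OF tensor_module[OF m(1,2)] m(3) generates_tens_free[OF m(1,2)] gD]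
        tensor_algebra[OF BC D] tensor_algebra[OF B CD] tassoc_lin[OF m]])
    show "tassoc R B C D \<one>\<^bsub>tensor R (tensor R B C) D\<^esub> = \<one>\<^bsub>tensor R B (tensor R C D)\<^esub>"
      by (simp add: tens_one[OF BC D] tens_one[OF B CD] tens_one[OF B C] tens_one[OF C D] tassoc_tens[OF m])
  qed (auto simp: simps)
qed

section \<open>Homomorphisms, annihilators and integer powers\<close>

lemma alg_hom_closed: "f \<in> alg_hom R B C \<Longrightarrow> x \<in> carrier B \<Longrightarrow> f x \<in> carrier C"
  by (rule lin_closed[OF alg_hom_lin])

lemma alg_hom_minus: "f \<in> alg_hom R B C \<Longrightarrow> algebra R B \<Longrightarrow> algebra R C \<Longrightarrow>
    x \<in> carrier B \<Longrightarrow> y \<in> carrier B \<Longrightarrow> f (x \<ominus>\<^bsub>B\<^esub> y) = f x \<ominus>\<^bsub>C\<^esub> f y"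
  by (rule lin_minus[OF alg_hom_lin algebra_module algebra_module])

lemma alg_hom_add: "f \<in> alg_hom R B C \<Longrightarrow> x \<in> carrier B \<Longrightarrow> y \<in> carrier B \<Longrightarrow>
    f (x \<oplus>\<^bsub>B\<^esub> y) = f x \<oplus>\<^bsub>C\<^esub> f y"
  by (rule lin_add[OF alg_hom_lin])

lemma tens_left_alg_hom:
  assumes B: "algebra R B" and C: "algebra R C"
  shows "(\<lambda>x. tens R B C x \<one>\<^bsub>C\<^esub>) \<in> alg_hom R B (tensor R B C)"
proof -
  interpret Bc: cring B by (rule algebra_cring[OF B])
  interpret Cc: cring C by (rule algebra_cring[OF C])
  show ?thesis
    using bilin_left[OF tens_bilin[OF B[THEN algebra_module] C[THEN algebra_module]] Cc.one_closed]
    by (simp add: alg_hom_def tens_one[OF B C] tens_mult[OF B C])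
qed

lemma tens_right_alg_hom:
  assumes B: "algebra R B" and C: "algebra R C"
  shows "(\<lambda>x. tens R B C \<one>\<^bsub>B\<^esub> x) \<in> alg_hom R C (tensor R B C)"
proof -
  interpret Bc: cring B by (rule algebra_cring[OF B])
  interpret Cc: cring C by (rule algebra_cring[OF C])
  show ?thesis
    using bilin_right[OF tens_bilin[OF B[THEN algebra_module] C[THEN algebra_module]] Bc.one_closed]
    by (simp add: alg_hom_def tens_one[OF B C] tens_mult[OF B C])
qed

lemma tens_zero:
  assumes "module R M" "module R N"
  shows "x \<in> carrier N \<Longrightarrow> tens R M N \<zero>\<^bsub>M\<^esub> x = \<zero>\<^bsub>tensor R M N\<^esub>"
    and "y \<in> carrier M \<Longrightarrow> tens R M N y \<zero>\<^bsub>N\<^esub> = \<zero>\<^bsub>tensor R M N\<^esub>"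
  using lin_zero[OF bilin_left[OF tens_bilin[OF assms]] assms(1) tensor_module[OF assms]]
    lin_zero[OF bilin_right[OF tens_bilin[OF assms]] assms(2) tensor_module[OF assms]] by auto

text \<open>Meant for products of ideals: one factor can be enlarged from generators to the ideal
  they generate while the other stays fixed.\<close>

lemma ideal_annihilator:
  fixes C (structure)
  assumes f: "f \<in> alg_hom R B C" and B: "algebra R B" and C: "algebra R C" and y: "y \<in> carrier C"
  shows "ideal {x \<in> carrier B. f x \<otimes> y = \<zero>} B"
proof -
  interpret Bc: cring B by (rule algebra_cring) fact
  interpret Cc: cring C by (rule algebra_cring) fact
  have "submodule {x \<in> carrier B. f x \<otimes> y \<in> {\<zero>}} R B"
    by (rule submodule_vimage[OF lin_comp[OF alg_hom_lin[OF f] bilin_left[OF mult_bilin[OF C] y]]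
          algebra_module[OF B] algebra_module[OF C] submodule_zero[OF algebra_module[OF C]]])
  then have 1: "subgroup {x \<in> carrier B. f x \<otimes> y = \<zero>} (add_monoid B)"
    by (simp add: submodule_def)
  have 2: "f (x \<otimes>\<^bsub>B\<^esub> a) \<otimes> y = \<zero>" if "a \<in> carrier B" "f a \<otimes> y = \<zero>" "x \<in> carrier B" for a x
    using that y by (simp add: alg_hom_mult[OF f] alg_hom_closed[OF f] Cc.m_assoc)
  show ?thesis
    by (rule idealI[OF Bc.ring_axioms 1]) (use 2 Bc.m_comm in auto)
qed

text \<open>Annihilators are ideals, so vanishing spreads from products of generators to products
  with any \<open>x\<close> of the first ideal, and from there to any \<open>y\<close> of the
  second. Sums of such products exhaust the product ideal.\<close>

lemma ideal_prod_kernel: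
  fixes B (structure)
  assumes f: "f \<in> alg_hom R B C" and B: "algebra R B" and C: "algebra R C"
    and S: "S \<subseteq> carrier B" "S' \<subseteq> carrier B"
    and zero: "\<And>s s'. s \<in> S \<Longrightarrow> s' \<in> S' \<Longrightarrow> f s \<otimes>\<^bsub>C\<^esub> f s' = \<zero>\<^bsub>C\<^esub>"
    and j: "j \<in> (Idl S) \<cdot> (Idl S')"
  shows "f j = \<zero>\<^bsub>C\<^esub>"
proof -
  interpret Bc: cring B by (rule algebra_cring) fact
  interpret Cc: cring C by (rule algebra_cring) fact
  note fc = alg_hom_closed[OF f]
  have carr: "x \<in> carrier B" if "x \<in> Idl S" for x
    using that ideal.Icarr[OF Bc.genideal_ideal[OF S(1)]] by blast
  have carr': "x \<in> carrier B" if "x \<in> Idl S'" for x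
    using that ideal.Icarr[OF Bc.genideal_ideal[OF S(2)]] by blast
  have 1: "f x \<otimes>\<^bsub>C\<^esub> f s' = \<zero>\<^bsub>C\<^esub>" if "x \<in> Idl S" "s' \<in> S'" for x s'
  proof -
    have "Idl S \<subseteq> {x \<in> carrier B. f x \<otimes>\<^bsub>C\<^esub> f s' = \<zero>\<^bsub>C\<^esub>}"
      by (rule Bc.genideal_minimal[OF ideal_annihilator[OF f B C fc]]) (use that S zero in auto)
    then show ?thesis using that by auto
  qed
  have 2: "f x \<otimes>\<^bsub>C\<^esub> f y = \<zero>\<^bsub>C\<^esub>" if "x \<in> Idl S" "y \<in> Idl S'" for x y
  proof -
    have "Idl S' \<subseteq> {y \<in> carrier B. f y \<otimes>\<^bsub>C\<^esub> f x = \<zero>\<^bsub>C\<^esub>}"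
      by (rule Bc.genideal_minimal[OF ideal_annihilator[OF f B C fc[OF carr[OF that(1)]]]])
        (use S 1[OF that(1)] Cc.m_comm[OF fc[OF carr[OF that(1)]] fc] in \<open>auto simp: subset_iff\<close>)
    then show ?thesis using that fc carr carr' Cc.m_comm by auto
  qed
  show ?thesis
    using j
  proof (induction j rule: ideal_prod.induct)
    case (prod i j)
    then show ?case using 2 carr carr' by (simp add: alg_hom_mult[OF f])
  next
    case (sum s1 s2)
    have c: "s \<in> carrier B" if "s \<in> (Idl S) \<cdot> (Idl S')" for s
      using that Bc.ideal_prod_in_carrier[OF Bc.genideal_ideal[OF S(1)] Bc.genideal_ideal[OF S(2)]] by blast
    show ?case using sum c by (simp add: alg_hom_add[OF f])
  qed
qed

text \<open>The family \<open>g\<close> is a one-parameter group in \<open>C\<close>. With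
  \<open>g\<close> a family of Laurent monomials, this computes the images of the integer powers
  that occur in \<open>wt\<close>.\<close>

lemma alg_hom_int_pow:
  fixes g :: "int \<Rightarrow> 'c"
  assumes f: "f \<in> alg_hom R B C" and B: "algebra R B" and C: "algebra R C" and x: "x \<in> Units B"
    and g: "\<And>a. g a \<in> carrier C" "g 0 = \<one>\<^bsub>C\<^esub>" "\<And>a b. g (a + b) = g a \<otimes>\<^bsub>C\<^esub> g b" and fx: "f x = g 1"
  shows "x [^]\<^bsub>B\<^esub> a \<in> carrier B" "f (x [^]\<^bsub>B\<^esub> (a :: int)) = g a"
proof -
  interpret Bc: cring B by (rule algebra_cring) fact
  interpret Cc: cring C by (rule algebra_cring) fact
  have xc: "x \<in> carrier B" using x by (rule Bc.Units_closed)
  have nat: "f (x [^]\<^bsub>B\<^esub> n) = g (int n)" for n :: nat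
  proof (induction n)
    case (Suc n)
    have "g (int (Suc n)) = g (int n) \<otimes>\<^bsub>C\<^esub> g 1" unfolding g(3)[symmetric] by (simp add: add.commute)
    then show ?case using Suc xc by (simp add: alg_hom_mult[OF f] fx)
  qed (simp add: g(2) alg_hom_one[OF f])
  \<comment> \<open>For negative \<open>a\<close> this is the positive power of \<open>x\<close>
    whose inverse is the integer power.\<close>
  define y where "y = x [^]\<^bsub>B\<^esub> nat (- a)"
  have "x [^]\<^bsub>B\<^esub> n \<in> Units B" for n :: nat by (induction n) (use x in auto)
  then have y: "y \<in> Units B" unfolding y_def .
  have inv: "f (inv\<^bsub>B\<^esub> y) = g a" if "a < 0"
  proof -
    have fy: "f y = g (- a)" using that nat[of "nat (- a)"] by (simp add: y_def)
    have "f y \<otimes>\<^bsub>C\<^esub> f (inv\<^bsub>B\<^esub> y) = \<one>\<^bsub>C\<^esub>"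
      using y Bc.Units_closed[OF y] Bc.Units_inv_closed[OF y]
      by (simp add: alg_hom_mult[OF f, symmetric] Bc.Units_r_inv alg_hom_one[OF f])
    then have e: "g (- a) \<otimes>\<^bsub>C\<^esub> f (inv\<^bsub>B\<^esub> y) = \<one>\<^bsub>C\<^esub>" by (simp only: fy)
    have "g a \<otimes>\<^bsub>C\<^esub> g (- a) = \<one>\<^bsub>C\<^esub>" by (simp add: g(3)[symmetric] g(2))
    \<comment> \<open>Uniqueness of inverses: the image of the inverse of \<open>y\<close> and the
      element \<open>g a\<close> are both inverse to \<open>g (- a)\<close>.\<close>
    then have "f (inv\<^bsub>B\<^esub> y) = (g a \<otimes>\<^bsub>C\<^esub> g (- a)) \<otimes>\<^bsub>C\<^esub> f (inv\<^bsub>B\<^esub> y)"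
      by (simp only: Cc.l_one[OF alg_hom_closed[OF f Bc.Units_inv_closed[OF y]]])
    also have "\<dots> = g a"
      unfolding Cc.m_assoc[OF g(1) g(1) alg_hom_closed[OF f Bc.Units_inv_closed[OF y]]] e by (rule Cc.r_one[OF g(1)])
    finally show ?thesis .
  qed
  have pow: "x [^]\<^bsub>B\<^esub> a = (if a < 0 then inv\<^bsub>B\<^esub> y else x [^]\<^bsub>B\<^esub> nat a)"
    unfolding y_def by (rule int_pow_def2)
  show "x [^]\<^bsub>B\<^esub> a \<in> carrier B"
    unfolding pow using Bc.nat_pow_closed[OF xc, of "nat a"] Bc.Units_inv_closed[OF y] by presburger
  show "f (x [^]\<^bsub>B\<^esub> a) = g a"
  proof (cases "a < 0")
    case True
    then show ?thesis unfolding pow using inv by simp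
  next
    case False
    then show ?thesis unfolding pow using nat[of "nat a"] by simp
  qed
qed

text \<open>Multiplicativity of the 2 by 2 determinant, which is what makes \<open>D\<close>
  grouplike.\<close>

lemma (in cring) det_product:
  assumes "a \<in> carrier R" "b \<in> carrier R" "c \<in> carrier R" "d \<in> carrier R"
    and "a' \<in> carrier R" "b' \<in> carrier R" "c' \<in> carrier R" "d' \<in> carrier R"
  shows "(a \<otimes> a' \<oplus> b \<otimes> c') \<otimes> (c \<otimes> b' \<oplus> d \<otimes> d') \<ominus> (a \<otimes> b' \<oplus> b \<otimes> d') \<otimes> (c \<otimes> a' \<oplus> d \<otimes> c') =
    (a \<otimes> d \<ominus> b \<otimes> c) \<otimes> (a' \<otimes> d' \<ominus> b' \<otimes> c')"
  using assms by algebra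

section \<open>Coalgebras and comodules\<close>

lemma coalgebraD:
  assumes "coalgebra R C \<Delta> \<epsilon>"
  shows "module R C" "\<Delta> \<in> lin_map R C (tensor R C C)" "\<epsilon> \<in> lin_map R C (regular_mod R)"
    "\<And>c. c \<in> carrier C \<Longrightarrow>
        tassoc R C C C (tmap R (tensor R C C) C \<Delta> id (\<Delta> c)) = tmap R C (tensor R C C) id \<Delta> (\<Delta> c)"
    "\<And>c. c \<in> carrier C \<Longrightarrow> tlift R C (\<lambda>x y. \<epsilon> x \<odot>\<^bsub>C\<^esub> y) (\<Delta> c) = c"
    "\<And>c. c \<in> carrier C \<Longrightarrow> tlift R C (\<lambda>x y. \<epsilon> y \<odot>\<^bsub>C\<^esub> x) (\<Delta> c) = c"
  using assms by (auto simp: coalgebra_def)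

lemma comoduleD:
  assumes "comodule R C \<Delta> \<epsilon> M \<delta>"
  shows "coalgebra R C \<Delta> \<epsilon>" "module R M" "\<delta> \<in> lin_map R M (tensor R C M)"
    "\<And>v. v \<in> carrier M \<Longrightarrow>
        tassoc R C C M (tmap R (tensor R C C) M \<Delta> id (\<delta> v)) = tmap R C (tensor R C M) id \<delta> (\<delta> v)"
    "\<And>v. v \<in> carrier M \<Longrightarrow> tlift R M (\<lambda>c w. \<epsilon> c \<odot>\<^bsub>M\<^esub> w) (\<delta> v) = v"
  using assms by (auto simp: comodule_def)

lemma smult_bilin:
  fixes M (structure)
  assumes "module R M" shows "bilin R (regular_mod R) M M (smult M)"
proof -
  interpret M: module R M by fact
  have lcomm: "r \<odot> (s \<odot> x) = s \<odot> (r \<odot> x)" if "r \<in> carrier R" "s \<in> carrier R" "x \<in> carrier M" for r s x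
    using that M.smult_assoc1[of r s x] M.smult_assoc1[of s r x] M.R.m_comm[of r s] by metis
  show ?thesis
    by (intro bilinI lin_mapI)
      (simp_all add: M.smult_l_distr M.smult_r_distr M.smult_assoc1 lcomm)
qed

lemma counit_bilin:
  assumes "module R M" "\<epsilon> \<in> lin_map R C (regular_mod R)"
  shows "bilin R C M M (\<lambda>c w. \<epsilon> c \<odot>\<^bsub>M\<^esub> w)"
  using bilin_comp[OF smult_bilin[OF assms(1)] assms(2) lin_id(1) lin_id(1)] .

lemma counit_bilin_right:
  assumes "module R M" "\<epsilon> \<in> lin_map R C (regular_mod R)"
  shows "bilin R M C M (\<lambda>w c. \<epsilon> c \<odot>\<^bsub>M\<^esub> w)"
  using counit_bilin[OF assms] by (simp add: bilin_def)

text \<open>The condition on \<open>\<Delta>\<close> is the coideal property, phrased through the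
  kernel of \<open>\<pi> \<otimes> \<pi>\<close> so that this kernel need not be described. Every
  axiom of the quotient is the image of an axiom of \<open>C\<close> under the surjection
  \<open>\<pi>\<close>.\<close>

lemma quot_coalgebra:
  fixes C (structure)
  assumes C: "coalgebra R C \<Delta> \<epsilon>" and J: "submodule J R C"
    and \<Delta>J: "\<And>j. j \<in> J \<Longrightarrow>
      tmap R (quot_mod C J) (quot_mod C J) (\<lambda>c. J +> c) (\<lambda>c. J +> c) (\<Delta> j) =
        \<zero>\<^bsub>tensor R (quot_mod C J) (quot_mod C J)\<^esub>"
    and \<epsilon>J: "\<And>j. j \<in> J \<Longrightarrow> \<epsilon> j = \<zero>\<^bsub>R\<^esub>"
  shows "coalgebra R (quot_mod C J) (quot_comult R C J \<Delta>) (quot_counit \<epsilon>)" (is ?thesis1)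
    and "\<And>c. c \<in> carrier C \<Longrightarrow> quot_comult R C J \<Delta> (J +> c) =
      tmap R (quot_mod C J) (quot_mod C J) (\<lambda>c. J +> c) (\<lambda>c. J +> c) (\<Delta> c)"
    and "\<And>c. c \<in> carrier C \<Longrightarrow> quot_counit \<epsilon> (J +> c) = \<epsilon> c"
proof -
  let ?Q = "quot_mod C J" and ?\<pi> = "\<lambda>c. J +> c"
  let ?\<Delta> = "quot_comult R C J \<Delta>" and ?\<epsilon> = "quot_counit \<epsilon>"
  let ?p = "tmap R ?Q ?Q ?\<pi> ?\<pi>" and ?as = "tassoc R ?Q ?Q ?Q" and ?D = "\<lambda>c. tmap R (tensor R C C) C \<Delta> id (\<Delta> c)" and ?Q2 = "tensor R ?Q ?Q"
  note Cm = coalgebraD(1)[OF C] and \<Delta> = coalgebraD(2)[OF C] and \<epsilon> = coalgebraD(3)[OF C]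
  have R: "cring R" by (rule module_cring[OF Cm])
  have Q: "module R ?Q" by (rule quot_mod_module[OF Cm J])
  have \<pi>: "?\<pi> \<in> lin_map R C ?Q" by (rule coset_lin[OF Cm J])
  note CC = tensor_module[OF Cm Cm] and QQ = tensor_module[OF Q Q]
  note pp = tmap_lin[OF \<pi> \<pi> Cm Cm Q Q]
  note D = lin_comp[OF \<Delta> pp]
  show comult: "?\<Delta> (?\<pi> c) = ?p (\<Delta> c)" if "c \<in> carrier C" for c
    unfolding quot_comult_def Let_def
    by (rule the_elem_image_coset_lin[OF D Cm QQ J \<Delta>J that])
  show counit: "?\<epsilon> (?\<pi> c) = \<epsilon> c" if "c \<in> carrier C" for c
    unfolding quot_counit_def
    by (rule the_elem_image_coset_lin[OF \<epsilon> Cm regular_mod_module[OF R] J _ that]) (simp add: \<epsilon>J)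
  have \<Delta>': "?\<Delta> \<in> lin_map R ?Q (?Q2)"
    by (rule quot_lift_lin[OF D Cm QQ J \<Delta>J comult])
  have \<epsilon>': "?\<epsilon> \<in> lin_map R ?Q (regular_mod R)"
    by (rule quot_lift_lin[OF \<epsilon> Cm regular_mod_module[OF R] J _ counit]) (simp_all add: \<epsilon>J)
  have "?as (tmap R (?Q2) ?Q ?\<Delta> id (?\<Delta> X)) =
        tmap R ?Q (?Q2) id ?\<Delta> (?\<Delta> X) \<and>
      tlift R ?Q (\<lambda>x y. ?\<epsilon> x \<odot>\<^bsub>?Q\<^esub> y) (?\<Delta> X) = X \<and> tlift R ?Q (\<lambda>x y. ?\<epsilon> y \<odot>\<^bsub>?Q\<^esub> x) (?\<Delta> X) = X"
    if X: "X \<in> carrier ?Q" for X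
  proof -
    obtain c where c: "c \<in> carrier C" "X = ?\<pi> c" using X by (auto simp: quot_mod_simps)
    note \<Delta>c = lin_closed[OF \<Delta> c(1)]
    \<comment> \<open>The chain pulls the projections to the outside, passes the associator by
      naturality, applies coassociativity of \<open>C\<close>, and pushes the projections in
      again.\<close>
    have "tmap R (?Q2) ?Q ?\<Delta> id (?p (\<Delta> c)) =
        tmap R (?Q2) ?Q (\<lambda>x. ?p (\<Delta> x)) ?\<pi> (\<Delta> c)"
      by (rule tmap_tmap[OF \<pi> \<pi> \<Delta>' lin_id(2) Cm Cm Q Q QQ Q \<Delta>c D \<pi>]) (simp_all add: comult)
    also have "\<dots> = tmap R (?Q2) ?Q (?p) ?\<pi> ((?D c))"
      by (rule tmap_tmap[OF \<Delta> lin_id(2) pp \<pi> Cm Cm CC Cm QQ Q \<Delta>c D \<pi>, symmetric]) simp_all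
    finally have "?as (tmap R (?Q2) ?Q ?\<Delta> id (?p (\<Delta> c))) =
        ?as (tmap R (?Q2) ?Q (?p) ?\<pi> ((?D c)))"
      by (rule arg_cong)
    also have "\<dots> =
        tmap R ?Q (?Q2) ?\<pi> (?p) (tassoc R C C C ((?D c)))"
      by (rule tassoc_natural[OF \<pi> \<pi> \<pi> Cm Q Cm Q Cm Q lin_closed[OF tmap_lin[OF \<Delta> lin_id(2) Cm Cm CC Cm] \<Delta>c]])
    also have "\<dots> = tmap R ?Q (?Q2) ?\<pi> (?p) (tmap R C (tensor R C C) id \<Delta> (\<Delta> c))"
      by (simp add: coalgebraD(4)[OF C c(1)])
    also have "\<dots> = tmap R ?Q (?Q2) ?\<pi> (\<lambda>x. ?p (\<Delta> x)) (\<Delta> c)"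
      by (rule tmap_tmap[OF lin_id(2) \<Delta> \<pi> pp Cm Cm Cm CC Q QQ \<Delta>c \<pi> D]) simp_all
    also have "\<dots> = tmap R ?Q (?Q2) id ?\<Delta> (?p (\<Delta> c))"
      by (rule tmap_tmap[OF \<pi> \<pi> lin_id(2) \<Delta>' Cm Cm Q Q Q QQ \<Delta>c \<pi> D, symmetric]) (simp_all add: comult)
    finally have 1: "?as (tmap R (?Q2) ?Q ?\<Delta> id (?\<Delta> X)) =
        tmap R ?Q (?Q2) id ?\<Delta> (?\<Delta> X)" by (simp only: c(2) comult[OF c(1)])
    have "tlift R ?Q (\<lambda>x y. ?\<epsilon> x \<odot>\<^bsub>?Q\<^esub> y) (?\<Delta> X) = ?\<pi> (tlift R C (\<lambda>x y. \<epsilon> x \<odot> y) (\<Delta> c))"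
      unfolding c(2) comult[OF c(1)]
      by (rule tensor_ext[OF Cm Cm lin_comp[OF pp tlift_lin[OF Q Q Q counit_bilin[OF Q \<epsilon>']]]
            lin_comp[OF tlift_lin[OF Cm Cm Cm counit_bilin[OF Cm \<epsilon>]] \<pi>] Q _ \<Delta>c])
        (simp add: tmap_tens[OF \<pi> \<pi> Cm Cm Q Q] tlift_tens[OF Q Q Q counit_bilin[OF Q \<epsilon>']]
          tlift_tens[OF Cm Cm Cm counit_bilin[OF Cm \<epsilon>]] lin_closed[OF \<pi>] counit
          lin_smult[OF \<pi>] lin_closed[OF \<epsilon>, simplified])
    moreover have "tlift R ?Q (\<lambda>x y. ?\<epsilon> y \<odot>\<^bsub>?Q\<^esub> x) (?\<Delta> X) = ?\<pi> (tlift R C (\<lambda>x y. \<epsilon> y \<odot> x) (\<Delta> c))"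
      unfolding c(2) comult[OF c(1)]
      by (rule tensor_ext[OF Cm Cm lin_comp[OF pp tlift_lin[OF Q Q Q counit_bilin_right[OF Q \<epsilon>']]]
            lin_comp[OF tlift_lin[OF Cm Cm Cm counit_bilin_right[OF Cm \<epsilon>]] \<pi>] Q _ \<Delta>c])
        (simp add: tmap_tens[OF \<pi> \<pi> Cm Cm Q Q] tlift_tens[OF Q Q Q counit_bilin_right[OF Q \<epsilon>']]
          tlift_tens[OF Cm Cm Cm counit_bilin_right[OF Cm \<epsilon>]] lin_closed[OF \<pi>] counit
          lin_smult[OF \<pi>] lin_closed[OF \<epsilon>, simplified])
    ultimately show ?thesis using 1 coalgebraD(5,6)[OF C c(1)] c(2) by simp
  qed
  then show ?thesis1 unfolding coalgebra_def by (intro conjI ballI Q \<Delta>' \<epsilon>') simp_all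
qed

text \<open>The change of coalgebra along a morphism \<open>q\<close>. It is applied to
  \<open>k[G] \<rightarrow> k[N]\<close> and to \<open>k[N] \<rightarrow> k[T]\<close>.\<close>

lemma comodule_pushforward:
  fixes M (structure)
  assumes M: "comodule R C \<Delta> \<epsilon> M \<delta>" and C': "coalgebra R C' \<Delta>' \<epsilon>'" and q: "q \<in> lin_map R C C'"
    and comult: "\<And>c. c \<in> carrier C \<Longrightarrow> \<Delta>' (q c) = tmap R C' C' q q (\<Delta> c)"
    and counit: "\<And>c. c \<in> carrier C \<Longrightarrow> \<epsilon>' (q c) = \<epsilon> c"
  shows "comodule R C' \<Delta>' \<epsilon>' M (\<lambda>v. tmap R C' M q id (\<delta> v))"
proof -
  let ?q = "tmap R C' M q id" and ?qq = "tmap R C' C' q q" and ?CC' = "tensor R C' C'" and ?CM' = "tensor R C' M" and ?as = "tassoc R C' C' M" and ?D = "\<lambda>v. tmap R (tensor R C C) M \<Delta> id (\<delta> v)"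
  note C = comoduleD(1)[OF M] and Mm = comoduleD(2)[OF M] and \<delta> = comoduleD(3)[OF M]
  note Cm = coalgebraD(1)[OF C] and \<Delta> = coalgebraD(2)[OF C] and \<epsilon> = coalgebraD(3)[OF C]
  note C'm = coalgebraD(1)[OF C'] and \<Delta>' = coalgebraD(2)[OF C'] and \<epsilon>' = coalgebraD(3)[OF C']
  note CC = tensor_module[OF Cm Cm] and CC' = tensor_module[OF C'm C'm]
    and CM = tensor_module[OF Cm Mm] and CM' = tensor_module[OF C'm Mm]
  note idl = lin_id(2)
  note qi = tmap_lin[OF q idl Cm Mm C'm Mm] and qq = tmap_lin[OF q q Cm Cm C'm C'm]
  let ?\<delta> = "\<lambda>v. ?q (\<delta> v)"
  note \<delta>' = lin_comp[OF \<delta> qi] and D = lin_comp[OF \<Delta> qq]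
  have "?as (tmap R (?CC') M \<Delta>' id (?\<delta> v)) = tmap R C' (?CM') id ?\<delta> (?\<delta> v) \<and>
      tlift R M (\<lambda>c w. \<epsilon>' c \<odot> w) (?\<delta> v) = v" if v: "v \<in> carrier M" for v
  proof
    note \<delta>v = lin_closed[OF \<delta> v]
    have "tmap R (?CC') M \<Delta>' id (?\<delta> v) = tmap R (?CC') M (\<lambda>c. ?qq (\<Delta> c)) id (\<delta> v)"
      by (rule tmap_tmap[OF q idl \<Delta>' idl Cm Mm C'm Mm CC' Mm \<delta>v D idl]) (simp_all add: comult)
    also have "\<dots> = tmap R (?CC') M (?qq) id (?D v)"
      by (rule tmap_tmap[OF \<Delta> idl qq idl Cm Mm CC Mm CC' Mm \<delta>v D idl, symmetric]) simp_all
    finally have "?as (tmap R (?CC') M \<Delta>' id (?\<delta> v)) =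
        ?as (tmap R (?CC') M (?qq) id (?D v))"
      by (rule arg_cong)
    also have "\<dots> =
        tmap R C' (?CM') q (?q) (tassoc R C C M (?D v))"
      by (rule tassoc_natural[OF q q idl Cm C'm Cm C'm Mm Mm lin_closed[OF tmap_lin[OF \<Delta> idl Cm Mm CC Mm] \<delta>v]])
    also have "\<dots> = tmap R C' (?CM') q (?q) (tmap R C (tensor R C M) id \<delta> (\<delta> v))"
      by (simp add: comoduleD(4)[OF M v])
    also have "\<dots> = tmap R C' (?CM') q ?\<delta> (\<delta> v)"
      by (rule tmap_tmap[OF idl \<delta> q qi Cm Mm Cm CM C'm CM' \<delta>v q \<delta>']) simp_all
    also have "\<dots> = tmap R C' (?CM') id ?\<delta> (?\<delta> v)"
      by (rule tmap_tmap[OF q idl idl \<delta>' Cm Mm C'm Mm C'm CM' \<delta>v q \<delta>', symmetric]) simp_all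
    finally show "?as (tmap R (?CC') M \<Delta>' id (?\<delta> v)) = tmap R C' (?CM') id ?\<delta> (?\<delta> v)" .
    have "tlift R M (\<lambda>c w. \<epsilon>' c \<odot> w) (?\<delta> v) = tlift R M (\<lambda>c w. \<epsilon> c \<odot> w) (\<delta> v)"
      by (rule tlift_tmap[OF q idl Cm Mm C'm Mm Mm counit_bilin[OF Mm \<epsilon>'] \<delta>v counit_bilin[OF Mm \<epsilon>]])
        (simp add: counit)
    then show "tlift R M (\<lambda>c w. \<epsilon>' c \<odot> w) (?\<delta> v) = v" using comoduleD(5)[OF M v] by simp
  qed
  then show ?thesis unfolding comodule_def by (intro conjI ballI C' Mm \<delta>') simp_all
qed

section \<open>Tensoring a retract, and subcomodules\<close>

context
  fixes R :: "('a, 'z) ring_scheme" and C :: "('a, 'c, 'y) module_scheme" and M :: "('a, 'm, 'x) module_scheme"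
    and H :: "'m set" and p :: "'m \<Rightarrow> 'm"
  assumes C: "module R C" and M: "module R M" and H: "submodule H R M"
    and p: "p \<in> lin_map R M (M\<lparr>carrier := H\<rparr>)" and p_id: "\<And>w. w \<in> H \<Longrightarrow> p w = w"
begin

private abbreviation "W \<equiv> M\<lparr>carrier := H\<rparr>"

lemma retract_tmap:
  assumes "t \<in> carrier (tensor R C W)"
  shows "tmap R C W id p (tmap R C M id id t) = t"
proof -
  note W = submodule_facts(6)[OF H M] and i = submodule_incl(2)[OF H M] and idl = lin_id(2)
  have "tmap R C W id p (tmap R C M id id t) = tmap R C W id id t"
    by (rule tmap_tmap[OF idl i idl p C W C M C W assms idl idl]) (simp_all add: p_id)
  also have "\<dots> = t" by (rule tmap_ident[OF C W assms idl idl]) simp_all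
  finally show ?thesis .
qed

lemma incl_tmap_inj:
  assumes "t \<in> carrier (tensor R C W)" "s \<in> carrier (tensor R C W)"
    and "tmap R C M id id t = tmap R C M id id s"
  shows "t = s"
proof -
  have "t = tmap R C W id p (tmap R C M id id t)" by (rule retract_tmap[OF assms(1), symmetric])
  also have "\<dots> = tmap R C W id p (tmap R C M id id s)" by (simp only: assms(3))
  also have "\<dots> = s" by (rule retract_tmap[OF assms(2)])
  finally show ?thesis .
qed

end

text \<open>Coassociativity is an equation in \<open>C \<otimes> (C \<otimes> W)\<close>. It is
  tested in \<open>C \<otimes> (C \<otimes> M)\<close>, where it becomes the coassociativity of
  \<open>\<rho>\<close>.\<close>

lemma subcomodule:
  assumes M: "comodule R C \<Delta> \<epsilon> M \<rho>" and H: "submodule H R M"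
    and p: "p \<in> lin_map R M (M\<lparr>carrier := H\<rparr>)" and p_id: "\<And>w. w \<in> H \<Longrightarrow> p w = w"
    and \<delta>: "\<delta> \<in> lin_map R (M\<lparr>carrier := H\<rparr>) (tensor R C (M\<lparr>carrier := H\<rparr>))"
    and restr: "\<And>w. w \<in> H \<Longrightarrow> tmap R C M id id (\<delta> w) = \<rho> w"
  shows "comodule R C \<Delta> \<epsilon> (M\<lparr>carrier := H\<rparr>) \<delta>"
proof -
  let ?W = "M\<lparr>carrier := H\<rparr>"
  let ?CW = "tensor R C ?W" and ?CM = "tensor R C M" and ?CC = "tensor R C C" and ?j = "tmap R C M id id"
  note C = comoduleD(1)[OF M] and Mm = comoduleD(2)[OF M] and \<rho> = comoduleD(3)[OF M]
  note Cm = coalgebraD(1)[OF C] and \<Delta> = coalgebraD(2)[OF C] and \<epsilon> = coalgebraD(3)[OF C]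
  note W = submodule_facts(6)[OF H Mm] and i = submodule_incl[OF H Mm]
  note CC = tensor_module[OF Cm Cm] and CM = tensor_module[OF Cm Mm] and CW = tensor_module[OF Cm W]
  note idl = lin_id(2)
  note j = tmap_lin[OF idl i(2) Cm W Cm Mm] and q = tmap_lin[OF idl p Cm Mm Cm W]
  note ii = tmap_lin[OF idl idl Cm Cm Cm Cm]
  have \<rho>W: "\<rho> \<in> lin_map R ?W (?CM)"
    using lin_comp[OF i(1) \<rho>] by simp
  have "tassoc R C C ?W (tmap R (?CC) ?W \<Delta> id (\<delta> w)) = tmap R C (?CW) id \<delta> (\<delta> w) \<and>
      tlift R ?W (\<lambda>c w. \<epsilon> c \<odot>\<^bsub>?W\<^esub> w) (\<delta> w) = w" if "w \<in> carrier ?W" for w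
  proof
    have w: "w \<in> H" "w \<in> carrier M" using that submodule_facts(1)[OF H Mm] by auto
    note \<delta>w = lin_closed[OF \<delta> that]
    note t = lin_closed[OF tmap_lin[OF \<Delta> idl Cm W CC W] \<delta>w]
    \<comment> \<open>\<open>?J\<close> embeds one double tensor product into the other; its left
      inverse \<open>?K\<close> comes from tensoring the projection \<open>p\<close> twice with
      \<open>C\<close>.\<close>
    let ?J = "tmap R C (?CM) id (?j)"
    let ?K = "tmap R C (?CW) id (tmap R C ?W id p)"
    let ?X = "tassoc R C C ?W (tmap R (?CC) ?W \<Delta> id (\<delta> w))"
    let ?Y = "tmap R C (?CW) id \<delta> (\<delta> w)"
    have X: "?X \<in> carrier (tensor R C (?CW))" by (rule lin_closed[OF tassoc_lin[OF Cm Cm W] t])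
    have Y: "?Y \<in> carrier (tensor R C (?CW))"
      by (rule lin_closed[OF tmap_lin[OF idl \<delta> Cm W Cm CW] \<delta>w])
    have KJ: "?K (?J z) = z" if z: "z \<in> carrier (tensor R C (?CW))" for z
    proof -
      have "?K (?J z) = tmap R C (?CW) id id z"
        by (rule tmap_tmap[OF idl j idl q Cm CW Cm CM Cm CW z idl idl])
          (simp_all add: retract_tmap[OF Cm Mm H p p_id])
      also have "\<dots> = z" by (rule tmap_ident[OF Cm CW z idl idl]) simp_all
      finally show ?thesis .
    qed
    have "tmap R (?CC) M (tmap R C C id id) id (tmap R (?CC) ?W \<Delta> id (\<delta> w)) =
        tmap R (?CC) M \<Delta> id (\<delta> w)"
      by (rule tmap_tmap[OF \<Delta> idl ii i(2) Cm W CC W CC Mm \<delta>w \<Delta> i(2)])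
        (simp_all add: tmap_ident[OF Cm Cm lin_closed[OF \<Delta>] idl idl])
    also have "\<dots> = tmap R (?CC) M \<Delta> id (?j (\<delta> w))"
      by (rule tmap_tmap[OF idl i(2) \<Delta> idl Cm W Cm Mm CC Mm \<delta>w \<Delta> i(2), symmetric]) simp_all
    finally have 1: "tassoc R C C M (tmap R (?CC) M (tmap R C C id id) id (tmap R (?CC) ?W \<Delta> id (\<delta> w))) =
        tassoc R C C M (tmap R (?CC) M \<Delta> id (?j (\<delta> w)))"
      by (rule arg_cong)
    have "?J ?X = tassoc R C C M (tmap R (?CC) M (tmap R C C id id) id (tmap R (?CC) ?W \<Delta> id (\<delta> w)))"
      by (rule tassoc_natural[OF idl idl i(2) Cm Cm Cm Cm W Mm t, symmetric])
    also note 1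
    also have "tassoc R C C M (tmap R (?CC) M \<Delta> id (?j (\<delta> w))) =
        tmap R C (?CM) id \<rho> (?j (\<delta> w))"
      by (simp only: restr[OF w(1)] comoduleD(4)[OF M w(2)])
    also have "\<dots> = tmap R C (?CM) id \<rho> (\<delta> w)"
      by (rule tmap_tmap[OF idl i(2) idl \<rho> Cm W Cm Mm Cm CM \<delta>w idl \<rho>W]) simp_all
    also have "\<dots> = ?J ?Y"
      by (rule tmap_tmap[OF idl \<delta> idl j Cm W Cm CW Cm CM \<delta>w idl \<rho>W, symmetric]) (simp_all add: restr)
    finally have "?J ?X = ?J ?Y" .
    then show "?X = ?Y" by (metis KJ[OF X] KJ[OF Y])
    have "tlift R ?W (\<lambda>c w. \<epsilon> c \<odot>\<^bsub>?W\<^esub> w) (\<delta> w) = tlift R M (\<lambda>c w. \<epsilon> c \<odot>\<^bsub>M\<^esub> w) (?j (\<delta> w))"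
      by (rule tensor_ext[OF Cm W lin_comp[OF tlift_lin[OF Cm W W counit_bilin[OF W \<epsilon>]] i(1)]
            lin_comp[OF j tlift_lin[OF Cm Mm Mm counit_bilin[OF Mm \<epsilon>]]] Mm _ \<delta>w])
        (use submodule_facts(1)[OF H Mm] in \<open>auto simp: tlift_tens[OF Cm W W counit_bilin[OF W \<epsilon>], simplified]
          tmap_tens[OF idl i(2) Cm W Cm Mm] tlift_tens[OF Cm Mm Mm counit_bilin[OF Mm \<epsilon>]]\<close>)
    then show "tlift R ?W (\<lambda>c w. \<epsilon> c \<odot>\<^bsub>?W\<^esub> w) (\<delta> w) = w"
      by (simp only: restr[OF w(1)] comoduleD(5)[OF M w(2)])
  qed
  then show ?thesis unfolding comodule_def by (intro conjI ballI C W \<delta>) simp_all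
qed

text \<open>Turns the counit axioms into equations between algebra homomorphisms, so that generators
  suffice. The two versions serve the left and the right counit axiom.\<close>

lemma tlift_counit_alg_hom:
  fixes B (structure)
  assumes C: "algebra R C" and B: "algebra R B" and \<epsilon>: "\<epsilon> \<in> alg_hom R C (regular_mod R)"
  shows "tlift R B (\<lambda>c w. \<epsilon> c \<odot> w) \<in> alg_hom R (tensor R C B) B"
    and "tlift R B (\<lambda>w c. \<epsilon> c \<odot> w) \<in> alg_hom R (tensor R B C) B"
proof -
  interpret Bc: cring B by (rule algebra_cring[OF B])
  interpret Cc: cring C by (rule algebra_cring[OF C])
  interpret B: algebra R B by fact
  note m = C[THEN algebra_module] B[THEN algebra_module]
  note l = tlift_tens[OF m m(2) counit_bilin[OF m(2) alg_hom_lin[OF \<epsilon>]]]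
  note r = tlift_tens[OF m(2,1,2) counit_bilin_right[OF m(2) alg_hom_lin[OF \<epsilon>]]]
  have \<epsilon>c: "\<epsilon> c \<in> carrier R" if "c \<in> carrier C" for c using alg_hom_closed[OF \<epsilon> that] by simp
  have mult: "\<epsilon> c \<odot> w \<otimes> (\<epsilon> c' \<odot> w') = \<epsilon> (c \<otimes>\<^bsub>C\<^esub> c') \<odot> (w \<otimes> w')"
    if "c \<in> carrier C" "c' \<in> carrier C" "w \<in> carrier B" "w' \<in> carrier B" for c c' w w'
    using that \<epsilon>c by (simp only: alg_hom_mult[OF \<epsilon>] B.smult_assoc2 B.smult_assoc1 B.smult_closed Bc.m_closed regular_mod_simps
        lin_smult[OF bilin_right[OF mult_bilin[OF B]], of w "\<epsilon> c'" w'])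
  have one: "\<epsilon> \<one>\<^bsub>C\<^esub> = \<one>\<^bsub>R\<^esub>" using alg_hom_one[OF \<epsilon>] by simp
  show "tlift R B (\<lambda>c w. \<epsilon> c \<odot> w) \<in> alg_hom R (tensor R C B) B"
  proof (rule alg_homI[OF generates_tens_free[OF m] tensor_algebra[OF C B] B])
    show "tlift R B (\<lambda>c w. \<epsilon> c \<odot> w) \<in> lin_map R (tensor R C B) B"
      by (rule tlift_lin[OF m m(2) counit_bilin[OF m(2) alg_hom_lin[OF \<epsilon>]]])
    show "tlift R B (\<lambda>c w. \<epsilon> c \<odot> w) \<one>\<^bsub>tensor R C B\<^esub> = \<one>"
      by (simp add: tens_one[OF C B] l one)
  qed (auto simp: tens_mult[OF C B] l mult)
  show "tlift R B (\<lambda>w c. \<epsilon> c \<odot> w) \<in> alg_hom R (tensor R B C) B"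
  proof (rule alg_homI[OF generates_tens_free[OF m(2,1)] tensor_algebra[OF B C] B])
    show "tlift R B (\<lambda>w c. \<epsilon> c \<odot> w) \<in> lin_map R (tensor R B C) B"
      by (rule tlift_lin[OF m(2,1,2) counit_bilin_right[OF m(2) alg_hom_lin[OF \<epsilon>]]])
    show "tlift R B (\<lambda>w c. \<epsilon> c \<odot> w) \<one>\<^bsub>tensor R B C\<^esub> = \<one>"
      by (simp add: tens_one[OF B C] r one)
  qed (auto simp: tens_mult[OF B C] r mult)
qed

section \<open>Exponent vectors\<close>

instance gvar :: finite
proof
  have "(UNIV :: gvar set) = {X11, X12, X21, X22, Dinv}" using gvar.exhaust by auto
  then show "finite (UNIV :: gvar set)" by (metis finite.emptyI finite_insert)
qed

instance evar :: finite
proof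
  have "(UNIV :: evar set) = {E1, E2}" using evar.exhaust by auto
  then show "finite (UNIV :: evar set)" by (metis finite.emptyI finite_insert)
qed

lemma exponents_comm_monoid: "comm_monoid exponents"
  by (rule comm_monoidI) (auto simp: exponents_def)

lemma exponents_simps [simp]:
  "carrier exponents = UNIV" "m \<otimes>\<^bsub>exponents\<^esub> n = (\<lambda>v. m v + n v)" "\<one>\<^bsub>exponents\<^esub> = (\<lambda>v. 0)"
  by (simp_all add: exponents_def)

abbreviation unit_exp :: "'v \<Rightarrow> 'v \<Rightarrow> nat" where
  "unit_exp v \<equiv> \<lambda>w. if w = v then 1 else 0"

text \<open>Induction on the total degree. Adding one variable at a time matches multiplication of a
  monomial by that variable.\<close>

lemma exponents_induct [case_names zero add]:
  fixes m :: "'v::finite \<Rightarrow> nat"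
  assumes "P (\<lambda>v. 0)" and step: "\<And>m v. P m \<Longrightarrow> P (\<lambda>w. m w + unit_exp v w)"
  shows "P m"
proof (induction "sum m UNIV" arbitrary: m)
  case 0
  then have "m = (\<lambda>v. 0)" by auto
  then show ?case using assms(1) by simp
next
  case (Suc n)
  then obtain v where v: "m v \<noteq> 0" by (metis nat.distinct(1) sum.neutral)
  define m' where "m' = (\<lambda>w. m w - unit_exp v w)"
  have m: "m = (\<lambda>w. m' w + unit_exp v w)" using v by (auto simp: m'_def fun_eq_iff)
  have "sum m UNIV = sum m' UNIV + 1" unfolding m by (simp add: sum.distrib)
  then have "P m'" using Suc by simp
  then show ?case unfolding m by (rule step)
qed

lemma mpoly_simps [simp]:
  "(f \<oplus>\<^bsub>mpoly R\<^esub> g) x = f x \<oplus>\<^bsub>R\<^esub> g x" "(r \<odot>\<^bsub>mpoly R\<^esub> f) x = r \<otimes>\<^bsub>R\<^esub> f x"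
  "\<zero>\<^bsub>mpoly R\<^esub> x = \<zero>\<^bsub>R\<^esub>"
  by (simp_all add: mpoly_def)

lemma mpoly_coeff_closed: "f \<in> carrier (mpoly R) \<Longrightarrow> f m \<in> carrier R"
  by (simp add: mpoly_def monoid_alg_carrier)

lemma mpoly_supp_finite: "f \<in> carrier (mpoly R) \<Longrightarrow> finite {m. f m \<noteq> \<zero>\<^bsub>R\<^esub>}"
  by (simp add: mpoly_def monoid_alg_carrier)

lemma mpoly_eval_lin: "(\<lambda>f. f m) \<in> lin_map R (mpoly R) (regular_mod R)"
  unfolding mpoly_def by (rule monoid_alg_eval)

section \<open>Forms with prescribed monomials\<close>

text \<open>\<open>Sym R d\<close>, the refined summands and the weight spaces are all of this form
  for suitable \<open>S\<close>; the empty set gives the zero module.\<close>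

definition supp_mod :: "('a, 'z) ring_scheme \<Rightarrow> ('v \<Rightarrow> nat) set \<Rightarrow> (('v \<Rightarrow> nat) \<Rightarrow> 'a) set" where
  "supp_mod R S = {f \<in> carrier (mpoly R). \<forall>m. f m \<noteq> \<zero>\<^bsub>R\<^esub> \<longrightarrow> m \<in> S}"

lemma supp_modD: "f \<in> supp_mod R S \<Longrightarrow> m \<notin> S \<Longrightarrow> f m = \<zero>\<^bsub>R\<^esub>"
  by (auto simp: supp_mod_def)

text \<open>The projection onto this direct summand along the remaining monomials. On exponents of
  degree \<open>d\<close> it is \<open>hom_part\<close>.\<close>

definition proj_supp :: "('a, 'z) ring_scheme \<Rightarrow> ('v \<Rightarrow> nat) set \<Rightarrow> (('v \<Rightarrow> nat) \<Rightarrow> 'a) \<Rightarrow> ('v \<Rightarrow> nat) \<Rightarrow> 'a" where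
  "proj_supp R S f = (\<lambda>m. if m \<in> S then f m else \<zero>\<^bsub>R\<^esub>)"

abbreviation supp_module :: "('a, 'z) ring_scheme \<Rightarrow> ('v \<Rightarrow> nat) set \<Rightarrow> ('a, ('v \<Rightarrow> nat) \<Rightarrow> 'a) module" where
  "supp_module R S \<equiv> (mpoly R)\<lparr>carrier := supp_mod R S\<rparr>"

definition deg_exps :: "nat \<Rightarrow> (evar \<Rightarrow> nat) set" where
  "deg_exps d = {m. m E1 + m E2 = d}"

lemma Sym_eq: "Sym R d = supp_module R (deg_exps d)"
  by (simp add: Sym_def supp_mod_def deg_exps_def)

lemma hom_part_eq: "hom_part R d = proj_supp R (deg_exps d)"
  by (simp add: hom_part_def proj_supp_def fun_eq_iff deg_exps_def)

text \<open>Integer arguments, because the characters of the torus have integer exponents: the set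
  is empty if \<open>a\<close> or \<open>b\<close> is negative and a single point otherwise.\<close>

definition wt_exps :: "int \<Rightarrow> int \<Rightarrow> (evar \<Rightarrow> nat) set" where
  "wt_exps a b = {m. int (m E1) = a \<and> int (m E2) = b}"

lemma wt_exps_inj: "m \<in> wt_exps a b \<Longrightarrow> m' \<in> wt_exps a b \<Longrightarrow> m = m'"
proof
  fix e assume "m \<in> wt_exps a b" "m' \<in> wt_exps a b"
  then show "m e = m' e" by (cases e) (auto simp: wt_exps_def)
qed

definition swap_exp :: "(evar \<Rightarrow> nat) \<Rightarrow> evar \<Rightarrow> nat" where
  "swap_exp m = (\<lambda>e. case e of E1 \<Rightarrow> m E2 | E2 \<Rightarrow> m E1)"

section \<open>The orbits of the Weyl group on exponents\<close>

definition mexp :: "nat \<Rightarrow> nat \<Rightarrow> evar \<Rightarrow> nat" where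
  "mexp a b = (\<lambda>e. case e of E1 \<Rightarrow> a | E2 \<Rightarrow> b)"

lemma mexp_simps [simp]: "mexp a b E1 = a" "mexp a b E2 = b"
  by (simp_all add: mexp_def)

lemma mexp_eq_iff: "m = mexp a b \<longleftrightarrow> m E1 = a \<and> m E2 = b"
  by (auto simp: mexp_def fun_eq_iff split: evar.splits)

lemma swap_mexp: "swap_exp (mexp a b) = mexp b a"
  by (auto simp: swap_exp_def mexp_def fun_eq_iff split: evar.splits)

definition orbit_exps :: "nat \<Rightarrow> nat \<Rightarrow> (evar \<Rightarrow> nat) set" where
  "orbit_exps d i = {mexp (d - i) i, mexp i (d - i)}"

lemma wt_exps_nat: "wt_exps (int a) (int b) = {mexp a b}"
  by (auto simp: wt_exps_def mexp_eq_iff)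

lemma orbit_exps_swap: "m \<in> orbit_exps d i \<Longrightarrow> swap_exp m \<in> orbit_exps d i"
  by (auto simp: orbit_exps_def swap_mexp)

lemma orbit_exps_nonzero: "d \<ge> 1 \<Longrightarrow> i \<le> d \<Longrightarrow> (\<lambda>e. 0) \<notin> orbit_exps d i"
  by (auto simp: orbit_exps_def mexp_eq_iff)

lemma deg_exps_swap: "m \<in> deg_exps d \<Longrightarrow> swap_exp m \<in> deg_exps d"
  by (simp add: deg_exps_def swap_exp_def)

lemma deg_exps_nonzero: "d \<ge> 1 \<Longrightarrow> (\<lambda>e. 0) \<notin> deg_exps d"
  by (simp add: deg_exps_def)

lemma orbit_exps_deg: "i \<le> d \<Longrightarrow> orbit_exps d i \<subseteq> deg_exps d"
  by (auto simp: orbit_exps_def deg_exps_def)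

text \<open>The index of an orbit is the smaller of the two exponents, and this is at most
  \<open>k\<close>. Hence every exponent vector of degree \<open>d\<close> lies in exactly one
  orbit.\<close>

lemma deg_exps_orbits:
  assumes "d = 2 * k + 1 \<or> d = 2 * k"
  shows "deg_exps d = (\<Union>i\<in>{0..k}. orbit_exps d i)"
    and "i \<in> {0..k} \<Longrightarrow> j \<in> {0..k} \<Longrightarrow> i \<noteq> j \<Longrightarrow> orbit_exps d i \<inter> orbit_exps d j = {}"
proof
  show "deg_exps d \<subseteq> (\<Union>i\<in>{0..k}. orbit_exps d i)"
  proof
    fix m assume m: "m \<in> deg_exps d"
    then have "m \<in> orbit_exps d (min (m E1) (m E2))" "min (m E1) (m E2) \<le> k"
      using assms by (auto simp: orbit_exps_def mexp_eq_iff deg_exps_def min_def)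
    then show "m \<in> (\<Union>i\<in>{0..k}. orbit_exps d i)" by auto
  qed
  show "(\<Union>i\<in>{0..k}. orbit_exps d i) \<subseteq> deg_exps d"
    using assms by (intro UN_least orbit_exps_deg) auto
qed (use assms in \<open>auto simp: orbit_exps_def mexp_eq_iff\<close>)

section \<open>Coactions before and after truncation, and the Laurent model of
  \<open>k[T]\<close>\<close>

definition det_rel :: "('a, 'z) ring_scheme \<Rightarrow> (gvar \<Rightarrow> nat) \<Rightarrow> 'a" where
  "det_rel R = pvar R Dinv \<otimes>\<^bsub>mpoly R\<^esub> det_poly R \<ominus>\<^bsub>mpoly R\<^esub> \<one>\<^bsub>mpoly R\<^esub>"

text \<open>Kept on the whole symmetric algebra, where the coaction is an algebra homomorphism;
  cutting down to a degree or an orbit comes afterwards.\<close>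

definition coactSymN :: "('a, 'z) ring_scheme \<Rightarrow> 'a symV \<Rightarrow> ('a kG set \<times> 'a symV \<Rightarrow> 'a) set" where
  "coactSymN R f = tmap R (kN R) (mpoly R) (projN R) id (coactSym R f)"

definition coactSymT :: "('a, 'z) ring_scheme \<Rightarrow> 'a symV \<Rightarrow> ('a kG set \<times> 'a symV \<Rightarrow> 'a) set" where
  "coactSymT R f = tmap R (kT R) (mpoly R) (projT R) id (coactSym R f)"

text \<open>All exponents of degree \<open>d\<close> give the coaction on \<open>Sym R d\<close>; a
  single orbit gives the coaction on a refined summand.\<close>

definition coactW :: "('a, 'z) ring_scheme \<Rightarrow> (evar \<Rightarrow> nat) set \<Rightarrow> 'a symV \<Rightarrow>
    ('a kG set \<times> 'a symV \<Rightarrow> 'a) set" where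
  "coactW R X f = tmap R (kN R) (supp_module R X) id (proj_supp R X) (coactSymN R f)"

text \<open>The monoid algebra of \<open>int2\<close> is the Laurent polynomial ring, of which \<open>k[T]\<close> is a copy.\<close>

definition int2 :: "(int \<times> int) monoid" where
  "int2 = \<lparr>carrier = UNIV, mult = (+), one = 0\<rparr>"

lemma int2_comm_monoid: "comm_monoid int2"
  by (rule comm_monoidI) (auto simp: int2_def)

lemma int2_simps [simp]: "carrier int2 = UNIV" "mult int2 = (+)" "\<one>\<^bsub>int2\<^esub> = 0"
  by (simp_all add: int2_def)

text \<open>The coordinate functions restricted to the diagonal torus. The determinant becomes the
  product of the two variables, so \<open>Dinv\<close> has exponent
  \<open>(- 1, - 1)\<close>.\<close>

definition lvar :: "('a, 'z) ring_scheme \<Rightarrow> gvar \<Rightarrow> int \<times> int \<Rightarrow> 'a" where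
  "lvar R v = (case v of X11 \<Rightarrow> basis_elt R (1, 0) | X12 \<Rightarrow> \<zero>\<^bsub>monoid_alg R int2\<^esub> | X21 \<Rightarrow> \<zero>\<^bsub>monoid_alg R int2\<^esub>
    | X22 \<Rightarrow> basis_elt R (0, 1) | Dinv \<Rightarrow> basis_elt R (- 1, - 1))"

context
  fixes R :: "('a, 'z) ring_scheme" (structure) assumes R: "cring R"
begin

interpretation Rc: cring R by (rule R)

section \<open>Polynomial rings\<close>

lemma mpoly_algebra: "algebra R (mpoly R)"
  unfolding mpoly_def by (rule monoid_alg_algebra[OF R exponents_comm_monoid])

lemma mpoly_module: "module R (mpoly R)"
  by (rule algebra_module[OF mpoly_algebra])

lemma monom_closed: "basis_elt R m \<in> carrier (mpoly R)"
  unfolding mpoly_def by (rule basis_elt_closed[OF R]) simp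

lemma pvar_closed: "pvar R v \<in> carrier (mpoly R)"
  unfolding pvar_def by (rule monom_closed)

lemma generates_monom: "generates R (mpoly R) (range (basis_elt R))"
  using generates_basis[OF R, of exponents] by (simp add: mpoly_def)

lemma monom_mult: "basis_elt R m \<otimes>\<^bsub>mpoly R\<^esub> basis_elt R n = basis_elt R (\<lambda>v. m v + n v)"
  using basis_elt_mult[OF R exponents_comm_monoid, of m n] by (simp add: mpoly_def)

lemma monom_one: "\<one>\<^bsub>mpoly R\<^esub> = basis_elt R (\<lambda>v. 0)"
  using monoid_alg_one[OF R exponents_comm_monoid] by (simp add: mpoly_def)

lemma peval_alg_hom:
  fixes \<phi> :: "'v::finite \<Rightarrow> 'b"
  assumes B: "algebra R B" and \<phi>: "\<And>v. \<phi> v \<in> carrier B"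
  shows "peval R B \<phi> \<in> alg_hom R (mpoly R) B"
proof -
  interpret Bc: cring B by (rule algebra_cring) fact
  interpret B: algebra R B by fact
  have "peval R B \<phi> = lext R B (\<lambda>m. \<Otimes>\<^bsub>B\<^esub>v\<in>UNIV. \<phi> v [^]\<^bsub>B\<^esub> m v)"
    by (simp add: peval_def lext_def fun_eq_iff)
  also have "\<dots> \<in> alg_hom R (mpoly R) B" unfolding mpoly_def
    by (rule lext_alg_hom[OF R exponents_comm_monoid B])
      (use \<phi> in \<open>auto simp: Bc.nat_pow_mult[symmetric] intro!: Bc.finprod_closed Bc.finprod_multf Bc.finprod_one_eqI\<close>)
  finally show ?thesis .
qed

lemma peval_pvar:
  fixes \<phi> :: "'v::finite \<Rightarrow> 'b"
  assumes B: "algebra R B" and \<phi>: "\<And>v. \<phi> v \<in> carrier B"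
  shows "peval R B \<phi> (pvar R v) = \<phi> v"
proof -
  interpret Bc: cring B by (rule algebra_cring) fact
  interpret B: algebra R B by fact
  have eq: "(\<Otimes>\<^bsub>B\<^esub>w\<in>UNIV. \<phi> w [^]\<^bsub>B\<^esub> unit_exp v w) = \<phi> v"
  proof -
    have "(\<Otimes>\<^bsub>B\<^esub>w\<in>UNIV. \<phi> w [^]\<^bsub>B\<^esub> unit_exp v w) = (\<Otimes>\<^bsub>B\<^esub>w\<in>UNIV. if v = w then \<phi> w else \<one>\<^bsub>B\<^esub>)"
      by (rule Bc.finprod_cong') (use \<phi> in auto)
    also have "\<dots> = \<phi> v" by (rule Bc.finprod_singleton) (use \<phi> in auto)
    finally show ?thesis .
  qed
  have "peval R B \<phi> (pvar R v) = lext R B (\<lambda>m. \<Otimes>\<^bsub>B\<^esub>v\<in>UNIV. \<phi> v [^]\<^bsub>B\<^esub> m v) (basis_elt R (unit_exp v))"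
    by (simp add: peval_def lext_def pvar_def)
  also have "\<dots> = \<phi> v"
    using lext_basis[OF B.module, of "\<lambda>m. \<Otimes>\<^bsub>B\<^esub>v\<in>UNIV. \<phi> v [^]\<^bsub>B\<^esub> m v" "unit_exp v"] \<phi> unfolding eq by simp
  finally show ?thesis .
qed

lemma mpoly_hom_eq:
  fixes f g :: "(('v::finite \<Rightarrow> nat) \<Rightarrow> 'a) \<Rightarrow> 'b"
  assumes B: "algebra R B" and f: "f \<in> alg_hom R (mpoly R) B" and g: "g \<in> alg_hom R (mpoly R) B"
    and eq: "\<And>v. f (pvar R v) = g (pvar R v)" and x: "x \<in> carrier (mpoly R)"
  shows "f x = g x"
proof (rule generates_eq[OF generates_monom alg_hom_lin[OF f] alg_hom_lin[OF g] mpoly_module algebra_module[OF B] _ x])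
  have "f (basis_elt R m) = g (basis_elt R m)" for m :: "'v \<Rightarrow> nat"
  proof (induction m rule: exponents_induct)
    case zero
    show ?case using alg_hom_one[OF f] alg_hom_one[OF g] by (simp add: monom_one)
  next
    case (add m v)
    have "basis_elt R (\<lambda>w. m w + unit_exp v w) = basis_elt R m \<otimes>\<^bsub>mpoly R\<^esub> pvar R v"
      by (simp only: pvar_def monom_mult)
    then show ?case
      by (simp only: alg_hom_mult[OF f monom_closed pvar_closed]
          alg_hom_mult[OF g monom_closed pvar_closed] add eq)
  qed
  then show "\<And>s. s \<in> range (basis_elt R) \<Longrightarrow> f s = g s" by auto
qed

section \<open>The coordinate ring of \<open>GL\<^sub>2\<close>\<close>

interpretation Pc: cring "mpoly R" by (rule algebra_cring[OF mpoly_algebra])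

lemma det_rel_closed: "det_rel R \<in> carrier (mpoly R)"
  by (simp add: det_rel_def det_poly_def Let_def pvar_closed)

lemma det_ideal_ideal: "ideal (det_ideal R) (mpoly R)"
  unfolding det_ideal_def Let_def using Pc.genideal_ideal[of "{det_rel R}"] det_rel_closed
  by (simp add: det_rel_def)

lemma kG_algebra: "algebra R (kG R)"
  unfolding kG_def by (rule quot_mod_algebra[OF mpoly_algebra det_ideal_ideal])

lemma kG_module: "module R (kG R)"
  by (rule algebra_module[OF kG_algebra])

lemma toG_alg_hom: "(\<lambda>f. det_ideal R +>\<^bsub>mpoly R\<^esub> f) \<in> alg_hom R (mpoly R) (kG R)"
  unfolding kG_def by (rule coset_alg_hom[OF mpoly_algebra det_ideal_ideal])

lemma xG_closed: "xG R v \<in> carrier (kG R)"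
  unfolding xG_def by (rule alg_hom_closed[OF toG_alg_hom pvar_closed])

lemma alg_hom_det_rel:
  assumes B: "algebra R B" and f: "f \<in> alg_hom R (mpoly R) B"
  shows "f (det_rel R) = f (pvar R Dinv) \<otimes>\<^bsub>B\<^esub> (f (pvar R X11) \<otimes>\<^bsub>B\<^esub> f (pvar R X22) \<ominus>\<^bsub>B\<^esub>
    f (pvar R X12) \<otimes>\<^bsub>B\<^esub> f (pvar R X21)) \<ominus>\<^bsub>B\<^esub> \<one>\<^bsub>B\<^esub>"
  by (simp add: det_rel_def det_poly_def Let_def alg_hom_minus[OF f mpoly_algebra B]
      alg_hom_mult[OF f] alg_hom_one[OF f] pvar_closed)

lemma xG_det:
  "xG R Dinv \<otimes>\<^bsub>kG R\<^esub> (xG R X11 \<otimes>\<^bsub>kG R\<^esub> xG R X22 \<ominus>\<^bsub>kG R\<^esub> xG R X12 \<otimes>\<^bsub>kG R\<^esub> xG R X21) = \<one>\<^bsub>kG R\<^esub>"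
proof -
  interpret Gc: cring "kG R" by (rule algebra_cring[OF kG_algebra])
  have "det_rel R \<in> det_ideal R"
    unfolding det_ideal_def Let_def using Pc.genideal_self'[OF det_rel_closed] by (simp add: det_rel_def)
  then have "det_ideal R +>\<^bsub>mpoly R\<^esub> det_rel R = \<zero>\<^bsub>kG R\<^esub>"
    unfolding kG_def by (rule coset_eq_zero[OF mpoly_module ideal_submodule[OF mpoly_algebra det_ideal_ideal]])
  then show ?thesis
    unfolding alg_hom_det_rel[OF kG_algebra toG_alg_hom] xG_def[symmetric]
    by (simp add: minus_eq_zero_iff[OF module_abelian[OF kG_module]] xG_closed)
qed

lemma kG_hom_eq:
  assumes B: "algebra R B" and f: "f \<in> alg_hom R (kG R) B" and g: "g \<in> alg_hom R (kG R) B"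
    and eq: "\<And>v. f (xG R v) = g (xG R v)" and x: "x \<in> carrier (kG R)"
  shows "f x = g x"
proof -
  obtain y where y: "y \<in> carrier (mpoly R)" "x = det_ideal R +>\<^bsub>mpoly R\<^esub> y"
    using x by (auto simp: kG_def quot_mod_simps)
  show ?thesis unfolding y(2)
    by (rule mpoly_hom_eq[OF B alg_hom_comp[OF toG_alg_hom f] alg_hom_comp[OF toG_alg_hom g] _ y(1)])
      (use eq in \<open>simp add: xG_def\<close>)
qed

text \<open>The universal property of the localization. Its form with \<open>the_elem\<close> makes
  \<open>comultG\<close> and \<open>counitG\<close> literal instances.\<close>

lemma kG_lift:
  assumes B: "algebra R B" and \<phi>: "\<And>v. \<phi> v \<in> carrier B"
    and det: "\<phi> Dinv \<otimes>\<^bsub>B\<^esub> (\<phi> X11 \<otimes>\<^bsub>B\<^esub> \<phi> X22 \<ominus>\<^bsub>B\<^esub> \<phi> X12 \<otimes>\<^bsub>B\<^esub> \<phi> X21) = \<one>\<^bsub>B\<^esub>"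
  shows "(\<lambda>X. the_elem (peval R B \<phi> ` X)) \<in> alg_hom R (kG R) B"
    and "the_elem (peval R B \<phi> ` xG R v) = \<phi> v"
proof -
  interpret Bc: cring B by (rule algebra_cring[OF B])
  let ?f = "peval R B \<phi>"
  have f: "?f \<in> alg_hom R (mpoly R) B" by (rule peval_alg_hom[OF B \<phi>])
  have "?f (det_rel R) = \<zero>\<^bsub>B\<^esub>"
    unfolding alg_hom_det_rel[OF B f] peval_pvar[OF B \<phi>] det
    by (simp add: minus_eq_zero_iff[OF module_abelian[OF algebra_module[OF B]]])
  then have J: "?f j = \<zero>\<^bsub>B\<^esub>" if "j \<in> det_ideal R" for j
    using genideal_kernel[OF f mpoly_algebra B, of "{det_rel R}" j] that det_rel_closed
    by (simp add: det_ideal_def det_rel_def Let_def)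
  have val: "the_elem (?f ` (det_ideal R +>\<^bsub>mpoly R\<^esub> x)) = ?f x" if "x \<in> carrier (mpoly R)" for x
    by (rule the_elem_image_coset_lin[OF alg_hom_lin[OF f] mpoly_module algebra_module[OF B]
          ideal_submodule[OF mpoly_algebra det_ideal_ideal] J that])
  show "(\<lambda>X. the_elem (?f ` X)) \<in> alg_hom R (kG R) B"
    unfolding kG_def by (rule quot_lift_alg_hom[OF f mpoly_algebra B det_ideal_ideal J val])
  show "the_elem (?f ` xG R v) = \<phi> v"
    unfolding xG_def val[OF pvar_closed] by (rule peval_pvar[OF B \<phi>])
qed

private abbreviation "G \<equiv> kG R"

private abbreviation "GG \<equiv> tensor R G G"

private abbreviation "SV \<equiv> mpoly R :: ('a, 'a symV) module"

private lemma GG: "algebra R G" "module R G" "algebra R GG" "module R GG"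
  using kG_algebra by (simp_all add: algebra_module tensor_algebra)

interpretation Gc: cring G by (rule algebra_cring[OF GG(1)])

interpretation GGc: cring GG by (rule algebra_cring[OF GG(3)])

private lemma xc [simp]: "xG R v \<in> carrier G" by (rule xG_closed)

private lemma tc [simp]: "x \<in> carrier G \<Longrightarrow> y \<in> carrier G \<Longrightarrow> tens R G G x y \<in> carrier GG"
  by (rule tens_closed[OF GG(2,2)])

lemma comultG_gen_closed: "comultG_gen R v \<in> carrier GG"
  by (cases v) (simp_all add: comultG_gen_def Let_def)

text \<open>The generators are sent to the entries of the product of two generic matrices, one from
  each tensor factor. As the determinant is multiplicative, the claim splits into one copy of
  \<open>xG_det\<close> for each factor.\<close>

lemma comultG_gen_det:
  "comultG_gen R Dinv \<otimes>\<^bsub>GG\<^esub> (comultG_gen R X11 \<otimes>\<^bsub>GG\<^esub> comultG_gen R X22 \<ominus>\<^bsub>GG\<^esub>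
    comultG_gen R X12 \<otimes>\<^bsub>GG\<^esub> comultG_gen R X21) = \<one>\<^bsub>GG\<^esub>"
proof -
  define l r where "l = (\<lambda>v. tens R G G (xG R v) \<one>\<^bsub>G\<^esub>)" and "r = (\<lambda>v. tens R G G \<one>\<^bsub>G\<^esub> (xG R v))"
  have lr: "tens R G G (xG R v) (xG R w) = l v \<otimes>\<^bsub>GG\<^esub> r w" for v w
    by (simp add: l_def r_def tens_mult[OF GG(1,1)])
  have c [simp]: "l v \<in> carrier GG" "r v \<in> carrier GG" for v by (simp_all add: l_def r_def)
  note Lh = tens_left_alg_hom[OF GG(1,1)] and Rh = tens_right_alg_hom[OF GG(1,1)]
  have L: "l Dinv \<otimes>\<^bsub>GG\<^esub> (l X11 \<otimes>\<^bsub>GG\<^esub> l X22 \<ominus>\<^bsub>GG\<^esub> l X12 \<otimes>\<^bsub>GG\<^esub> l X21) = \<one>\<^bsub>GG\<^esub>"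
    using arg_cong[OF xG_det, of "\<lambda>x. tens R G G x \<one>\<^bsub>G\<^esub>"]
    by (simp add: l_def alg_hom_mult[OF Lh] alg_hom_minus[OF Lh GG(1,3)] alg_hom_one[OF Lh])
  have R: "r Dinv \<otimes>\<^bsub>GG\<^esub> (r X11 \<otimes>\<^bsub>GG\<^esub> r X22 \<ominus>\<^bsub>GG\<^esub> r X12 \<otimes>\<^bsub>GG\<^esub> r X21) = \<one>\<^bsub>GG\<^esub>"
    using arg_cong[OF xG_det, of "\<lambda>x. tens R G G \<one>\<^bsub>G\<^esub> x"]
    by (simp add: r_def alg_hom_mult[OF Rh] alg_hom_minus[OF Rh GG(1,3)] alg_hom_one[OF Rh])
  let ?L = "l X11 \<otimes>\<^bsub>GG\<^esub> l X22 \<ominus>\<^bsub>GG\<^esub> l X12 \<otimes>\<^bsub>GG\<^esub> l X21" and ?R = "r X11 \<otimes>\<^bsub>GG\<^esub> r X22 \<ominus>\<^bsub>GG\<^esub> r X12 \<otimes>\<^bsub>GG\<^esub> r X21"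
  have "comultG_gen R Dinv \<otimes>\<^bsub>GG\<^esub> (comultG_gen R X11 \<otimes>\<^bsub>GG\<^esub> comultG_gen R X22 \<ominus>\<^bsub>GG\<^esub>
      comultG_gen R X12 \<otimes>\<^bsub>GG\<^esub> comultG_gen R X21) = (l Dinv \<otimes>\<^bsub>GG\<^esub> r Dinv) \<otimes>\<^bsub>GG\<^esub> (?L \<otimes>\<^bsub>GG\<^esub> ?R)"
    using GGc.det_product[of "l X11" "l X12" "l X21" "l X22" "r X11" "r X12" "r X21" "r X22"]
    by (simp add: comultG_gen_def Let_def lr)
  also have "\<dots> = (l Dinv \<otimes>\<^bsub>GG\<^esub> ?L) \<otimes>\<^bsub>GG\<^esub> (r Dinv \<otimes>\<^bsub>GG\<^esub> ?R)"
    by (simp add: GGc.m_ac)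
  finally show ?thesis by (simp add: L R)
qed

lemma comultG_alg_hom: "comultG R \<in> alg_hom R G GG"
  and comultG_xG: "comultG R (xG R v) = comultG_gen R v"
  using kG_lift[OF GG(3) comultG_gen_closed comultG_gen_det]
  by (simp_all add: comultG_def[abs_def])

private abbreviation "ceps \<equiv> \<lambda>v. if v \<in> {X12, X21} then \<zero> else \<one>"

lemma counitG_alg_hom: "counitG R \<in> alg_hom R G (regular_mod R)"
  and counitG_xG: "counitG R (xG R v) = ceps v"
proof -
  have 1: "ceps v \<in> carrier (regular_mod R)" for v by simp
  have 2: "ceps Dinv \<otimes>\<^bsub>regular_mod R\<^esub> (ceps X11 \<otimes>\<^bsub>regular_mod R\<^esub> ceps X22 \<ominus>\<^bsub>regular_mod R\<^esub>
      ceps X12 \<otimes>\<^bsub>regular_mod R\<^esub> ceps X21) = \<one>\<^bsub>regular_mod R\<^esub>"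
  proof -
    interpret Q: module R "regular_mod R" by (rule regular_mod_module[OF R])
    have "\<ominus>\<^bsub>regular_mod R\<^esub> \<zero> = \<zero>" using Q.add.inv_one by (simp add: a_inv_def)
    then show ?thesis by (simp add: a_minus_def)
  qed
  show "counitG R \<in> alg_hom R G (regular_mod R)" "counitG R (xG R v) = ceps v"
    using kG_lift[OF regular_mod_algebra[OF R] 1 2]
    by (simp_all add: counitG_def[abs_def])
qed

private lemma lins:
  "comultG R \<in> lin_map R G GG" "counitG R \<in> lin_map R G (regular_mod R)"
  using comultG_alg_hom counitG_alg_hom by (simp_all add: alg_hom_lin)

lemma coalgebra_kG: "coalgebra R G (comultG R) (counitG R)"
  unfolding coalgebra_def
proof (intro conjI ballI GG(2) lins)
  note D = comultG_alg_hom and E = counitG_alg_hom and idh = alg_hom_id(2) and idl = lin_id(2)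
  note GT = tensor_algebra[OF GG(1,3)]
  note tb1 = tens_bilin[OF GG(4,2)] and tb2 = tens_bilin[OF GG(2,4)]
  note D1 = tmap_alg_hom[OF D idh GG(1,1,3,1)] and D2 = tmap_alg_hom[OF idh D GG(1,1,1,3)]
    and As = tassoc_alg_hom[OF GG(1,1,1)]
  interpret GTc: cring "tensor R G GG" by (rule algebra_cring[OF GT])
  interpret TGc: cring "tensor R GG G" by (rule algebra_cring[OF tensor_algebra[OF GG(3,1)]])
  fix c assume c: "c \<in> carrier G"
  show "tassoc R G G G (tmap R GG G (comultG R) id (comultG R c)) = tmap R G GG id (comultG R) (comultG R c)"
  proof (rule kG_hom_eq[OF GT alg_hom_comp[OF alg_hom_comp[OF D D1] As] alg_hom_comp[OF D D2] _ c])
    fix v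
    show "tassoc R G G G (tmap R GG G (comultG R) id (comultG R (xG R v))) =
        tmap R G GG id (comultG R) (comultG R (xG R v))"
      by (cases v)
        (simp_all add: comultG_xG comultG_gen_def Let_def alg_hom_add[OF D1] alg_hom_add[OF D2] alg_hom_add[OF As]
          tmap_tens[OF lins(1) idl GG(2,2,4,2)] tmap_tens[OF idl lins(1) GG(2,2,2,4)] lin_add[OF bilin_left[OF tb1]]
          lin_add[OF bilin_right[OF tb2]] tens_closed[OF GG(4,2)] tens_closed[OF GG(2,4)]
          tassoc_tens[OF GG(2,2,2)] GTc.a_ac)
  qed
  note El = tlift_counit_alg_hom(1)[OF GG(1,1) E] and Er = tlift_counit_alg_hom(2)[OF GG(1,1) E]
  note tl = tlift_tens[OF GG(2,2,2) counit_bilin[OF GG(2) lins(2)]]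
    and tr = tlift_tens[OF GG(2,2,2) counit_bilin_right[OF GG(2) lins(2)]]
  interpret G: algebra R G by (rule GG(1))
  show "tlift R G (\<lambda>x y. counitG R x \<odot>\<^bsub>G\<^esub> y) (comultG R c) = c"
  proof (rule kG_hom_eq[OF GG(1) alg_hom_comp[OF D El] alg_hom_id(1) _ c])
    fix v
    show "tlift R G (\<lambda>x y. counitG R x \<odot>\<^bsub>G\<^esub> y) (comultG R (xG R v)) = xG R v"
      by (cases v) (simp_all add: comultG_xG comultG_gen_def Let_def alg_hom_add[OF El] tl counitG_xG)
  qed
  show "tlift R G (\<lambda>x y. counitG R y \<odot>\<^bsub>G\<^esub> x) (comultG R c) = c"
  proof (rule kG_hom_eq[OF GG(1) alg_hom_comp[OF D Er] alg_hom_id(1) _ c])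
    fix v
    show "tlift R G (\<lambda>x y. counitG R y \<odot>\<^bsub>G\<^esub> x) (comultG R (xG R v)) = xG R v"
      by (cases v) (simp_all add: comultG_xG comultG_gen_def Let_def alg_hom_add[OF Er] tr counitG_xG)
  qed
qed

section \<open>The coaction on the symmetric algebra\<close>

private abbreviation "GS \<equiv> tensor R G SV"

private lemma SS: "algebra R SV" "module R SV" "algebra R GS" "module R GS"
  by (intro mpoly_algebra mpoly_module tensor_algebra[OF GG(1)] tensor_module[OF GG(2)])+

interpretation Sc: cring SV by (rule algebra_cring[OF SS(1)])

interpretation GSc: cring GS by (rule algebra_cring[OF SS(3)])

private lemma tcS [simp]: "x \<in> carrier G \<Longrightarrow> y \<in> carrier SV \<Longrightarrow> tens R G SV x y \<in> carrier GS"
  by (rule tens_closed[OF GG(2) SS(2)])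

private lemma pc [simp]: "pvar R v \<in> carrier SV" by (rule pvar_closed)

lemma std_coaction_closed: "std_coaction R e \<in> carrier GS"
  by (cases e) (simp_all add: std_coaction_def Let_def)

lemma coactSym_alg_hom: "coactSym R \<in> alg_hom R SV GS"
  and coactSym_pvar: "coactSym R (pvar R e) = std_coaction R e"
  unfolding coactSym_def
  by (rule peval_alg_hom[OF SS(3) std_coaction_closed]) (rule peval_pvar[OF SS(3) std_coaction_closed])

lemma comodule_coactSym: "comodule R G (comultG R) (counitG R) SV (coactSym R)"
  unfolding comodule_def
proof (intro conjI ballI coalgebra_kG SS(2))
  note D = comultG_alg_hom and E = counitG_alg_hom and \<rho> = coactSym_alg_hom
    and idh = alg_hom_id(2) and idl = lin_id(2)
  show "coactSym R \<in> lin_map R SV GS" by (rule alg_hom_lin[OF \<rho>])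
  note GT = tensor_algebra[OF GG(1) SS(3)]
  note tb1 = tens_bilin[OF GG(4) SS(2)] and tb2 = tens_bilin[OF GG(2) SS(4)]
  note D1 = tmap_alg_hom[OF D idh GG(1) SS(1) GG(3) SS(1)] and D2 = tmap_alg_hom[OF idh \<rho> GG(1) SS(1) GG(1) SS(3)]
    and As = tassoc_alg_hom[OF GG(1,1) SS(1)]
  interpret GTc: cring "tensor R G GS" by (rule algebra_cring[OF GT])
  interpret TGc: cring "tensor R GG SV" by (rule algebra_cring[OF tensor_algebra[OF GG(3) SS(1)]])
  fix c assume c: "c \<in> carrier SV"
  show "tassoc R G G SV (tmap R GG SV (comultG R) id (coactSym R c)) = tmap R G GS id (coactSym R) (coactSym R c)"
  proof (rule mpoly_hom_eq[OF GT alg_hom_comp[OF alg_hom_comp[OF \<rho> D1] As] alg_hom_comp[OF \<rho> D2] _ c])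
    fix v
    show "tassoc R G G SV (tmap R GG SV (comultG R) id (coactSym R (pvar R v))) =
        tmap R G GS id (coactSym R) (coactSym R (pvar R v))"
      by (cases v)
        (simp_all add: comultG_xG comultG_gen_def coactSym_pvar std_coaction_def Let_def
          alg_hom_add[OF D1] alg_hom_add[OF D2] alg_hom_add[OF As]
          tmap_tens[OF lins(1) idl GG(2) SS(2) GG(4) SS(2)] tmap_tens[OF idl alg_hom_lin[OF \<rho>] GG(2) SS(2) GG(2) SS(4)]
          lin_add[OF bilin_left[OF tb1]]
          lin_add[OF bilin_right[OF tb2]] tens_closed[OF GG(4) SS(2)] tens_closed[OF GG(2) SS(4)]
          tassoc_tens[OF GG(2,2) SS(2)] GTc.a_ac)
  qed
  note El = tlift_counit_alg_hom(1)[OF GG(1) SS(1) E]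
  note tl = tlift_tens[OF GG(2) SS(2,2) counit_bilin[OF SS(2) lins(2)]]
  interpret S: algebra R SV by (rule SS(1))
  show "tlift R SV (\<lambda>x y. counitG R x \<odot>\<^bsub>SV\<^esub> y) (coactSym R c) = c"
  proof (rule mpoly_hom_eq[OF SS(1) alg_hom_comp[OF \<rho> El] alg_hom_id(1) _ c])
    fix v
    show "tlift R SV (\<lambda>x y. counitG R x \<odot>\<^bsub>SV\<^esub> y) (coactSym R (pvar R v)) = pvar R v"
      by (cases v) (simp_all add: coactSym_pvar std_coaction_def Let_def alg_hom_add[OF El] tl counitG_xG)
  qed
qed

section \<open>The torus and its normalizer\<close>

lemma I1_ideal: "ideal (I1 R) G" and I2_ideal: "ideal (I2 R) G"
  unfolding I1_def I2_def by (rule Gc.genideal_ideal; simp)+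

lemma IN_ideal: "ideal (IN R) G"
  unfolding IN_def by (rule Gc.ideal_prod_is_ideal[OF I1_ideal I2_ideal])

lemma kT_algebra: "algebra R (kT R)" and kN_algebra: "algebra R (kN R)"
  unfolding kT_def kN_def by (rule quot_mod_algebra[OF GG(1)], rule I1_ideal IN_ideal)+

lemma kT_module: "module R (kT R)" and kN_module: "module R (kN R)"
  using kT_algebra kN_algebra by (simp_all add: algebra_module)

lemma projT_alg_hom: "projT R \<in> alg_hom R G (kT R)" and projN_alg_hom: "projN R \<in> alg_hom R G (kN R)"
  using coset_alg_hom[OF GG(1) I1_ideal] coset_alg_hom[OF GG(1) IN_ideal]
  by (simp_all add: projT_def[abs_def] projN_def[abs_def] kT_def kN_def)

private lemma sub: "submodule (I1 R) R G" "submodule (IN R) R G"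
  by (rule ideal_submodule[OF GG(1)], rule I1_ideal IN_ideal)+

lemma projT_xG_zero: "v \<in> {X12, X21} \<Longrightarrow> projT R (xG R v) = \<zero>\<^bsub>kT R\<^esub>"
  unfolding projT_def kT_def
  by (rule coset_eq_zero[OF GG(2) sub(1)]) (auto simp: I1_def intro!: Gc.genideal_self[THEN subsetD])

lemma kill_I1:
  assumes "algebra R B" "f \<in> alg_hom R G B" "f (xG R X12) = \<zero>\<^bsub>B\<^esub>" "f (xG R X21) = \<zero>\<^bsub>B\<^esub>" "j \<in> I1 R"
  shows "f j = \<zero>\<^bsub>B\<^esub>"
  by (rule genideal_kernel[OF assms(2) GG(1) assms(1) _ _ assms(5)[unfolded I1_def]]) (use assms in auto)

text \<open>\<open>I1\<close> is generated by the off-diagonal and \<open>I2\<close> by the diagonal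
  coordinates, so by \<open>ideal_prod_kernel\<close> only four products have to vanish.\<close>

lemma kill_IN:
  assumes "algebra R B" "f \<in> alg_hom R G B"
    and "\<And>v w. v \<in> {X12, X21} \<Longrightarrow> w \<in> {X11, X22} \<Longrightarrow> f (xG R v) \<otimes>\<^bsub>B\<^esub> f (xG R w) = \<zero>\<^bsub>B\<^esub>" "j \<in> IN R"
  shows "f j = \<zero>\<^bsub>B\<^esub>"
  by (rule ideal_prod_kernel[OF assms(2) GG(1) assms(1) _ _ _ assms(4)[unfolded IN_def I1_def I2_def]])
    (use assms(3) in auto)

interpretation Tc: cring "kT R" by (rule algebra_cring[OF kT_algebra])

interpretation Nc: cring "kN R" by (rule algebra_cring[OF kN_algebra])

private abbreviation "t \<equiv> \<lambda>v. projT R (xG R v)"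

private abbreviation "n \<equiv> \<lambda>v. projN R (xG R v)"

private lemma tc' [simp]: "t v \<in> carrier (kT R)" and nc [simp]: "n v \<in> carrier (kN R)"
  by (rule alg_hom_closed[OF projT_alg_hom xc] alg_hom_closed[OF projN_alg_hom xc])+

lemma projN_xG_mult_zero:
  assumes "v \<in> {X12, X21}" "w \<in> {X11, X22}"
  shows "n v \<otimes>\<^bsub>kN R\<^esub> n w = \<zero>\<^bsub>kN R\<^esub>" "n w \<otimes>\<^bsub>kN R\<^esub> n v = \<zero>\<^bsub>kN R\<^esub>"
proof -
  have "xG R v \<otimes>\<^bsub>G\<^esub> xG R w \<in> IN R"
    unfolding IN_def I1_def I2_def
    by (rule ideal_prod.prod) (use assms in \<open>auto intro!: Gc.genideal_self[THEN subsetD]\<close>)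
  then have "projN R (xG R v \<otimes>\<^bsub>G\<^esub> xG R w) = \<zero>\<^bsub>kN R\<^esub>"
    unfolding projN_def kN_def by (rule coset_eq_zero[OF GG(2) sub(2)])
  then show "n v \<otimes>\<^bsub>kN R\<^esub> n w = \<zero>\<^bsub>kN R\<^esub>" by (simp add: alg_hom_mult[OF projN_alg_hom])
  then show "n w \<otimes>\<^bsub>kN R\<^esub> n v = \<zero>\<^bsub>kN R\<^esub>" using Nc.m_comm[OF nc nc] by metis
qed

text \<open>The matrix product with entries pushed into \<open>B\<close>, for use with the
  projections to \<open>k[T]\<close> and to \<open>k[N]\<close>.\<close>

private lemma tmap_comultG_gen:
  assumes q: "q \<in> alg_hom R G B" and B: "algebra R B"
  shows "tmap R B B q q (comultG R (xG R v)) = (let T = tensor R B B; s = (\<lambda>v w. tens R B B (q (xG R v)) (q (xG R w))) in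
     (case v of
        X11 \<Rightarrow> s X11 X11 \<oplus>\<^bsub>T\<^esub> s X12 X21
      | X12 \<Rightarrow> s X11 X12 \<oplus>\<^bsub>T\<^esub> s X12 X22
      | X21 \<Rightarrow> s X21 X11 \<oplus>\<^bsub>T\<^esub> s X22 X21
      | X22 \<Rightarrow> s X21 X12 \<oplus>\<^bsub>T\<^esub> s X22 X22
      | Dinv \<Rightarrow> s Dinv Dinv))"
  using tmap_tens[OF alg_hom_lin[OF q] alg_hom_lin[OF q] GG(2,2) algebra_module[OF B] algebra_module[OF B]]
    lin_add[OF tmap_lin[OF alg_hom_lin[OF q] alg_hom_lin[OF q] GG(2,2) algebra_module[OF B] algebra_module[OF B]]]
  by (cases v) (simp_all add: comultG_xG comultG_gen_def Let_def tens_closed[OF GG(2,2)])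

text \<open>Each term of an off-diagonal entry of a matrix product has an off-diagonal factor on one
  side, and that factor is zero in \<open>k[T]\<close>.\<close>

lemma comultT_kill:
  assumes "j \<in> I1 R"
  shows "tmap R (kT R) (kT R) (projT R) (projT R) (comultG R j) = \<zero>\<^bsub>tensor R (kT R) (kT R)\<^esub>"
proof -
  note TT = tensor_algebra[OF kT_algebra kT_algebra]
  interpret TTc: cring "tensor R (kT R) (kT R)" by (rule algebra_cring[OF TT])
  show ?thesis
    by (rule kill_I1[OF TT alg_hom_comp[OF comultG_alg_hom
            tmap_alg_hom[OF projT_alg_hom projT_alg_hom GG(1,1) kT_algebra kT_algebra]] _ _ assms])
      (simp_all add: tmap_comultG_gen[OF projT_alg_hom kT_algebra] Let_def projT_xG_zero
        tens_zero[OF kT_module kT_module])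
qed

text \<open>Terms of an off-diagonal entry pair a diagonal with an off-diagonal coordinate; terms of
  a diagonal entry pair two coordinates of the same kind. Multiplying one of each creates a mixed
  product in one tensor factor, which is zero in \<open>k[N]\<close>. Geometrically,
  \<open>N\<close> is closed under multiplication.\<close>

lemma comultN_kill:
  assumes "j \<in> IN R"
  shows "tmap R (kN R) (kN R) (projN R) (projN R) (comultG R j) = \<zero>\<^bsub>tensor R (kN R) (kN R)\<^esub>"
proof -
  note NN = tensor_algebra[OF kN_algebra kN_algebra]
  interpret NNc: cring "tensor R (kN R) (kN R)" by (rule algebra_cring[OF NN])
  show ?thesis
    by (rule kill_IN[OF NN alg_hom_comp[OF comultG_alg_hom
            tmap_alg_hom[OF projN_alg_hom projN_alg_hom GG(1,1) kN_algebra kN_algebra]] _ assms])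
      (auto simp: tmap_comultG_gen[OF projN_alg_hom kN_algebra] Let_def projN_xG_mult_zero
        tens_zero[OF kN_module kN_module] tens_mult[OF kN_algebra kN_algebra]
        tens_closed[OF kN_module kN_module] NNc.l_distr NNc.r_distr)
qed

lemma counit_kill: "j \<in> I1 R \<Longrightarrow> counitG R j = \<zero>" "j \<in> IN R \<Longrightarrow> counitG R j = \<zero>"
  using kill_I1[OF regular_mod_algebra[OF R] counitG_alg_hom, of j]
    kill_IN[OF regular_mod_algebra[OF R] counitG_alg_hom, of j]
  by (auto simp: counitG_xG)

lemma coalgebra_kT: "coalgebra R (kT R) (comultT R) (counitT R)"
  and comultT_projT: "\<And>c. c \<in> carrier G \<Longrightarrow>
    comultT R (projT R c) = tmap R (kT R) (kT R) (projT R) (projT R) (comultG R c)"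
  and counitT_projT: "\<And>c. c \<in> carrier G \<Longrightarrow> counitT R (projT R c) = counitG R c"
  using quot_coalgebra[OF coalgebra_kG sub(1) _ counit_kill(1)] comultT_kill
  by (simp_all add: kT_def comultT_def counitT_def projT_def[abs_def])

lemma coalgebra_kN: "coalgebra R (kN R) (comultN R) (counitN R)"
  and comultN_projN: "\<And>c. c \<in> carrier G \<Longrightarrow>
    comultN R (projN R c) = tmap R (kN R) (kN R) (projN R) (projN R) (comultG R c)"
  and counitN_projN: "\<And>c. c \<in> carrier G \<Longrightarrow> counitN R (projN R c) = counitG R c"
  using quot_coalgebra[OF coalgebra_kG sub(2) _ counit_kill(2)] comultN_kill
  by (simp_all add: kN_def comultN_def counitN_def projN_def[abs_def])

text \<open>The product ideal lies in \<open>I1\<close>; this is the inclusion of the torus in its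
  normalizer.\<close>

private lemma projT_kill_IN: "j \<in> IN R \<Longrightarrow> projT R j = \<zero>\<^bsub>kT R\<^esub>"
  by (rule kill_IN[OF kT_algebra projT_alg_hom]) (auto simp: projT_xG_zero)

lemma resNT_projN: "c \<in> carrier G \<Longrightarrow> resNT R (projN R c) = projT R c"
  unfolding resNT_def projN_def
  by (rule the_elem_image_coset_lin[OF alg_hom_lin[OF projT_alg_hom] GG(2) kT_module sub(2) projT_kill_IN])

lemma resNT_alg_hom: "resNT R \<in> alg_hom R (kN R) (kT R)"
  unfolding kN_def
  by (rule quot_lift_alg_hom[OF projT_alg_hom GG(1) kT_algebra IN_ideal projT_kill_IN])
    (simp_all add: resNT_projN[unfolded projN_def])

private lemma kN_cases: assumes "X \<in> carrier (kN R)" obtains c where "c \<in> carrier G" "X = projN R c"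
  using assms by (auto simp: kN_def quot_mod_simps projN_def)

text \<open>As \<open>projN\<close> is surjective, the compatibilities follow from those of
  \<open>projN\<close> and \<open>projT\<close> with the structure maps of
  \<open>k[G]\<close>.\<close>

lemma resNT_coalgebra_hom:
  assumes "X \<in> carrier (kN R)"
  shows "comultT R (resNT R X) = tmap R (kT R) (kT R) (resNT R) (resNT R) (comultN R X)"
    and "counitT R (resNT R X) = counitN R X"
proof -
  obtain c where c: "c \<in> carrier G" "X = projN R c" using assms by (rule kN_cases)
  note p = projT_alg_hom[THEN alg_hom_lin] and pn = projN_alg_hom[THEN alg_hom_lin] and r = resNT_alg_hom[THEN alg_hom_lin]
  have "tmap R (kT R) (kT R) (resNT R) (resNT R) (tmap R (kN R) (kN R) (projN R) (projN R) (comultG R c)) =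
      tmap R (kT R) (kT R) (projT R) (projT R) (comultG R c)"
    by (rule tmap_tmap[OF pn pn r r GG(2,2) kN_module kN_module kT_module kT_module
          alg_hom_closed[OF comultG_alg_hom c(1)] p p]) (simp_all add: resNT_projN)
  then show "comultT R (resNT R X) = tmap R (kT R) (kT R) (resNT R) (resNT R) (comultN R X)"
    by (simp add: c resNT_projN comultT_projT comultN_projN)
  show "counitT R (resNT R X) = counitN R X"
    by (simp add: c resNT_projN counitT_projT counitN_projN)
qed

lemma comodule_resNT:
  assumes "comodule R (kN R) (comultN R) (counitN R) M \<delta>"
  shows "comodule R (kT R) (comultT R) (counitT R) M (\<lambda>v. tmap R (kT R) M (resNT R) id (\<delta> v))"
  by (rule comodule_pushforward[OF assms coalgebra_kT alg_hom_lin[OF resNT_alg_hom] resNT_coalgebra_hom])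

lemma comodule_coactSymN: "comodule R (kN R) (comultN R) (counitN R) SV (coactSymN R)"
  unfolding coactSymN_def[abs_def]
  by (rule comodule_pushforward[OF comodule_coactSym coalgebra_kN alg_hom_lin[OF projN_alg_hom]
        comultN_projN counitN_projN])

private abbreviation "NS \<equiv> tensor R (kN R) SV"

private abbreviation "TS \<equiv> tensor R (kT R) SV"

private lemma NS: "algebra R NS" "module R NS" and TS: "algebra R TS" "module R TS"
  by (intro tensor_algebra tensor_module kN_algebra kN_module kT_algebra kT_module SS)+

lemma coactSymN_alg_hom: "coactSymN R \<in> alg_hom R SV NS"
  unfolding coactSymN_def[abs_def]
  by (rule alg_hom_comp[OF coactSym_alg_hom
        tmap_alg_hom[OF projN_alg_hom alg_hom_id(2) GG(1) SS(1) kN_algebra SS(1)]])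

lemma coactSymT_alg_hom: "coactSymT R \<in> alg_hom R SV TS"
  unfolding coactSymT_def[abs_def]
  by (rule alg_hom_comp[OF coactSym_alg_hom
        tmap_alg_hom[OF projT_alg_hom alg_hom_id(2) GG(1) SS(1) kT_algebra SS(1)]])

lemma coactSymT_resNT:
  assumes "f \<in> carrier SV"
  shows "tmap R (kT R) SV (resNT R) id (coactSymN R f) = coactSymT R f"
  unfolding coactSymN_def coactSymT_def
  by (rule tmap_tmap[OF alg_hom_lin[OF projN_alg_hom] lin_id(2) alg_hom_lin[OF resNT_alg_hom] lin_id(2)
        GG(2) SS(2) kN_module SS(2) kT_module SS(2) alg_hom_closed[OF coactSym_alg_hom assms]
        alg_hom_lin[OF projT_alg_hom] lin_id(2)])
    (simp_all add: resNT_projN)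

private lemma mc [simp]: "basis_elt R m \<in> carrier SV" by (rule monom_closed)

private lemma tmap_std_coaction:
  assumes q: "q \<in> alg_hom R G B" and B: "algebra R B"
  shows "tmap R B SV q id (coactSym R (pvar R e)) = (case e of
      E1 \<Rightarrow> tens R B SV (q (xG R X11)) (pvar R E1) \<oplus>\<^bsub>tensor R B SV\<^esub> tens R B SV (q (xG R X12)) (pvar R E2)
    | E2 \<Rightarrow> tens R B SV (q (xG R X21)) (pvar R E1) \<oplus>\<^bsub>tensor R B SV\<^esub> tens R B SV (q (xG R X22)) (pvar R E2))"
  using tmap_tens[OF alg_hom_lin[OF q] lin_id(2) GG(2) SS(2) algebra_module[OF B] SS(2)]
    lin_add[OF tmap_lin[OF alg_hom_lin[OF q] lin_id(2) GG(2) SS(2) algebra_module[OF B] SS(2)]]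
  by (cases e) (simp_all add: coactSym_pvar std_coaction_def Let_def tens_closed[OF GG(2) SS(2)])

interpretation NSc: cring NS by (rule algebra_cring[OF NS(1)])

interpretation TSc: cring TS by (rule algebra_cring[OF TS(1)])

private lemma tcN [simp]: "x \<in> carrier (kN R) \<Longrightarrow> y \<in> carrier SV \<Longrightarrow> tens R (kN R) SV x y \<in> carrier NS"
  by (rule tens_closed[OF kN_module SS(2)])

private lemma tcT [simp]: "x \<in> carrier (kT R) \<Longrightarrow> y \<in> carrier SV \<Longrightarrow> tens R (kT R) SV x y \<in> carrier TS"
  by (rule tens_closed[OF kT_module SS(2)])

private lemma monom_add: "basis_elt R (\<lambda>w. m w + unit_exp v w) = basis_elt R m \<otimes>\<^bsub>mpoly R\<^esub> pvar R v"
  by (simp only: pvar_def monom_mult)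

text \<open>On a nonzero monomial \<open>e\<^sub>1\<^sup>a e\<^sub>2\<^sup>b\<close> the factors are \<open>u = x\<^sub>1\<^sub>1\<^sup>a x\<^sub>2\<^sub>2\<^sup>b\<close> and \<open>v = x\<^sub>1\<^sub>2\<^sup>a x\<^sub>2\<^sub>1\<^sup>b\<close>; the mixed
  products vanish in \<open>k[N]\<close>.\<close>

lemma coactSymN_monom:
  assumes "m \<noteq> (\<lambda>e. 0)"
  shows "\<exists>u v. u \<in> carrier (kN R) \<and> v \<in> carrier (kN R) \<and>
    (\<forall>w\<in>{X12, X21}. u \<otimes>\<^bsub>kN R\<^esub> n w = \<zero>\<^bsub>kN R\<^esub>) \<and> (\<forall>w\<in>{X11, X22}. v \<otimes>\<^bsub>kN R\<^esub> n w = \<zero>\<^bsub>kN R\<^esub>) \<and>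
    coactSymN R (basis_elt R m) = tens R (kN R) SV u (basis_elt R m) \<oplus>\<^bsub>NS\<^esub> tens R (kN R) SV v (basis_elt R (swap_exp m))"
  using assms
proof (induction m rule: exponents_induct)
  case zero
  then show ?case by simp
next
  case (add m e)
  have pvar: "coactSymN R (pvar R e) = (case e of
      E1 \<Rightarrow> tens R (kN R) SV (n X11) (pvar R E1) \<oplus>\<^bsub>NS\<^esub> tens R (kN R) SV (n X12) (pvar R E2)
    | E2 \<Rightarrow> tens R (kN R) SV (n X21) (pvar R E1) \<oplus>\<^bsub>NS\<^esub> tens R (kN R) SV (n X22) (pvar R E2))"
    unfolding coactSymN_def by (rule tmap_std_coaction[OF projN_alg_hom kN_algebra])
  have swap_unit: "swap_exp (unit_exp E1) = unit_exp E2" "swap_exp (unit_exp E2) = unit_exp E1"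
    by (auto simp: swap_exp_def fun_eq_iff split: evar.splits)
  have swap_add: "swap_exp (\<lambda>w. m w + unit_exp E1 w) = (\<lambda>w. swap_exp m w + unit_exp E2 w)"
      "swap_exp (\<lambda>w. m w + unit_exp E2 w) = (\<lambda>w. swap_exp m w + unit_exp E1 w)" for m
    by (auto simp: swap_exp_def fun_eq_iff split: evar.splits)
  show ?case
  \<comment> \<open>The induction effectively starts in degree one, where the coaction of a variable
    already has two terms of the required kind.\<close>
  proof (cases "m = (\<lambda>e. 0)")
    case True
    show ?thesis
    proof (cases e)
      case E1
      show ?thesis
        by (rule exI[of _ "n X11"], rule exI[of _ "n X12"])
          (use pvar in \<open>simp add: True E1 swap_unit pvar_def projN_xG_mult_zero\<close>)
    next
      \<comment> \<open>The diagonal coordinate now sits in the second term of the coaction, so the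
        two terms are exchanged.\<close>
      case E2
      show ?thesis
        by (rule exI[of _ "n X22"], rule exI[of _ "n X21"])
          (use pvar in \<open>simp add: True E2 swap_unit pvar_def projN_xG_mult_zero NSc.a_comm\<close>)
    qed
  next
    case False
    from add.IH[OF this] obtain u v where uv: "u \<in> carrier (kN R)" "v \<in> carrier (kN R)"
      and zu: "u \<otimes>\<^bsub>kN R\<^esub> n X12 = \<zero>\<^bsub>kN R\<^esub>" "u \<otimes>\<^bsub>kN R\<^esub> n X21 = \<zero>\<^bsub>kN R\<^esub>"
      and zv: "v \<otimes>\<^bsub>kN R\<^esub> n X11 = \<zero>\<^bsub>kN R\<^esub>" "v \<otimes>\<^bsub>kN R\<^esub> n X22 = \<zero>\<^bsub>kN R\<^esub>"
      and eq: "coactSymN R (basis_elt R m) = tens R (kN R) SV u (basis_elt R m) \<oplus>\<^bsub>NS\<^esub> tens R (kN R) SV v (basis_elt R (swap_exp m))"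
      by auto
    \<comment> \<open>Multiplying by the coaction of one more variable gives four terms. The facts
      \<open>zu\<close> and \<open>zv\<close> remove the two mixed ones, and
      \<open>projN_xG_mult_zero\<close> restores the vanishing conditions for the new
      factors.\<close>
    note simps = monom_add alg_hom_mult[OF coactSymN_alg_hom mc pc] eq NSc.l_distr NSc.r_distr
      tens_mult[OF kN_algebra SS(1)] uv zu zv tens_zero[OF kN_module SS(2)] swap_add
      algebra_cring[OF SS(1), THEN cring.axioms(1), THEN ring.ring_simprules(5)] Nc.m_assoc projN_xG_mult_zero
    show ?thesis
    proof (cases e)
      case E1
      show ?thesis
        by (rule exI[of _ "u \<otimes>\<^bsub>kN R\<^esub> n X11"], rule exI[of _ "v \<otimes>\<^bsub>kN R\<^esub> n X12"]) (simp add: E1 pvar[unfolded E1 evar.case] simps)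
    next
      case E2
      show ?thesis
        by (rule exI[of _ "u \<otimes>\<^bsub>kN R\<^esub> n X22"], rule exI[of _ "v \<otimes>\<^bsub>kN R\<^esub> n X21"]) (simp add: E2 pvar[unfolded E2 evar.case] simps NSc.a_comm)
    qed
  qed
qed

lemma wt_of_nat: "wt R (int a) (int b) = t X11 [^]\<^bsub>kT R\<^esub> a \<otimes>\<^bsub>kT R\<^esub> t X22 [^]\<^bsub>kT R\<^esub> b"
  by (simp add: wt_def int_pow_int)

text \<open>Off-diagonal coordinates vanish in \<open>k[T]\<close>, so each variable is a weight
  vector; as the coaction is multiplicative, the weights multiply.\<close>

lemma coactSymT_monom:
  "coactSymT R (basis_elt R m) = tens R (kT R) SV (wt R (int (m E1)) (int (m E2))) (basis_elt R m)"
proof (induction m rule: exponents_induct)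
  case zero
  show ?case
    using alg_hom_one[OF coactSymT_alg_hom] wt_of_nat[of 0 0] by (simp add: monom_one tens_one[OF kT_algebra SS(1)])
next
  case (add m e)
  have pvar: "coactSymT R (pvar R e) = tens R (kT R) SV (case e of E1 \<Rightarrow> t X11 | E2 \<Rightarrow> t X22) (pvar R e)"
    unfolding coactSymT_def tmap_std_coaction[OF projT_alg_hom kT_algebra]
    by (cases e) (simp_all add: projT_xG_zero tens_zero[OF kT_module SS(2)])
  note simps = monom_add alg_hom_mult[OF coactSymT_alg_hom mc pc] add.IH wt_of_nat tens_mult[OF kT_algebra SS(1)]
    Tc.nat_pow_closed tc' Tc.m_closed mc pc evar.distinct if_True if_False
    refl Tc.nat_pow_Suc add_0_right Tc.m_ac Suc_eq_plus1[symmetric]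
  show ?case
  proof (cases e)
    case E1
    show ?thesis by (simp only: E1 pvar[unfolded E1 evar.case] simps)
  next
    case E2
    show ?thesis by (simp only: E2 pvar[unfolded E2 evar.case] simps)
  qed
qed

section \<open>Linear independence of the characters of the torus\<close>

private abbreviation "L \<equiv> monoid_alg R int2"

text \<open>\<open>lvar\<close> respects the determinant relation and so extends to
  \<open>k[G]\<close>; it kills the generators of \<open>I1\<close> and so factors through
  \<open>k[T]\<close>. The resulting map turns the characters into Laurent monomials.\<close>

lemma wt_coordinates:
  "\<exists>\<psi>\<in>alg_hom R (kT R) (monoid_alg R int2). \<forall>a b. \<psi> (wt R a b) = basis_elt R (a, b)"
  "wt R a b \<in> carrier (kT R)"
proof -
  have L: "algebra R L" by (rule monoid_alg_algebra[OF R int2_comm_monoid])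
  note T = kT_algebra and p = projT_alg_hom and xc = xG_closed
  interpret Lc: cring L by (rule algebra_cring[OF L])
  interpret Tc: cring "kT R" by (rule algebra_cring[OF T])
  have bc [simp]: "basis_elt R x \<in> carrier L" for x :: "int \<times> int"
    by (rule basis_elt_closed[OF R]) simp
  have bm [simp]: "basis_elt R x \<otimes>\<^bsub>L\<^esub> basis_elt R y = basis_elt R (x + y)" for x y :: "int \<times> int"
    using basis_elt_mult[OF R int2_comm_monoid, of x y] by simp
  have one: "\<one>\<^bsub>L\<^esub> = basis_elt R (0, 0)"
    using monoid_alg_one[OF R int2_comm_monoid] by (simp add: zero_prod_def)
  have lc: "lvar R v \<in> carrier L" for v by (cases v) (simp_all add: lvar_def)
  have det: "lvar R Dinv \<otimes>\<^bsub>L\<^esub> (lvar R X11 \<otimes>\<^bsub>L\<^esub> lvar R X22 \<ominus>\<^bsub>L\<^esub> lvar R X12 \<otimes>\<^bsub>L\<^esub> lvar R X21) = \<one>\<^bsub>L\<^esub>"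
    by (simp add: lvar_def one Lc.minus_eq)
  define \<psi>0 where "\<psi>0 = (\<lambda>X. the_elem (peval R L (lvar R) ` X))"
  have \<psi>0: "\<psi>0 \<in> alg_hom R (kG R) L" and \<psi>0x: "\<psi>0 (xG R v) = lvar R v" for v
    unfolding \<psi>0_def by (rule kG_lift[OF L lc det])+
  have kill: "\<psi>0 j = \<zero>\<^bsub>L\<^esub>" if "j \<in> I1 R" for j
    by (rule kill_I1[OF L \<psi>0 _ _ that]) (simp_all add: \<psi>0x lvar_def)
  define \<psi> where "\<psi> = (\<lambda>X. the_elem (\<psi>0 ` X))"
  have \<psi>p: "\<psi> (projT R c) = \<psi>0 c" if "c \<in> carrier (kG R)" for c
    unfolding \<psi>_def projT_def
    by (rule the_elem_image_coset_lin[OF alg_hom_lin[OF \<psi>0] kG_module algebra_module[OF L]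
          ideal_submodule[OF kG_algebra I1_ideal] kill that])
  have \<psi>: "\<psi> \<in> alg_hom R (kT R) L"
    unfolding kT_def
    by (rule quot_lift_alg_hom[OF \<psi>0 kG_algebra L I1_ideal kill]) (simp_all add: \<psi>p[unfolded projT_def])
  have tc: "t v \<in> carrier (kT R)" for v by (rule alg_hom_closed[OF p xc])
  \<comment> \<open>Modulo \<open>I1\<close> the determinant is the product of the diagonal
    coordinates, so \<open>Dinv\<close> supplies the inverses that make both of them units.\<close>
  have "t Dinv \<otimes>\<^bsub>kT R\<^esub> (t X11 \<otimes>\<^bsub>kT R\<^esub> t X22) = \<one>\<^bsub>kT R\<^esub>"
    using arg_cong[OF xG_det, of "projT R"] kG_algebra
      cring.cring_simprules(5)[OF algebra_cring[OF kG_algebra]] tc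
    by (simp add: alg_hom_mult[OF p] alg_hom_minus[OF p kG_algebra T] alg_hom_one[OF p] xc
        algebra_cring[THEN cring.cring_simprules(4)] projT_xG_zero Tc.minus_eq)
  then have "(t Dinv \<otimes>\<^bsub>kT R\<^esub> t X22) \<otimes>\<^bsub>kT R\<^esub> t X11 = \<one>\<^bsub>kT R\<^esub>"
      "(t Dinv \<otimes>\<^bsub>kT R\<^esub> t X11) \<otimes>\<^bsub>kT R\<^esub> t X22 = \<one>\<^bsub>kT R\<^esub>"
    using tc by (simp_all add: Tc.m_ac)
  then have units: "t X11 \<in> Units (kT R)" "t X22 \<in> Units (kT R)"
    using tc Tc.m_comm[OF Tc.m_closed[OF tc tc] tc] unfolding Units_def by (metis (mono_tags, lifting) Tc.m_closed mem_Collect_eq)+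
  note pow1 = alg_hom_int_pow[OF \<psi> T L units(1), of "\<lambda>a. basis_elt R (a, 0)"]
    and pow2 = alg_hom_int_pow[OF \<psi> T L units(2), of "\<lambda>a. basis_elt R (0, a)"]
  have c1: "t X11 [^]\<^bsub>kT R\<^esub> a \<in> carrier (kT R)" "\<psi> (t X11 [^]\<^bsub>kT R\<^esub> a) = basis_elt R (a, 0)" for a :: int
    by (rule pow1; simp add: one \<psi>p xc \<psi>0x lvar_def)+
  have c2: "t X22 [^]\<^bsub>kT R\<^esub> a \<in> carrier (kT R)" "\<psi> (t X22 [^]\<^bsub>kT R\<^esub> a) = basis_elt R (0, a)" for a :: int
    by (rule pow2; simp add: one \<psi>p xc \<psi>0x lvar_def)+
  show "wt R a b \<in> carrier (kT R)" unfolding wt_def by (intro Tc.m_closed c1 c2)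
  have "\<psi> (wt R a b) = basis_elt R (a, b)" for a b
    unfolding wt_def by (simp add: alg_hom_mult[OF \<psi>] c1 c2)
  then show "\<exists>\<psi>\<in>alg_hom R (kT R) L. \<forall>a b. \<psi> (wt R a b) = basis_elt R (a, b)" using \<psi> by blast
qed

section \<open>Restriction to forms with prescribed monomials\<close>

private lemma P: "module R (mpoly R)" by (rule mpoly_module)

interpretation P: module R "mpoly R :: ('a, ('v \<Rightarrow> nat) \<Rightarrow> 'a) module" by (rule P)

lemma supp_mod_submodule: "submodule (supp_mod R S) R (mpoly R)"
proof (rule submoduleI'[OF P])
  fix f g assume fg: "f \<in> supp_mod R S" "g \<in> supp_mod R S"
  then have "f m \<oplus> g m = \<zero>" if "m \<notin> S" for m
    using supp_modD[OF fg(1) that] supp_modD[OF fg(2) that] by simp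
  then show "f \<oplus>\<^bsub>mpoly R\<^esub> g \<in> supp_mod R S" using fg by (auto simp: supp_mod_def)
next
  fix r f assume rf: "r \<in> carrier R" "f \<in> supp_mod R S"
  then have "r \<otimes> f m = \<zero>" if "m \<notin> S" for m
    using supp_modD[OF rf(2) that] by simp
  then show "r \<odot>\<^bsub>mpoly R\<^esub> f \<in> supp_mod R S" using rf by (auto simp: supp_mod_def)
qed (auto simp: supp_mod_def)

lemma supp_module: "module R (supp_module R S)"
  by (rule submodule_facts(6)[OF supp_mod_submodule P])

lemma proj_supp_lin:
  fixes S :: "('v \<Rightarrow> nat) set"
  shows "proj_supp R S \<in> lin_map R (mpoly R) (supp_module R S)"
proof (rule lin_mapI)
  fix f assume f: "f \<in> carrier (mpoly R :: ('a, ('v \<Rightarrow> nat) \<Rightarrow> 'a) module)"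
  have "{m. proj_supp R S f m \<noteq> \<zero>} \<subseteq> {m. f m \<noteq> \<zero>}" by (auto simp: proj_supp_def)
  then have "finite {m. proj_supp R S f m \<noteq> \<zero>}"
    using mpoly_supp_finite[OF f] by (rule finite_subset)
  then show "proj_supp R S f \<in> carrier (supp_module R S)"
    using f by (auto simp: supp_mod_def mpoly_def monoid_alg_carrier) (auto simp: proj_supp_def split: if_splits)
qed (auto simp: proj_supp_def fun_eq_iff)

lemma proj_supp_lin': "proj_supp R S \<in> lin_map R (mpoly R) (mpoly R)"
  using lin_comp[OF proj_supp_lin[of S] submodule_incl(1)[OF supp_mod_submodule P]] by simp

lemma proj_supp_id: "f \<in> supp_mod R S \<Longrightarrow> proj_supp R S f = f"
  using supp_modD[of f R S] by (auto simp: proj_supp_def fun_eq_iff)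

lemma proj_supp_monom: "m \<in> S \<Longrightarrow> proj_supp R S (basis_elt R m) = basis_elt R m"
  "m \<notin> S \<Longrightarrow> proj_supp R S (basis_elt R m) = \<zero>\<^bsub>mpoly R\<^esub>"
  by (rule ext, auto simp: proj_supp_def basis_elt_def)+

lemma supp_mod_carrier: "f \<in> supp_mod R S \<Longrightarrow> f \<in> carrier (mpoly R)"
  by (simp add: supp_mod_def)

text \<open>\<open>\<delta>\<close> truncates the values of \<open>\<sigma>\<close>; the stability
  condition says that nothing is lost when the argument has support in \<open>S\<close>.\<close>

lemma restricted_coaction:
  fixes S :: "('v \<Rightarrow> nat) set"
  assumes C: "module R C" and \<sigma>: "\<sigma> \<in> lin_map R (mpoly R) (tensor R C (mpoly R))"
    and stable: "\<And>m. m \<in> S \<Longrightarrow> tmap R C (mpoly R) id (proj_supp R S) (\<sigma> (basis_elt R m)) = \<sigma> (basis_elt R m)"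
  defines "\<delta> \<equiv> \<lambda>f. tmap R C (supp_module R S) id (proj_supp R S) (\<sigma> f)"
  shows "\<delta> \<in> lin_map R (mpoly R) (tensor R C (supp_module R S))"
    and "\<delta> \<in> lin_map R (supp_module R S) (tensor R C (supp_module R S))"
    and "f \<in> supp_mod R S \<Longrightarrow> tmap R C (mpoly R) id id (\<delta> f) = \<sigma> f"
proof -
  let ?W = "supp_module R S" and ?p = "proj_supp R S"
  note CP = tensor_module[OF C P] and W = supp_module[of S] and i = submodule_incl[OF supp_mod_submodule[of S] P]
  note q = tmap_lin[OF lin_id(2) proj_supp_lin[of S] C P C W]
  show \<delta>: "\<delta> \<in> lin_map R (mpoly R) (tensor R C (?W))"
    unfolding \<delta>_def by (rule lin_comp[OF \<sigma> q])
  show "\<delta> \<in> lin_map R (?W) (tensor R C (?W))"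
    using lin_comp[OF i(1) \<delta>] by simp
  assume f: "f \<in> supp_mod R S"
  note q' = tmap_lin[OF lin_id(2) proj_supp_lin'[of S] C P C P]
  have "tmap R C (mpoly R) id id (\<delta> f) = tmap R C (mpoly R) id (?p) (\<sigma> f)"
    unfolding \<delta>_def
    by (rule tmap_tmap[OF lin_id(2) proj_supp_lin lin_id(2) i(2) C P C W C P
          lin_closed[OF \<sigma> supp_mod_carrier[OF f]] lin_id(2) proj_supp_lin']) simp_all
  \<comment> \<open>Inserting the truncation of the argument turns the claim into an equation of
    linear maps on the whole polynomial ring. Monomials generate there: those in \<open>S\<close>
    are covered by stability, and the others give zero on both sides.\<close>
  also have "\<dots> = tmap R C (mpoly R) id (?p) (\<sigma> (?p f))"
    by (simp add: proj_supp_id[OF f])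
  also have "\<dots> = \<sigma> (?p f)"
  proof (rule generates_eq[OF generates_monom lin_comp[OF lin_comp[OF proj_supp_lin' \<sigma>] q']
        lin_comp[OF proj_supp_lin' \<sigma>] P CP _ supp_mod_carrier[OF f]])
    fix s :: "('v \<Rightarrow> nat) \<Rightarrow> 'a" assume "s \<in> range (basis_elt R)"
    then obtain m where s: "s = basis_elt R m" by auto
    show "tmap R C (mpoly R) id (?p) (\<sigma> (?p s)) = \<sigma> (?p s)"
      by (cases "m \<in> S") (simp_all add: s proj_supp_monom stable lin_zero[OF \<sigma> P CP] lin_zero[OF q' CP CP])
  qed
  also have "\<dots> = \<sigma> f" by (simp add: proj_supp_id[OF f])
  finally show "tmap R C (mpoly R) id id (\<delta> f) = \<sigma> f" .
qed

private lemma NT: "module R (kN R)" "module R (kT R)" by (rule kN_module kT_module)+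

lemma coactSymN_stable:
  assumes "\<And>m. m \<in> S \<Longrightarrow> swap_exp m \<in> S" "(\<lambda>e. 0) \<notin> S" "m \<in> S"
  shows "tmap R (kN R) (mpoly R) id (proj_supp R S) (coactSymN R (basis_elt R m)) = coactSymN R (basis_elt R m)"
proof -
  have "m \<noteq> (\<lambda>e. 0)" using assms(2,3) by auto
  from coactSymN_monom[OF this] obtain u v where uv: "u \<in> carrier (kN R)" "v \<in> carrier (kN R)"
    "coactSymN R (basis_elt R m) = tens R (kN R) (mpoly R) u (basis_elt R m) \<oplus>\<^bsub>tensor R (kN R) SV\<^esub>
      tens R (kN R) (mpoly R) v (basis_elt R (swap_exp m))" by blast
  note t = tmap_tens[OF lin_id(2) proj_supp_lin'[of S] NT(1) P NT(1) P]
    and l = lin_add[OF tmap_lin[OF lin_id(2) proj_supp_lin'[of S] NT(1) P NT(1) P]]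
  show ?thesis
    using uv(1,2) assms(1,3)
    by (simp add: uv(3) t l tens_closed[OF NT(1) P] monom_closed proj_supp_monom)
qed

lemma coactSymT_stable:
  assumes "m \<in> S"
  shows "tmap R (kT R) (mpoly R) id (proj_supp R S) (coactSymT R (basis_elt R m)) = coactSymT R (basis_elt R m)"
  using tmap_tens[OF lin_id(2) proj_supp_lin'[of S] NT(2) P NT(2) P] assms
  by (simp add: coactSymT_monom wt_coordinates(2) monom_closed proj_supp_monom)

section \<open>Weight spaces\<close>

lemma coactSymT_weight_iff:
  assumes f: "f \<in> carrier (mpoly R)"
  shows "coactSymT R f = tens R (kT R) (mpoly R) (wt R a b) f \<longleftrightarrow> f \<in> supp_mod R (wt_exps a b)"
proof
  obtain \<psi> where \<psi>: "\<psi> \<in> alg_hom R (kT R) (monoid_alg R int2)" "\<And>a b. \<psi> (wt R a b) = basis_elt R (a, b)"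
    using wt_coordinates(1) by blast
  note Q = regular_mod_module[OF R] and tb = mult_bilin[OF regular_mod_algebra[OF R]]
  \<comment> \<open>The functional pairs the coefficient of the character with exponent
    \<open>m\<close> with the coefficient of the monomial \<open>m\<close>; on a coaction this
    returns the coefficient of the form.\<close>
  define \<beta> where "\<beta> m = (\<lambda>c w. \<psi> c (int (m E1), int (m E2)) \<otimes> w m)" for m :: "evar \<Rightarrow> nat"
  have \<beta>: "bilin R (kT R) SV (regular_mod R) (\<beta> m)" for m
    using bilin_comp[OF tb lin_comp[OF alg_hom_lin[OF \<psi>(1)] monoid_alg_eval] mpoly_eval_lin lin_id(1)]
    by (simp add: \<beta>_def)
  note lin = tlift_lin[OF NT(2) P Q \<beta>] and val = tlift_tens[OF NT(2) P Q \<beta>]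
  have coeff: "tlift R (regular_mod R) (\<beta> m) (coactSymT R f) = f m" for m
  proof (rule generates_eq[OF generates_monom lin_comp[OF alg_hom_lin[OF coactSymT_alg_hom] lin]
        mpoly_eval_lin P Q _ f])
    fix s :: "'a symV" assume "s \<in> range (basis_elt R)"
    then obtain m' where s: "s = basis_elt R m'" by auto
    show "tlift R (regular_mod R) (\<beta> m) (coactSymT R s) = s m"
      by (simp add: s coactSymT_monom val wt_coordinates(2) monom_closed)
        (auto simp: \<beta>_def \<psi>(2) basis_elt_def)
  qed
  show "f \<in> supp_mod R (wt_exps a b)" if eq: "coactSymT R f = tens R (kT R) (mpoly R) (wt R a b) f"
  proof -
    \<comment> \<open>Applied to the weight equation, the functional multiplies \<open>f m\<close>
      by a Kronecker delta, which forces \<open>f m\<close> to vanish away from the weight.\<close>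
    have "f m = basis_elt R (a, b) (int (m E1), int (m E2)) \<otimes> f m" for m
      using coeff[of m] val[OF wt_coordinates(2) f, of m a b] by (simp add: eq \<beta>_def \<psi>(2))
    then have "f m = \<zero>" if "m \<notin> wt_exps a b" for m
      using that mpoly_coeff_closed[OF f, of m] by (metis (mono_tags, lifting) Rc.l_null basis_elt_def mem_Collect_eq prod.inject wt_exps_def)
    then show ?thesis using f by (auto simp: supp_mod_def)
  qed
  assume fs: "f \<in> supp_mod R (wt_exps a b)"
  have tbS: "bilin R (kT R) SV (tensor R (kT R) SV) (tens R (kT R) SV)" by (rule tens_bilin[OF NT(2) P])
  show "coactSymT R f = tens R (kT R) (mpoly R) (wt R a b) f"
  \<comment> \<open>A weight with a negative exponent admits no monomial, so \<open>f\<close> is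
    zero; any other weight admits exactly one.\<close>
  proof (cases "wt_exps a b = {}")
    case True
    then have "f = \<zero>\<^bsub>SV\<^esub>" using fs by (auto simp: supp_mod_def fun_eq_iff)
    moreover have "tens R (kT R) SV (wt R a b) \<zero>\<^bsub>SV\<^esub> = \<zero>\<^bsub>tensor R (kT R) SV\<^esub>"
      by (rule tens_zero(2)[OF NT(2) P wt_coordinates(2)])
    ultimately show ?thesis
      using lin_zero[OF alg_hom_lin[OF coactSymT_alg_hom] P tensor_module[OF NT(2) P]] by simp
  next
    case False
    then obtain m where m: "m \<in> wt_exps a b" by auto
    \<comment> \<open>Only one monomial has this weight, so \<open>f\<close> is a multiple of it and
      linearity reduces the claim to \<open>coactSymT_monom\<close>.\<close>
    have f_eq: "f = f m \<odot>\<^bsub>SV\<^esub> basis_elt R m"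
    proof
      fix m'
      show "f m' = (f m \<odot>\<^bsub>SV\<^esub> basis_elt R m) m'"
      proof (cases "m' = m")
        case True
        then show ?thesis using mpoly_coeff_closed[OF f, of m] by (simp add: basis_elt_def)
      next
        case False
        then have "m' \<notin> wt_exps a b" using wt_exps_inj[OF m] by metis
        then have "f m' = \<zero>" by (rule supp_modD[OF fs])
        then show ?thesis using False mpoly_coeff_closed[OF f, of m] by (simp add: basis_elt_def)
      qed
    qed
    have fm: "f m \<in> carrier R" by (rule mpoly_coeff_closed[OF f])
    have "coactSymT R (f m \<odot>\<^bsub>SV\<^esub> basis_elt R m) = tens R (kT R) (mpoly R) (wt R a b) (f m \<odot>\<^bsub>SV\<^esub> basis_elt R m)"
      using m lin_smult[OF alg_hom_lin[OF coactSymT_alg_hom] fm monom_closed]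
        lin_smult[OF bilin_right[OF tbS wt_coordinates(2)] fm monom_closed]
      by (simp add: coactSymT_monom wt_exps_def)
    then show ?thesis by (simp only: f_eq[symmetric])
  qed
qed

text \<open>The weight equation lives in \<open>k[T] \<otimes> W\<close>. By
  \<open>incl_tmap_inj\<close> it may be tested in \<open>k[T] \<otimes> Sym(V)\<close>, where
  \<open>coactSymT_weight_iff\<close> decides it.\<close>

lemma weight_space_supp:
  assumes \<delta>: "\<And>w. w \<in> supp_mod R S \<Longrightarrow> \<delta> w \<in> carrier (tensor R (kT R) (supp_module R S))"
    and restr: "\<And>w. w \<in> supp_mod R S \<Longrightarrow> tmap R (kT R) (mpoly R) id id (\<delta> w) = coactSymT R w"
  shows "weight_space R (supp_module R S) \<delta> (wt R a b) = supp_mod R (S \<inter> wt_exps a b)"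
proof -
  let ?W = "supp_module R S"
  note W = supp_module[of S] and H = supp_mod_submodule[of S]
  have "\<delta> w = tens R (kT R) (?W) (wt R a b) w \<longleftrightarrow> w \<in> supp_mod R (wt_exps a b)"
    if w: "w \<in> supp_mod R S" for w
  proof -
    have tw: "tens R (kT R) (?W) (wt R a b) w \<in> carrier (tensor R (kT R) (?W))"
      by (rule tens_closed[OF NT(2) W wt_coordinates(2)]) (simp add: w)
    have "tmap R (kT R) SV id id (tens R (kT R) (?W) (wt R a b) w) = tens R (kT R) SV (wt R a b) w"
      using tmap_tens[OF lin_id(2) submodule_incl(2)[OF H P] NT(2) W NT(2) P wt_coordinates(2)] w by simp
    then have "\<delta> w = tens R (kT R) (?W) (wt R a b) w \<longleftrightarrow>
        coactSymT R w = tens R (kT R) SV (wt R a b) w"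
      using incl_tmap_inj[OF NT(2) P H proj_supp_lin proj_supp_id \<delta>[OF w] tw] restr[OF w] by metis
    then show ?thesis using coactSymT_weight_iff[OF supp_mod_carrier[OF w]] by simp
  qed
  then show ?thesis unfolding weight_space_def by (auto simp: supp_mod_def)
qed

section \<open>Direct sums and characters\<close>

lemma supp_mod_sub_submodule:
  assumes "S' \<subseteq> S" shows "submodule (supp_mod R S') R (supp_module R S)"
proof (rule submoduleI'[OF supp_module])
  show "supp_mod R S' \<subseteq> carrier (supp_module R S)" using assms by (auto simp: supp_mod_def)
qed (simp_all add: submodule_facts(2-4)[OF supp_mod_submodule P])

lemma supp_mod_finsum_apply:
  assumes "g \<in> A \<rightarrow> supp_mod R S"
  shows "(\<Oplus>\<^bsub>supp_module R S\<^esub>i\<in>A. g i) m = (\<Oplus>i\<in>A. g i m)"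
  using lin_finsum[OF lin_comp[OF submodule_incl(1)[OF supp_mod_submodule[of S] P] mpoly_eval_lin[of m]]
      supp_module regular_mod_module[OF R], of g A] assms by simp

text \<open>The component at \<open>i\<close> is the truncation to \<open>D i\<close>. It is unique
  because at an exponent in \<open>D i\<close> disjointness lets only that component contribute. The
  index set may be infinite, as needed for weights ranging over all pairs of integers.\<close>

lemma direct_sum_supp:
  fixes S :: "('v \<Rightarrow> nat) set" and D :: "'i \<Rightarrow> ('v \<Rightarrow> nat) set"
  assumes S: "S = (\<Union>i\<in>I. D i)" and disj: "\<And>i j. i \<in> I \<Longrightarrow> j \<in> I \<Longrightarrow> i \<noteq> j \<Longrightarrow> D i \<inter> D j = {}"
  shows "is_direct_sum R (supp_module R S) I (\<lambda>i. supp_mod R (D i))"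
  unfolding is_direct_sum_def
proof (intro conjI ballI)
  let ?Z = "\<lambda>f. {i \<in> I. f i \<noteq> \<zero>\<^bsub>supp_module R S\<^esub>}"
  let ?sum = "\<lambda>g. \<Oplus>\<^bsub>supp_module R S\<^esub>i\<in>?Z g. g i" and ?Pi = "(\<Pi>\<^sub>E i\<in>I. supp_mod R (D i))"
  show "submodule (supp_mod R (D i)) R (supp_module R S)" if "i \<in> I" for i
    by (rule supp_mod_sub_submodule) (use that S in auto)
  have mono: "supp_mod R (D i) \<subseteq> supp_mod R S" if "i \<in> I" for i
    using that S by (auto simp: supp_mod_def)
  have off: "g j m = \<zero>" if "g \<in> ?Pi" "i \<in> I" "j \<in> I" "m \<in> D i" "j \<noteq> i" for g i j m
  proof (rule supp_modD[OF PiE_mem[OF that(1,3)]])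
    show "m \<notin> D j" using disj[OF that(2,3)] that(4,5) by blast
  qed
  have eval: "?sum g m = g i m"
    if g: "g \<in> ?Pi" "finite (?Z g)" and i: "i \<in> I" "m \<in> D i" for g i m
  proof -
    have c: "g j m \<in> carrier R" if "j \<in> I" for j
      by (rule mpoly_coeff_closed[OF supp_mod_carrier[OF PiE_mem[OF g(1) that]]])
    have "?sum g m = (\<Oplus>j\<in>?Z g. g j m)"
      by (rule supp_mod_finsum_apply) (use PiE_mem[OF g(1)] mono in blast)
    \<comment> \<open>\<open>i\<close> is inserted because the component \<open>g i\<close> may be
      zero and then its index is absent from the support.\<close>
    also have "\<dots> = (\<Oplus>j\<in>insert i (?Z g). g j m)"
      by (rule Rc.add.finprod_mono_neutral_cong_left) (use g(2) i c in auto)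
    also have "\<dots> = (\<Oplus>j\<in>insert i (?Z g). if i = j then g j m else \<zero>)"
      by (rule Rc.finsum_cong') (use i c off[OF g(1) i(1) _ i(2)] in auto)
    also have "\<dots> = g i m"
      by (rule Rc.add.finprod_singleton) (use i g(2) c in auto)
    finally show ?thesis .
  qed
  have off': "?sum g m = \<zero>"
    if g: "g \<in> ?Pi" and m: "m \<notin> S" for g m
  proof -
    have "?sum g \<in> carrier (supp_module R S)"
    proof -
      interpret W: module R "supp_module R S" by (rule supp_module)
      show ?thesis by (rule W.finsum_closed) (use PiE_mem[OF g] mono in auto)
    qed
    then show ?thesis using m by (auto intro: supp_modD)
  qed
  fix v assume v: "v \<in> carrier (supp_module R S)"
  then have vS: "v \<in> supp_mod R S" by simp
  show "\<exists>!f. f \<in> ?Pi \<and> finite (?Z f) \<and> v = ?sum f"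
  proof (rule ex1I)
    define f where "f = (\<lambda>i\<in>I. proj_supp R (D i) v)"
    have f: "f \<in> ?Pi"
      using lin_closed[OF proj_supp_lin supp_mod_carrier[OF vS]] by (auto simp: f_def)
    \<comment> \<open>Finiteness of the family: a nonzero component contains a monomial of
      \<open>v\<close>, and by disjointness this monomial determines the index.\<close>
    have "?Z f \<subseteq> (\<lambda>m. SOME i. i \<in> I \<and> m \<in> D i) ` {m. v m \<noteq> \<zero>}"
    proof
      fix i assume i: "i \<in> ?Z f"
      then obtain m where m: "f i m \<noteq> \<zero>" by (auto simp: fun_eq_iff)
      then have mD: "m \<in> D i" "v m \<noteq> \<zero>" using i by (auto simp: f_def proj_supp_def split: if_splits)
      have "(SOME i. i \<in> I \<and> m \<in> D i) = i"
        by (rule some_equality) (use i mD disj in auto)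
      then show "i \<in> (\<lambda>m. SOME i. i \<in> I \<and> m \<in> D i) ` {m. v m \<noteq> \<zero>}" using mD by force
    qed
    then have fin: "finite (?Z f)"
      using mpoly_supp_finite[OF supp_mod_carrier[OF vS]] by (rule finite_surj[rotated])
    have "v m = ?sum f m" for m
    proof (cases "m \<in> S")
      case True
      then obtain i where i: "i \<in> I" "m \<in> D i" using S by auto
      then show ?thesis unfolding eval[OF f fin i] by (simp add: f_def proj_supp_def)
    next
      case False
      then show ?thesis unfolding off'[OF f False] by (rule supp_modD[OF vS])
    qed
    then show "f \<in> ?Pi \<and> finite (?Z f) \<and> v = ?sum f"
      using f fin by blast
    fix g assume g: "g \<in> ?Pi \<and> finite (?Z g) \<and> v = ?sum g"
    then have g1: "g \<in> ?Pi" and g2: "finite (?Z g)"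
      and g3: "v = ?sum g" by auto
    show "g = f"
    proof (rule PiE_ext[OF g1 f], rule ext)
      fix i m assume i: "i \<in> I"
      show "g i m = f i m"
      proof (cases "m \<in> D i")
        case True
        have "v m = g i m" by (subst g3) (rule eval[OF g1 g2 i True])
        then show ?thesis using True i by (simp add: f_def proj_supp_def)
      next
        case False
        have "g i \<in> supp_mod R (D i)" using g1 i by auto
        then have "g i m = \<zero>" using False by (rule supp_modD)
        then show ?thesis using False i by (simp add: f_def proj_supp_def)
      qed
    qed
  qed
qed

lemma free_of_rank_0: "free_of_rank R (supp_module R ({} :: ('v \<Rightarrow> nat) set)) 0"
proof -
  interpret W: module R "supp_module R {} :: ('a, ('v \<Rightarrow> nat) \<Rightarrow> 'a) module" by (rule supp_module)
  have "v = \<zero>\<^bsub>supp_module R {}\<^esub>" if "v \<in> supp_mod R {}" for v :: "('v \<Rightarrow> nat) \<Rightarrow> 'a"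
    by (rule ext) (use supp_modD[OF that] in simp)
  then have "v = (\<Oplus>\<^bsub>supp_module R {}\<^esub>j\<in>{..<0}. c j \<odot>\<^bsub>supp_module R {}\<^esub> e j)"
    if "v \<in> supp_mod R {}" for v :: "('v \<Rightarrow> nat) \<Rightarrow> 'a" and c :: "nat \<Rightarrow> 'a" and e
    using that W.finsum_empty by simp
  then show ?thesis unfolding free_of_rank_def by auto
qed

lemma free_of_rank_1: "free_of_rank R (supp_module R {m}) 1"
proof -
  let ?W = "supp_module R {m}"
  interpret W: module R "?W" by (rule supp_module)
  have b: "basis_elt R m \<in> supp_mod R {m}"
    using monom_closed[of m] by (auto simp: supp_mod_def basis_elt_def)
  then have bc: "basis_elt R m \<in> carrier (?W)" by simp
  show ?thesis
    unfolding free_of_rank_def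
  proof (intro bexI ballI)
    show "(\<lambda>_. basis_elt R m) \<in> {..<1 :: nat} \<rightarrow> carrier (?W)" using b by simp
    fix v assume "v \<in> carrier (?W)"
    then have v: "v \<in> supp_mod R {m}" by simp
    have sum: "(\<Oplus>\<^bsub>?W\<^esub>j\<in>{..<1}. c j \<odot>\<^bsub>?W\<^esub> basis_elt R m) =
        c 0 \<odot>\<^bsub>?W\<^esub> basis_elt R m" if "c 0 \<in> carrier R" for c :: "nat \<Rightarrow> 'a"
      using W.finsum_insert[of "{}" "0 :: nat" "\<lambda>j. c j \<odot>\<^bsub>?W\<^esub> basis_elt R m"]
        W.smult_closed[OF that bc] W.r_zero[OF W.smult_closed[OF that bc]]
      by (simp add: lessThan_Suc del: partial_object.update_convs)
    define c0 :: "nat \<Rightarrow> 'a" where "c0 = (\<lambda>j\<in>{..<1}. v m)"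
    show "\<exists>!c. c \<in> {..<1 :: nat} \<rightarrow>\<^sub>E carrier R \<and>
        v = (\<Oplus>\<^bsub>?W\<^esub>j\<in>{..<1}. c j \<odot>\<^bsub>?W\<^esub> basis_elt R m)"
    proof (rule ex1I)
      have vm: "v m \<in> carrier R" by (rule mpoly_coeff_closed[OF supp_mod_carrier[OF v]])
      have "v m' = (v m \<odot>\<^bsub>?W\<^esub> basis_elt R m) m'" for m'
        using supp_modD[OF v, of m'] vm by (simp add: basis_elt_def)
      then have "v = v m \<odot>\<^bsub>?W\<^esub> basis_elt R m" by (rule ext)
      moreover have "c0 0 = v m" by (simp add: c0_def)
      ultimately show "c0 \<in> {..<1} \<rightarrow>\<^sub>E carrier R \<and>
          v = (\<Oplus>\<^bsub>?W\<^esub>j\<in>{..<1}. c0 j \<odot>\<^bsub>?W\<^esub> basis_elt R m)"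
        using vm sum[of c0] by (auto simp only: c0_def restrict_PiE_iff)
      fix c :: "nat \<Rightarrow> 'a" assume c: "c \<in> {..<1} \<rightarrow>\<^sub>E carrier R \<and>
          v = (\<Oplus>\<^bsub>?W\<^esub>j\<in>{..<1}. c j \<odot>\<^bsub>?W\<^esub> basis_elt R m)"
      then have cc: "c 0 \<in> carrier R" by (auto simp: PiE_iff)
      have "v m = (c 0 \<odot>\<^bsub>?W\<^esub> basis_elt R m) m" using c unfolding sum[of c, OF cc] by metis
      then have "c 0 = v m" using cc by (simp add: basis_elt_def)
      then show "c = c0"
        using c unfolding c0_def by (intro extensionalityI[of c "{..<1}"]) (auto simp: PiE_def)
    qed
  qed
qed

text \<open>An exponent vector is determined by its weight exponents, so each weight space is
  spanned by at most one monomial and every rank can be taken to be 0 or 1.\<close>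

lemma has_char_supp:
  assumes com: "comodule R (kT R) (comultT R) (counitT R) (supp_module R S) \<delta>"
    and restr: "\<And>w. w \<in> supp_mod R S \<Longrightarrow> tmap R (kT R) (mpoly R) id id (\<delta> w) = coactSymT R w"
    and \<chi>: "\<And>a b. Poly_Mapping.lookup \<chi> (a, b) = (if S \<inter> wt_exps a b = {} then 0 else 1)"
  shows "has_char R (supp_module R S) \<delta> \<chi>"
  unfolding has_char_def
proof (intro conjI allI com)
  let ?W = "supp_module R S"
  have \<delta>: "\<delta> w \<in> carrier (tensor R (kT R) (?W))" if "w \<in> supp_mod R S" for w
    using lin_closed[OF comoduleD(3)[OF com]] that by simp
  note ws = weight_space_supp[OF \<delta> restr]
  have "(\<lambda>(a, b). weight_space R (?W) \<delta> (wt R a b)) = (\<lambda>p. supp_mod R (S \<inter> wt_exps (fst p) (snd p)))"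
    by (auto simp: ws fun_eq_iff)
  moreover have "is_direct_sum R (?W) UNIV (\<lambda>p. supp_mod R (S \<inter> wt_exps (fst p) (snd p)))"
    by (rule direct_sum_supp) (auto simp: wt_exps_def)
  ultimately show "is_direct_sum R (?W) UNIV (\<lambda>(a, b). weight_space R (?W) \<delta> (wt R a b))"
    by simp
  fix a b
  have eq: "(?W)\<lparr>carrier := weight_space R (?W) \<delta> (wt R a b)\<rparr> =
      supp_module R (S \<inter> wt_exps a b)" by (simp add: ws)
  show "\<exists>n. free_of_rank R ((?W)\<lparr>carrier := weight_space R (?W) \<delta> (wt R a b)\<rparr>) n \<and>
      Poly_Mapping.lookup \<chi> (a, b) = int n"
  proof (cases "S \<inter> wt_exps a b = {}")
    case True
    then show ?thesis unfolding eq using free_of_rank_0 by (intro exI[of _ 0]) (simp add: \<chi>)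
  next
    case False
    then obtain m where m: "m \<in> S" "m \<in> wt_exps a b" by auto
    then have "S \<inter> wt_exps a b = {m}" using wt_exps_inj by blast
    then show ?thesis unfolding eq using free_of_rank_1[of m] by (intro exI[of _ 1]) (simp add: \<chi>)
  qed
qed

section \<open>The refined weight space decomposition\<close>

private lemma mods: "module R (kG R)" "module R (kN R)" "module R (kT R)" "module R SV"
  "module R (supp_module R X)"
  by (rule kG_module kN_module kT_module P supp_module)+

private lemma supp_sub: "submodule (supp_mod R X) R SV"
  by (rule supp_mod_submodule)

text \<open>Passing to a quotient of \<open>k[G]\<close> and truncating to degree \<open>d\<close>
  act on different tensor factors, so they can be interchanged. This relates the given coactions to
  truncations of those on the whole symmetric algebra.\<close>

lemma coact_quotient:
  assumes q: "q \<in> lin_map R (kG R) C" and C: "module R C" and f: "f \<in> carrier SV"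
  shows "tmap R C (Sym R d) q id (coactG R d f) =
    tmap R C (supp_module R (deg_exps d)) id (proj_supp R (deg_exps d)) (tmap R C (mpoly R) q id (coactSym R f))"
proof -
  let ?W = "supp_module R (deg_exps d)" and ?p = "proj_supp R (deg_exps d)"
  note idl = lin_id(2) and pl = proj_supp_lin[of "deg_exps d"]
  note c = alg_hom_closed[OF coactSym_alg_hom f]
  have "tmap R C (Sym R d) q id (coactG R d f) = tmap R C (?W) q (?p) (coactSym R f)"
    unfolding coactG_def Sym_eq hom_part_eq
    by (rule tmap_tmap[OF idl pl q idl mods(1,4,1,5) C mods(5) c q pl]) simp_all
  also have "\<dots> = tmap R C (?W) id (?p) (tmap R C (mpoly R) q id (coactSym R f))"
    by (rule tmap_tmap[OF q idl idl pl mods(1,4) C mods(4) C mods(5) c q pl, symmetric]) simp_all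
  finally show ?thesis .
qed

lemma coactN_eq: "f \<in> carrier SV \<Longrightarrow> coactN R d f = coactW R (deg_exps d) f"
  unfolding coactN_def coactW_def coactSymN_def
  by (rule coact_quotient[OF alg_hom_lin[OF projN_alg_hom] mods(2)])

context
  fixes X :: "(evar \<Rightarrow> nat) set"
  assumes X: "\<And>m. m \<in> X \<Longrightarrow> swap_exp m \<in> X" "(\<lambda>e. 0) \<notin> X"
begin

private lemmas rc = restricted_coaction[OF mods(2) alg_hom_lin[OF coactSymN_alg_hom]
    coactSymN_stable[OF X], folded coactW_def]

lemma coactW_lin: "coactW R X \<in> lin_map R (supp_module R X) (tensor R (kN R) (supp_module R X))"
  using rc(2) by (simp add: coactW_def[abs_def])

lemma coactW_incl: "f \<in> supp_mod R X \<Longrightarrow> tmap R (kN R) SV id id (coactW R X f) = coactSymN R f"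
  using rc(3) by simp

lemma comodule_coactW: "comodule R (kN R) (comultN R) (counitN R) (supp_module R X) (coactW R X)"
  by (rule subcomodule[OF comodule_coactSymN supp_sub proj_supp_lin proj_supp_id coactW_lin coactW_incl])

text \<open>Restriction to the torus acts on the coalgebra factor and inclusion on the module
  factor, so the two commute.\<close>

lemma restrict_coactW:
  assumes f: "f \<in> supp_mod R X"
  shows "tmap R (kT R) SV id id (restrict_to_T R (supp_module R X) (coactW R X) f) = coactSymT R f"
proof -
  note idl = lin_id(2) and i = submodule_incl(2)[OF supp_sub[of X] mods(4)]
    and r = alg_hom_lin[OF resNT_alg_hom]
  have c: "coactW R X f \<in> carrier (tensor R (kN R) (supp_module R X))"
    using lin_closed[OF coactW_lin] f by simp
  have "tmap R (kT R) SV id id (restrict_to_T R (supp_module R X) (coactW R X) f) =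
      tmap R (kT R) SV (resNT R) id (coactW R X f)"
    unfolding restrict_to_T_def
    by (rule tmap_tmap[OF r idl idl i mods(2,5,3,5,3,4) c r i]) simp_all
  also have "\<dots> = tmap R (kT R) SV (resNT R) id (tmap R (kN R) SV id id (coactW R X f))"
    by (rule tmap_tmap[OF idl i r idl mods(2,5,2,4,3,4) c r i, symmetric]) simp_all
  also have "\<dots> = coactSymT R f"
    unfolding coactW_incl[OF f] by (rule coactSymT_resNT[OF supp_mod_carrier[OF f]])
  finally show ?thesis .
qed

lemma has_char_coactW:
  assumes "\<And>a b. Poly_Mapping.lookup \<chi> (a, b) = (if X \<inter> wt_exps a b = {} then 0 else 1)"
  shows "has_char R (supp_module R X) (restrict_to_T R (supp_module R X) (coactW R X)) \<chi>"
  by (rule has_char_supp[OF _ restrict_coactW assms])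
    (use comodule_resNT[OF comodule_coactW] in \<open>simp add: restrict_to_T_def[abs_def]\<close>)

end

lemma weight_space_Sym:
  "weight_space R (Sym R d) (coactT R d) (wt R a b) = supp_mod R (deg_exps d \<inter> wt_exps a b)"
proof -
  note rc = restricted_coaction[OF mods(3) alg_hom_lin[OF coactSymT_alg_hom]
      coactSymT_stable[of _ "deg_exps d"]]
  have eq: "coactT R d f = tmap R (kT R) (supp_module R (deg_exps d)) id (proj_supp R (deg_exps d)) (coactSymT R f)"
    if "f \<in> supp_mod R (deg_exps d)" for f
    unfolding coactT_def coactSymT_def
    by (rule coact_quotient[OF alg_hom_lin[OF projT_alg_hom] mods(3) supp_mod_carrier[OF that]])
  show ?thesis unfolding Sym_eq
    by (rule weight_space_supp)
      (use rc(3) lin_closed[OF rc(2)] in \<open>simp_all add: eq\<close>)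
qed

text \<open>Each weight of the orbit contributes one monomial. The delicate point is that
  \<open>orbit_wts\<close> is a set: equal weights are summed once, and this has to be matched with
  two exponent vectors.\<close>

lemma refined_eq:
  assumes "i \<le> d" shows "refined R d i = supp_mod R (orbit_exps d i)"
proof -
  let ?m1 = "mexp (d - i) i" and ?m2 = "mexp i (d - i)"
  let ?w1 = "wt R (int (d - i)) (int i)" and ?w2 = "wt R (int i) (int (d - i))"
  let ?ws = "weight_space R (Sym R d) (coactT R d)"
  have deg: "orbit_exps d i \<subseteq> deg_exps d" by (rule orbit_exps_deg[OF assms])
  have ws: "?ws ?w1 = supp_mod R {?m1}" "?ws ?w2 = supp_mod R {?m2}"
    unfolding weight_space_Sym wt_exps_nat using deg by (simp_all add: Int_absorb1 orbit_exps_def)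
  interpret Y: module R "Sym R d" unfolding Sym_eq by (rule mods(5))
  have O: "submodule (supp_mod R (orbit_exps d i)) R (Sym R d)"
    unfolding Sym_eq by (rule supp_mod_sub_submodule[OF deg])
  show ?thesis
  proof (intro Set.set_eqI iffI)
    fix v assume "v \<in> refined R d i"
    then obtain f where f: "f \<in> (\<Pi> t\<in>orbit_wts R d i. ?ws t)" and v: "v = (\<Oplus>\<^bsub>Sym R d\<^esub>t\<in>orbit_wts R d i. f t)"
      unfolding refined_def by auto
    have "f \<in> orbit_wts R d i \<rightarrow> supp_mod R (orbit_exps d i)"
      using f ws by (fastforce simp: orbit_wts_def supp_mod_def orbit_exps_def)
    then show "v \<in> supp_mod R (orbit_exps d i)"
      unfolding v by (rule finsum_submodule(2)[OF O Y.module_axioms])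
  next
    fix v assume v: "v \<in> supp_mod R (orbit_exps d i)"
    \<comment> \<open>If the two weights coincide, the single summand is the truncation to
      \<open>?m1\<close>.\<close>
    define f where "f = (\<lambda>t. if t = ?w1 then proj_supp R {?m1} v else proj_supp R {?m2} v)"
    have p: "proj_supp R {m} v \<in> supp_mod R {m}" for m
      using lin_closed[OF proj_supp_lin supp_mod_carrier[OF v]] by simp
    have c: "proj_supp R {m} v \<in> carrier (Sym R d)" if "m \<in> orbit_exps d i" for m
      using p[of m] that deg by (auto simp: Sym_eq supp_mod_def)
    have vm: "v m \<in> carrier R" for m by (rule mpoly_coeff_closed[OF supp_mod_carrier[OF v]])
    have "v = (\<Oplus>\<^bsub>Sym R d\<^esub>t\<in>orbit_wts R d i. f t)"
    \<comment> \<open>The weights coincide if \<open>d = 2 * i\<close>, but also over the zero ring,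
      where \<open>?m1\<close> and \<open>?m2\<close> may still differ.\<close>
    proof (cases "?w1 = ?w2")
      case True
      have "v m = proj_supp R {?m1} v m" for m
      proof (cases "m \<in> orbit_exps d i \<and> m \<noteq> ?m1")
        case True
        then have "v m = proj_supp R {?m2} v m" by (auto simp: proj_supp_def orbit_exps_def)
        \<comment> \<open>Equal weights have equal weight spaces, so a form supported at
          \<open>?m2\<close> is also supported at \<open>?m1\<close> and has coefficient zero away
          from \<open>?m1\<close>.\<close>
        also have "\<dots> = \<zero>" using supp_modD[of _ R "{?m1}" m] p[of ?m2] ws \<open>?w1 = ?w2\<close> True by auto
        finally show ?thesis using True by (simp add: proj_supp_def)
      qed (use supp_modD[OF v] in \<open>auto simp: proj_supp_def\<close>)
      then have "v = proj_supp R {?m1} v" by (rule ext)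
      then show ?thesis using True c[of ?m1] by (simp add: orbit_wts_def f_def orbit_exps_def)
    next
      case False
      then have "?m1 \<noteq> ?m2" by (auto simp: mexp_eq_iff)
      then have "v m = (proj_supp R {?m1} v \<oplus>\<^bsub>mpoly R\<^esub> proj_supp R {?m2} v) m" for m
        using vm[of m] supp_modD[OF v, of m] by (auto simp: proj_supp_def orbit_exps_def)
      then have "v = proj_supp R {?m1} v \<oplus>\<^bsub>Sym R d\<^esub> proj_supp R {?m2} v" unfolding Sym_eq by (simp add: fun_eq_iff)
      then show ?thesis using False c[of ?m1] c[of ?m2] by (simp add: orbit_wts_def f_def orbit_exps_def)
    qed
    moreover have "f \<in> (\<Pi> t\<in>orbit_wts R d i. ?ws t)"
      using p ws by (auto simp: orbit_wts_def f_def)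
    ultimately show "v \<in> refined R d i" unfolding refined_def by blast
  qed
qed

lemma refined_mod_eq: "i \<le> d \<Longrightarrow> refined_mod R d i = supp_module R (orbit_exps d i)"
  by (simp add: refined_mod_def refined_eq Sym_eq)

lemma comodule_direct_sum_refined:
  assumes d: "d \<ge> 1" "d = 2 * k + 1 \<or> d = 2 * k"
  shows "comodule_direct_sum R (kN R) (comultN R) (counitN R) (Sym R d) (coactN R d) {0..k} (refined R d)
    (\<lambda>i. coactW R (orbit_exps d i))"
  unfolding comodule_direct_sum_def
proof (intro conjI ballI)
  let ?\<delta> = "\<lambda>i. coactW R (orbit_exps d i)"
  \<comment> \<open>The set of all exponents of degree \<open>d\<close> is itself stable under the
    exchange, so the coaction on \<open>Sym R d\<close> is treated like that on an orbit.\<close>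
  note D = deg_exps_swap deg_exps_nonzero[OF d(1)]
  have eqN: "coactN R d f = coactW R (deg_exps d) f" if "f \<in> supp_mod R (deg_exps d)" for f
    by (rule coactN_eq[OF supp_mod_carrier[OF that]])
  have linN: "coactN R d \<in> lin_map R (supp_module R (deg_exps d)) (tensor R (kN R) (supp_module R (deg_exps d)))"
    by (rule lin_cong[OF coactW_lin[OF D] _ mods(5)]) (simp_all add: eqN)
  have inclN: "tmap R (kN R) SV id id (coactN R d f) = coactSymN R f" if "f \<in> supp_mod R (deg_exps d)" for f
    unfolding eqN[OF that] by (rule coactW_incl[OF D that])
  show "comodule R (kN R) (comultN R) (counitN R) (Sym R d) (coactN R d)"
    unfolding Sym_eq
    by (rule subcomodule[OF comodule_coactSymN supp_sub proj_supp_lin proj_supp_id linN inclN])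
  have le: "i \<le> d" if "i \<in> {0..k}" for i using that d by auto
  have "is_direct_sum R (Sym R d) {0..k} (\<lambda>i. supp_mod R (orbit_exps d i))"
    unfolding Sym_eq by (rule direct_sum_supp[OF deg_exps_orbits[OF d(2)]])
  moreover have "(\<Pi>\<^sub>E i\<in>{0..k}. supp_mod R (orbit_exps d i)) = (\<Pi>\<^sub>E i\<in>{0..k}. refined R d i)"
    by (rule PiE_cong) (simp add: refined_eq le)
  ultimately show "is_direct_sum R (Sym R d) {0..k} (refined R d)"
    by (simp add: is_direct_sum_def refined_eq le)
  fix i assume i: "i \<in> {0..k}"
  note O = orbit_exps_swap orbit_exps_nonzero[OF d(1) le[OF i]]
  show "comodule R (kN R) (comultN R) (counitN R) ((Sym R d)\<lparr>carrier := refined R d i\<rparr>) (?\<delta> i)"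
    using comodule_coactW[OF O] refined_mod_eq[OF le[OF i]] by (simp add: refined_mod_def)
  fix w assume "w \<in> refined R d i"
  then have w: "w \<in> supp_mod R (orbit_exps d i)" by (simp add: refined_eq[OF le[OF i]])
  then have wd: "w \<in> supp_mod R (deg_exps d)" using orbit_exps_deg[OF le[OF i]] by (auto simp: supp_mod_def)
  let ?W = "supp_module R (orbit_exps d i)" and ?Y = "supp_module R (deg_exps d)"
  note idl = lin_id(2)
  have j: "id \<in> lin_map R ?W ?Y"
    using submodule_incl(2)[OF supp_mod_sub_submodule[OF orbit_exps_deg[OF le[OF i]]] mods(5)] by simp
  have c: "?\<delta> i w \<in> carrier (tensor R (kN R) ?W)"
    using lin_closed[OF coactW_lin[OF O]] w by simp
  \<comment> \<open>The two elements of \<open>k[N] \<otimes> Sym^d(V)\<close> are compared after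
    embedding into \<open>k[N] \<otimes> Sym(V)\<close>, where both become \<open>coactSymN\<close>
    of \<open>w\<close>.\<close>
  have "tmap R (kN R) SV id id (tmap R (kN R) ?Y id id (?\<delta> i w)) =
      tmap R (kN R) SV id id (?\<delta> i w)"
    by (rule tmap_tmap[OF idl j idl submodule_incl(2)[OF supp_sub mods(4)] mods(2,5,2,5,2,4) c idl
          submodule_incl(2)[OF supp_sub mods(4)]]) simp_all
  also have "\<dots> = tmap R (kN R) SV id id (coactN R d w)"
    by (simp only: coactW_incl[OF O w] inclN[OF wd])
  finally have eq: "tmap R (kN R) SV id id (tmap R (kN R) ?Y id id (?\<delta> i w)) =
      tmap R (kN R) SV id id (coactN R d w)" .
  have t: "tmap R (kN R) ?Y id id (?\<delta> i w) \<in> carrier (tensor R (kN R) ?Y)"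
    by (rule lin_closed[OF tmap_lin[OF idl j mods(2,5,2,5)] c])
  have t': "coactN R d w \<in> carrier (tensor R (kN R) ?Y)"
    using lin_closed[OF linN] wd by simp
  have "tmap R (kN R) ?Y id id (?\<delta> i w) = coactN R d w"
    by (rule incl_tmap_inj[OF mods(2,4) supp_sub proj_supp_lin proj_supp_id t t' eq])
  then show "tmap R (kN R) (Sym R d) id id (?\<delta> i w) = coactN R d w"
    by (simp only: Sym_eq)
qed

end

section \<open>Monomials of the character ring, and the final theorem\<close>

lemma x1_power: "x1 ^ n = Poly_Mapping.single (int n, 0) 1"
  by (induction n) (simp_all add: x1_def mult_single zero_prod_def[symmetric])

lemma x2_power: "x2 ^ n = Poly_Mapping.single (0, int n) 1"
  by (induction n) (simp_all add: x2_def mult_single zero_prod_def[symmetric])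

text \<open>The characters for odd and for even \<open>d\<close> are written with the factors in
  opposite orders.\<close>

lemma x1_x2_power: "x1 ^ a * x2 ^ b = Poly_Mapping.single (int a, int b) 1"
  "x2 ^ b * x1 ^ a = Poly_Mapping.single (int a, int b) 1"
  by (simp_all add: x1_power x2_power mult_single)

theorem theorem1p2:
  fixes A :: "('a, 'z) ring_scheme" and d k :: nat
  assumes "cring A" and "d \<ge> 1" and "d = 2 * k + 1 \<or> d = 2 * k"
  shows "\<exists>\<Delta> :: nat \<Rightarrow> 'a symV \<Rightarrow> ('a kG set \<times> 'a symV \<Rightarrow> 'a) set.
    comodule_direct_sum A (kN A) (comultN A) (counitN A) (Sym A d) (coactN A d)
      {0..k} (refined A d) \<Delta> \<and>
    (d = 2 * k + 1 \<longrightarrow>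
      (\<forall>i\<in>{0..k}. has_char A (refined_mod A d i) (restrict_to_T A (refined_mod A d i) (\<Delta> i))
         (x2 ^ (d - i) * x1 ^ i + x2 ^ i * x1 ^ (d - i)))) \<and>
    (d = 2 * k \<longrightarrow>
      (\<forall>i\<in>{0..<k}. has_char A (refined_mod A d i) (restrict_to_T A (refined_mod A d i) (\<Delta> i))
         (x1 ^ (d - i) * x2 ^ i + x1 ^ i * x2 ^ (d - i))) \<and>
      has_char A (refined_mod A d k) (restrict_to_T A (refined_mod A d k) (\<Delta> k))
        (x1 ^ k * x2 ^ k))"
proof (intro exI conjI)
  let ?\<Delta> = "\<lambda>i. coactW A (orbit_exps d i)"
  show "comodule_direct_sum A (kN A) (comultN A) (counitN A) (Sym A d) (coactN A d) {0..k} (refined A d) ?\<Delta>"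
    by (rule comodule_direct_sum_refined[OF assms])
  have char: "has_char A (refined_mod A d i) (restrict_to_T A (refined_mod A d i) (?\<Delta> i)) \<chi>"
    if "i \<le> d" "\<And>a b. Poly_Mapping.lookup \<chi> (a, b) = (if orbit_exps d i \<inter> wt_exps a b = {} then 0 else 1)" for i \<chi>
    unfolding refined_mod_eq[OF assms(1) that(1)]
    by (rule has_char_coactW[OF assms(1) orbit_exps_swap orbit_exps_nonzero[OF assms(2) that(1)] that(2)])
  \<comment> \<open>Distinct exponents keep the two monomials from merging into one with coefficient
    2. For odd \<open>d\<close> they are always distinct, and for even \<open>d\<close> they are
    distinct when \<open>i < k\<close>.\<close>
  have lookup2: "Poly_Mapping.lookup (Poly_Mapping.single (int i, int (d - i)) 1 + Poly_Mapping.single (int (d - i), int i) 1 :: laurent2) (a, b) =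
      (if orbit_exps d i \<inter> wt_exps a b = {} then 0 else 1)" if "i \<noteq> d - i" for i a b
    using that by (auto simp: lookup_add lookup_single when_def orbit_exps_def wt_exps_def)
  show "d = 2 * k + 1 \<longrightarrow>
      (\<forall>i\<in>{0..k}. has_char A (refined_mod A d i) (restrict_to_T A (refined_mod A d i) (?\<Delta> i))
         (x2 ^ (d - i) * x1 ^ i + x2 ^ i * x1 ^ (d - i)))"
    unfolding x1_x2_power by (intro impI ballI char lookup2) auto
  show "d = 2 * k \<longrightarrow>
      (\<forall>i\<in>{0..<k}. has_char A (refined_mod A d i) (restrict_to_T A (refined_mod A d i) (?\<Delta> i))
         (x1 ^ (d - i) * x2 ^ i + x1 ^ i * x2 ^ (d - i))) \<and>
      has_char A (refined_mod A d k) (restrict_to_T A (refined_mod A d k) (?\<Delta> k)) (x1 ^ k * x2 ^ k)"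
    unfolding x1_x2_power
  proof (intro impI conjI ballI)
    assume dk: "d = 2 * k"
    show "has_char A (refined_mod A d i) (restrict_to_T A (refined_mod A d i) (?\<Delta> i))
        (Poly_Mapping.single (int (d - i), int i) 1 + Poly_Mapping.single (int i, int (d - i)) 1)"
      if "i \<in> {0..<k}" for i
      by (rule char) (use lookup2[of i] that dk in \<open>auto simp: add.commute\<close>)
    \<comment> \<open>For \<open>d = 2 * k\<close> and \<open>i = k\<close> the orbit is a single
      exponent vector, so its monomial is counted once.\<close>
    show "has_char A (refined_mod A d k) (restrict_to_T A (refined_mod A d k) (?\<Delta> k)) (Poly_Mapping.single (int k, int k) 1)"
      by (rule char) (auto simp: dk lookup_single when_def orbit_exps_def wt_exps_def)
  qed
qed

end
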